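(* Let $0<q<p<\infty$ and $\omega\in\widehat{\mathcal{D}}$. Then there exists a constant $C=C(\omega,q)>0$ such that $$|f(z)|^q\le C\int_{\mathbb{D}}|f(\zeta)|^qK^\omega_z(\zeta)\,\omega(\zeta)\,dA(\zeta),\quad f\in A^q_\omega,\ z\in\mathbb{D}.$$ Moreover, if $f\in A^p_\omega$, $\varepsilon>0$ and $E=E(\varepsilon,q,f)$ is the set of points $z\in\mathbb{D}$ for which $$|f(z)|^q\le\varepsilon\int_{\mathbb{D}}|f(\zeta)|^qK^\omega_z(\zeta)\,\omega(\zeta)\,dA(\zeta),$$ then there exists a constant $C=C(p/q,\omega)$ such that $$\int_E|f(z)|^p\omega(z)\,dA(z)\le(C\varepsilon)^{p/q}\|f\|_{A^p_\omega}^p.$$ Therefore $\varepsilon>0$ may be chosen such that $G=\mathbb{D}\setminus E$ satisfies $$\int_G|f(z)|^p\omega(z)\,dA(z)\ge\frac12\|f\|_{A^p_\omega}^p,\quad f\in A^p_\omega,$$ and thus $G$ is a dominating set for $f\in A^p_\omega$ if $\varepsilon>0$ is sufficiently small.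
   Context: $\mathbb{D}=\{z\in\mathbb{C}:|z|<1\}$, $\mathcal{H}(\mathbb{D})$ is the space of analytic functions in $\mathbb{D}$, and $dA(z)=\frac{dx\,dy}{\pi}$. A weight is a function $\omega:\mathbb{D}\to[0,\infty)$ integrable over $\mathbb{D}$ (with respect to $dA$); it is radial if $\omega(z)=\omega(|z|)$. $A^p_\omega$ consists of $f\in\mathcal{H}(\mathbb{D})$ with $\|f\|_{A^p_\omega}^p=\int_{\mathbb{D}}|f|^p\omega\,dA<\infty$. For a radial weight $\omega$ put $\widehat\omega(z)=\int_{|z|}^1\omega(s)\,ds$; it is assumed that $\widehat\omega(z)>0$ for all $z\in\mathbb{D}$. A radial weight $\omega$ belongs to $\widehat{\mathcal{D}}$ if there exists $C\ge1$ such that $\widehat\omega(r)\le C\widehat\omega(\frac{1+r}{2})$ for all $0\le r<1$. The reproducing kernels of the Hilbert space $A^2_\omega$ induced by a radial weight are $B^\omega_z(\zeta)=\sum_{n=0}^\infty\frac{(\overline z\zeta)^n}{2\omega_{2n+1}}$, where $\omega_x=\int_0^1s^x\omega(s)\,ds$, and $$K^\omega_z(\zeta)=\frac{|B^\omega_z(\zeta)|^2}{\|B^\omega_z\|_{A^2_\omega}^2},\quad z,\zeta\in\mathbb{D}.$$ A measurable set $G=G(f)\subset\mathbb{D}$ is a dominating set for $f\in A^p_\omega$ if there exists $\delta=\delta(G)>0$ such that $\int_G|f|^p\omega\,dA\ge\delta\|f\|_{A^p_\omega}^p$. Notation such as $C=C(\omega,q)$ means that the constant depends only on the listed parameters. 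*)

theory Defs
  imports "HOL-Complex_Analysis.Complex_Analysis"
begin

abbreviation unit_disc :: "complex set" ("\<bbbD>")
  where "\<bbbD> \<equiv> ball 0 1"

text \<open>The measure \<open>dA = dx dy / \<pi>\<close>, living on the unit disc only. Hence integrals with respect
  to it never see values outside the disc, and \<open>sets dA\<close> consists of the Lebesgue measurable subsets
  of the disc.\<close>

definition dA :: "complex measure"
  where "dA = density (lebesgue_on \<bbbD>) (\<lambda>_. ennreal (1 / pi))"

definition is_weight :: "(complex \<Rightarrow> real) \<Rightarrow> bool"
  where "is_weight \<omega> \<longleftrightarrow> (\<forall>z\<in>\<bbbD>. 0 \<le> \<omega> z) \<and> integrable dA \<omega>"

definition radial :: "(complex \<Rightarrow> real) \<Rightarrow> bool"
  where "radial \<omega> \<longleftrightarrow> (\<forall>z\<in>\<bbbD>. \<omega> z = \<omega> (of_real (cmod z)))"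

definition weight_hat :: "(complex \<Rightarrow> real) \<Rightarrow> complex \<Rightarrow> real"
  where "weight_hat \<omega> z = (LINT s:{cmod z..<1}|lebesgue. \<omega> (of_real s))"

text \<open>A radial weight may have \<open>\<integral>\<^sub>0\<^sup>1 \<omega>(s) ds = \<infinity>\<close>, because of a singularity at the origin. The doubling
  condition at \<open>r = 0\<close> excludes this; here such weights are excluded because the Bochner integral
  then gives \<open>weight_hat \<omega> 0 = 0\<close>, so that the positivity requirement fails.\<close>

definition D_hat :: "(complex \<Rightarrow> real) set"
  where "D_hat = {\<omega>. is_weight \<omega> \<and> radial \<omega> \<and> (\<forall>z\<in>\<bbbD>. 0 < weight_hat \<omega> z) \<and>
    (\<exists>C\<ge>1. \<forall>r. 0 \<le> r \<and> r < 1 \<longrightarrow>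
       weight_hat \<omega> (of_real r) \<le> C * weight_hat \<omega> (of_real ((1 + r) / 2)))}"

definition bergman_space :: "real \<Rightarrow> (complex \<Rightarrow> real) \<Rightarrow> (complex \<Rightarrow> complex) set"
  where "bergman_space p \<omega> =
    {f. f holomorphic_on \<bbbD> \<and> integrable dA (\<lambda>z. cmod (f z) powr p * \<omega> z)}"

definition bergman_norm :: "real \<Rightarrow> (complex \<Rightarrow> real) \<Rightarrow> (complex \<Rightarrow> complex) \<Rightarrow> real"
  where "bergman_norm p \<omega> f = (LINT z|dA. cmod (f z) powr p * \<omega> z) powr (1 / p)"

definition weight_moment :: "(complex \<Rightarrow> real) \<Rightarrow> real \<Rightarrow> real"
  where "weight_moment \<omega> x = (LINT s:{0..<1}|lebesgue. s powr x * \<omega> (of_real s))"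

definition bergman_kernel :: "(complex \<Rightarrow> real) \<Rightarrow> complex \<Rightarrow> complex \<Rightarrow> complex"
  where "bergman_kernel \<omega> z \<zeta> =
    (\<Sum>n. (cnj z * \<zeta>) ^ n / of_real (2 * weight_moment \<omega> (2 * real n + 1)))"

definition berezin_kernel :: "(complex \<Rightarrow> real) \<Rightarrow> complex \<Rightarrow> complex \<Rightarrow> real"
  where "berezin_kernel \<omega> z \<zeta> =
    (cmod (bergman_kernel \<omega> z \<zeta>))\<^sup>2 / (bergman_norm 2 \<omega> (bergman_kernel \<omega> z))\<^sup>2"

definition dominating_set ::
    "real \<Rightarrow> (complex \<Rightarrow> real) \<Rightarrow> (complex \<Rightarrow> complex) \<Rightarrow> complex set \<Rightarrow> bool"
  where "dominating_set p \<omega> f G \<longleftrightarrow> G \<in> sets dA \<and>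
    (\<exists>\<delta>>0. (LINT z:G|dA. cmod (f z) powr p * \<omega> z) \<ge> \<delta> * bergman_norm p \<omega> f powr p)"

definition exceptional_set ::
    "(complex \<Rightarrow> real) \<Rightarrow> real \<Rightarrow> real \<Rightarrow> (complex \<Rightarrow> complex) \<Rightarrow> complex set"
  where "exceptional_set \<omega> \<epsilon> q f =
    {z\<in>\<bbbD>. cmod (f z) powr q
        \<le> \<epsilon> * (LINT \<zeta>|dA. cmod (f \<zeta>) powr q * berezin_kernel \<omega> z \<zeta> * \<omega> \<zeta>)}"

end

theory Submission
  imports Defs
begin

text \<open>Write \<open>B_z(\<zeta>) = k(cnj z \<zeta>)\<close> with \<open>k(x) = \<Sum> x^n / (2 \<omega>_{2n+1})\<close>, so that \<open>\<parallel>B_z\<parallel>^2 = k(|z|^2)\<close>.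
  The doubling condition gives \<open>k(r^2) \<approx> k(r) \<approx> 1 / ((1 - r) F(r))\<close> and
  \<open>\<Sum> (x^n / (2 \<omega>_{2n+1}))^2 \<lesssim> 1 / ((1 - x) F(x)^2)\<close>, where \<open>F\<close> is the tail integral of the weight.

  For the pointwise estimate, removing zeros by Blaschke factors and applying Cauchy's formula to
  a branch of the \<open>q\<close>-th power gives \<open>|g(z)|^q \<lesssim> \<parallel>g\<parallel>^q / ((1 - |z|) F(|z|))\<close> for all \<open>q > 0\<close>. This is applied to
  \<open>g = f B_z^n\<close> with \<open>n q \<ge> 2\<close>, using \<open>|B_z| \<le> k(|z|) \<lesssim> k(|z|^2) = B_z(z)\<close>.

  For the second part, on the exceptional set \<open>|f|^p\<close> is at most \<open>\<epsilon>^(p/q)\<close> times the power \<open>p/q\<close> of the Berezin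
  transform of \<open>|f|^q\<close>, so it suffices that the Berezin transform is bounded on \<open>L^t(\<omega> dA)\<close> for \<open>t > 1\<close>.
  This follows from Schur's test with a small negative power of \<open>F\<close>: since the test function is
  radial and the kernel is quadratic in \<open>B_z\<close>, Parseval's identity reduces the test to
  one-dimensional integrals.\<close>

subsection \<open>Area measure in polar form\<close>

text \<open>Two obstacles shape the argument. The weight is merely measurable and may vanish on
  whole annuli, so there is no pointwise lower bound for it: every estimate goes through the tail
  \<open>F\<close>, and doubling is used as polynomial control of \<open>F x / F y\<close> by
  \<open>(1 - x) / (1 - y)\<close>. Integrals of powers of \<open>F\<close> are then read off from
  the distribution of \<open>F\<close> under its own measure, where \<open>F\<close> behaves at
  worst like a uniformly distributed variable. An integer power with \<open>n q \<ge> 2\<close>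
  replaces it, and the surplus \<open>n q - 2\<close> is paid for by the comparison of
  \<open>k(|z|)\<close> with \<open>k(|z|^2)\<close>. In the Schur test a constant test function is
  just out of reach: the column estimate would integrate \<open>1 / F\<close> from 0 up to a point,
  which grows logarithmically. A small negative power of \<open>F\<close> removes the logarithm, and
  it costs nothing in the rows as long as the exponents that occur stay below 1.\<close>

lemma lborel_complex: "distr lborel borel (\<lambda>(x,y). Complex x y) = (lborel :: complex measure)"
proof (rule lborel_eqI[symmetric])
  fix l u :: complex
  have m: "(\<lambda>(x,y). Complex x y) \<in> borel \<rightarrow>\<^sub>M (borel :: complex measure)"
    unfolding Complex_eq split_beta
    by (intro borel_measurable_continuous_onI continuous_intros)
  assume "\<And>b. b \<in> Basis \<Longrightarrow> l \<bullet> b \<le> u \<bullet> b"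
  from this[of 1] this[of \<i>] have le: "Re l \<le> Re u" "Im l \<le> Im u"
    by (simp_all add: Basis_complex_def)
  have "(\<lambda>(x,y). Complex x y) -` box l u = box (Re l, Im l) (Re u, Im u)"
    by (auto simp: box_def Basis_complex_def Basis_prod_def)
  then show "emeasure (distr lborel borel (\<lambda>(x,y). Complex x y)) (box l u) = (\<Prod>b\<in>Basis. (u-l) \<bullet> b)"
    using m le
    by (simp add: emeasure_distr)
       (subst emeasure_lborel_box_eq, auto simp: Basis_complex_def Basis_prod_def prod.union_disjoint)
qed simp

text \<open>Both orders of integration are kept because the two kinds of shear below freeze
  different coordinates.\<close>

lemma nn_integral_lborel_complex:
  assumes "f \<in> borel_measurable borel"
  shows "(\<integral>\<^sup>+z. f z \<partial>lborel) = (\<integral>\<^sup>+x. (\<integral>\<^sup>+y. f (Complex x y) \<partial>lborel) \<partial>lborel)"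
    and "(\<integral>\<^sup>+z. f z \<partial>lborel) = (\<integral>\<^sup>+y. (\<integral>\<^sup>+x. f (Complex x y) \<partial>lborel) \<partial>lborel)"
proof -
  have m: "(\<lambda>(x,y). Complex x y) \<in> borel \<rightarrow>\<^sub>M (borel :: complex measure)"
    unfolding Complex_eq split_beta
    by (intro borel_measurable_continuous_onI continuous_intros)
  have *: "(\<integral>\<^sup>+z. f z \<partial>lborel) = (\<integral>\<^sup>+p. f (case p of (x,y) \<Rightarrow> Complex x y) \<partial>(lborel \<Otimes>\<^sub>M lborel))"
    using m assms unfolding lborel_prod by (subst lborel_complex[symmetric], subst nn_integral_distr) auto
  have mf: "(\<lambda>p. f (case p of (x,y) \<Rightarrow> Complex x y)) \<in> borel_measurable (lborel \<Otimes>\<^sub>M lborel)"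
    using m assms unfolding lborel_prod by simp
  show "(\<integral>\<^sup>+z. f z \<partial>lborel) = (\<integral>\<^sup>+x. (\<integral>\<^sup>+y. f (Complex x y) \<partial>lborel) \<partial>lborel)"
    unfolding * by (subst lborel.nn_integral_fst[OF mf, symmetric]) simp
  show "(\<integral>\<^sup>+z. f z \<partial>lborel) = (\<integral>\<^sup>+y. (\<integral>\<^sup>+x. f (Complex x y) \<partial>lborel) \<partial>lborel)"
    unfolding * using lborel_pair.nn_integral_snd[OF mf] by (simp only: prod.case)
qed

lemma nn_integral_lborel_translate:
  fixes f :: "real \<Rightarrow> ennreal"
  assumes "f \<in> borel_measurable borel"
  shows "(\<integral>\<^sup>+x. f (x + a) \<partial>lborel) = (\<integral>\<^sup>+x. f x \<partial>lborel)"
  using nn_integral_real_affine[OF assms, of 1 a] by (simp add: add.commute)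

text \<open>A shear moves every horizontal (or every vertical) line along itself by an amount that
  is constant on that line, so integrating along these lines first reduces it to translation
  invariance on the real line.\<close>

lemma nn_integral_shear:
  fixes f :: "complex \<Rightarrow> ennreal"
  assumes f [measurable]: "f \<in> borel_measurable borel"
  shows "(\<integral>\<^sup>+z. f (z + of_real (a * Im z)) \<partial>lborel) = (\<integral>\<^sup>+z. f z \<partial>lborel)"
    and "(\<integral>\<^sup>+z. f (z + \<i> * of_real (a * Re z)) \<partial>lborel) = (\<integral>\<^sup>+z. f z \<partial>lborel)"
proof -
  have c: "(\<lambda>x. Complex x y) \<in> borel \<rightarrow>\<^sub>M borel" "(\<lambda>x. Complex y x) \<in> borel \<rightarrow>\<^sub>M borel" for y
    unfolding Complex_eq by measurable
  have m: "(\<lambda>x. f (Complex x y)) \<in> borel_measurable borel" "(\<lambda>x. f (Complex y x)) \<in> borel_measurable borel" for y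
    using measurable_compose[OF c(1) f] measurable_compose[OF c(2) f] by auto
  have "Complex x y + of_real (a * y) = Complex (x + a * y) y" for x y
    by (simp add: complex_eq_iff)
  then show "(\<integral>\<^sup>+z. f (z + of_real (a * Im z)) \<partial>lborel) = (\<integral>\<^sup>+z. f z \<partial>lborel)"
    by (subst (1 2) nn_integral_lborel_complex(2)) (simp_all add: nn_integral_lborel_translate[OF m(1)])
  have "Complex x y + \<i> * of_real (a * x) = Complex x (y + a * x)" for x y
    by (simp add: complex_eq_iff)
  then show "(\<integral>\<^sup>+z. f (z + \<i> * of_real (a * Re z)) \<partial>lborel) = (\<integral>\<^sup>+z. f z \<partial>lborel)"
    by (subst (1 2) nn_integral_lborel_complex(1)) (simp_all add: nn_integral_lborel_translate[OF m(2)])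
qed

text \<open>Non-real rotations factor into shears, which preserve area. The factorisation divides by
  \<open>Im v\<close>, so real \<open>u\<close> needs a detour through two non-real
  rotations.\<close>

lemma nn_integral_rotate:
  fixes f :: "complex \<Rightarrow> ennreal"
  assumes f [measurable]: "f \<in> borel_measurable borel" and u: "cmod u = 1"
  shows "(\<integral>\<^sup>+z. f (u * z) \<partial>lborel) = (\<integral>\<^sup>+z. f z \<partial>lborel)"
proof -
  have *: "(\<integral>\<^sup>+z. g (v * z) \<partial>lborel) = (\<integral>\<^sup>+z. g z \<partial>lborel)"
    if g [measurable]: "g \<in> borel_measurable borel" and v: "cmod v = 1" "Im v \<noteq> 0" for v g
  proof -
    \<comment> \<open>For \<open>v = cis \<theta>\<close> this is minus the tangent of half the
      angle; the middle shear has slope \<open>Im v\<close>, the sine.\<close>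
    define a where "a = - (1 - Re v) / Im v"
    define s where "s = (\<lambda>z. z + complex_of_real (a * Im z))"
    define r where "r = (\<lambda>z. z + \<i> * complex_of_real (Im v * Re z))"
    have [measurable]: "s \<in> borel \<rightarrow>\<^sub>M borel" "r \<in> borel \<rightarrow>\<^sub>M borel"
      unfolding s_def r_def by measurable
    have n: "Re v * Re v + Im v * Im v = 1"
      using v(1) by (simp add: cmod_def power2_eq_square)
    \<comment> \<open>a rotation is a product of three shears\<close>
    have "v * z = s (r (s z))" for z
    proof -
      have a: "a * Im v = Re v - 1" using v by (simp add: a_def)
      have "a * (Re v + 1) = - Im v"
        using n v by (simp add: a_def field_simps)
      then have b: "a * Re v = - Im v - a" by (simp add: algebra_simps)
      have 1: "Re z + a * Im z + a * (Im z + Im v * (Re z + a * Im z)) = Re v * Re z - Im v * Im z"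
      proof -
        have "Re z + a * Im z + a * (Im z + Im v * (Re z + a * Im z))
           = Re z + 2 * (a * Im z) + (a * Im v) * Re z + (a * Im v) * (a * Im z)"
          by (simp add: algebra_simps)
        also have "\<dots> = Re v * Re z + a * Im z + (a * Re v) * Im z" unfolding a by (simp add: algebra_simps)
        also have "\<dots> = Re v * Re z - Im v * Im z" unfolding b by (simp add: algebra_simps)
        finally show ?thesis .
      qed
      have 2: "Im z + Im v * (Re z + a * Im z) = Re v * Im z + Im v * Re z"
      proof -
        have "Im z + Im v * (Re z + a * Im z) = Im z + Im v * Re z + (a * Im v) * Im z"
          by (simp add: algebra_simps)
        then show ?thesis unfolding a by (simp add: algebra_simps)
      qed
      show ?thesis
        using 1 2 by (simp add: complex_eq_iff s_def r_def)
    qed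
    then have "(\<integral>\<^sup>+z. g (v * z) \<partial>lborel) = (\<integral>\<^sup>+z. g (s (r (s z))) \<partial>lborel)" by simp
    also have "\<dots> = (\<integral>\<^sup>+z. g (s (r z)) \<partial>lborel)"
      using nn_integral_shear(1)[of "\<lambda>z. g (s (r z))" a] by (simp add: s_def)
    also have "\<dots> = (\<integral>\<^sup>+z. g (s z) \<partial>lborel)"
      using nn_integral_shear(2)[of "\<lambda>z. g (s z)" "Im v"] by (simp add: r_def)
    also have "\<dots> = (\<integral>\<^sup>+z. g z \<partial>lborel)"
      using nn_integral_shear(1)[of g a] by (simp add: s_def)
    finally show ?thesis .
  qed
  show ?thesis
  proof (cases "Im u = 0")
    case True
    \<comment> \<open>Here \<open>u\<close> is 1 or -1; both factors \<open>- \<i> * u\<close> and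
      \<open>\<i>\<close> are non-real, so the case already treated applies twice.\<close>
    have "u * z = (- \<i> * u) * (\<i> * z)" for z
      by (simp add: complex_eq_iff)
    then have "(\<integral>\<^sup>+z. f (u * z) \<partial>lborel) = (\<integral>\<^sup>+z. f ((- \<i> * u) * (\<i> * z)) \<partial>lborel)"
      by (intro nn_integral_cong arg_cong[where f = f])
    also have "\<dots> = (\<integral>\<^sup>+z. f ((- \<i> * u) * z) \<partial>lborel)"
      by (rule *[of "\<lambda>z. f ((- \<i> * u) * z)"]) auto
    also have "\<dots> = (\<integral>\<^sup>+z. f z \<partial>lborel)"
    proof (rule *[OF f])
      show "Im (- \<i> * u) \<noteq> 0" using True u by (auto simp: cmod_def)
    qed (use u in \<open>simp add: norm_mult\<close>)
    finally show ?thesis .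
  qed (use * u in auto)
qed

text \<open>This is the radial half of polar coordinates. Finite measures on the line are determined
  by open upper rays; the mass of a ray is the normalised area \<open>1 - y\<^sup>2\<close> of an
  annulus, which is also the integral of \<open>2 * s\<close> from \<open>y\<close> to 1.\<close>

lemma distr_cmod_disc:
  "distr (density lborel (\<lambda>z. indicator \<bbbD> z * ennreal (1 / pi))) borel cmod
    = density lborel (\<lambda>s. indicator {0..<1} s * ennreal (2 * s))" (is "?M = ?N")
proof (rule measure_eqI_lessThan)
  have d: "(\<lambda>z::complex. ennreal (1 / pi) * indicator \<bbbD> z) \<in> borel_measurable borel"
    by measurable simp
  have fin: "emeasure ?M A \<le> 1" if "A \<in> sets borel" for A
  proof -
    have "emeasure ?M A \<le> emeasure ?M UNIV" by (rule emeasure_mono) auto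
    also have "\<dots> = ennreal (1/pi) * emeasure lborel \<bbbD>"
      by (simp add: emeasure_distr, subst emeasure_density)
         (simp_all add: nn_integral_cmult_indicator mult.commute d)
    also have "\<dots> = 1"
      by (simp add: emeasure_ball unit_ball_vol_2 flip: ennreal_mult')
    finally show ?thesis .
  qed
  show "emeasure ?M {x<..} < \<infinity>" for x
    using fin[of "{x<..}"] by (simp add: order.strict_trans1)
  show "emeasure ?M {x<..} = emeasure ?N {x<..}" for x
  proof -
    \<comment> \<open>Clamping the endpoint to the unit interval covers all rays at once. For
      negative \<open>x\<close> the annulus loses only the origin, a null set.\<close>
    define y where "y = min 1 (max 0 x)"
    have y: "0 \<le> y" "y \<le> 1" by (auto simp: y_def)
    have "emeasure ?M {x<..} = ennreal (1/pi) * emeasure lborel (\<bbbD> \<inter> {z. x < cmod z})"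
      by (simp add: emeasure_distr vimage_def, subst emeasure_density)
         (simp_all add: nn_integral_cmult_indicator mult.commute mult.left_commute d
            flip: indicator_inter_arith)
    also have "emeasure lborel (\<bbbD> \<inter> {z. x < cmod z}) = emeasure lborel (\<bbbD> - cball 0 y)"
    proof (cases "x < 0")
      case True
      then have "y = 0" by (auto simp: y_def)
      have "emeasure lborel (\<bbbD> - {0}) = emeasure lborel (\<bbbD> :: complex set)"
        by (subst emeasure_Diff) (auto simp: )
      moreover have "\<bbbD> \<inter> {z. x < cmod z} = \<bbbD>" using True by (auto intro: less_le_trans[OF _ norm_ge_zero])
      ultimately show ?thesis using \<open>y = 0\<close> by simp
    next
      case False
      then have "\<bbbD> \<inter> {z. x < cmod z} = \<bbbD> - cball 0 y" by (auto simp: y_def)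
      then show ?thesis by simp
    qed
    also have "\<dots> = ennreal (pi - pi * y\<^sup>2)"
    proof -
      \<comment> \<open>Replacing the closed disc by the open one changes a circle, a null set, and
        makes the area formula for balls applicable.\<close>
      have "emeasure lborel (\<bbbD> - cball 0 y) = emeasure lborel (ball 0 1 - ball (0::complex) y)"
      proof (rule emeasure_eq_AE)
        have "sphere (0::complex) y \<in> null_sets lborel"
          using negligible_sphere[of "0::complex" y]
          by (simp add: negligible_iff_null_sets null_sets_completion_iff)
        then have "AE z in lborel. z \<notin> sphere (0::complex) y" by (rule AE_not_in)
        then show "AE z in lborel. (z \<in> \<bbbD> - cball 0 y) = (z \<in> ball 0 1 - ball (0::complex) y)"
          by eventually_elim auto
      qed auto
      also have "\<dots> = ennreal pi - ennreal (pi * y\<^sup>2)"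
        using y by (subst emeasure_Diff) (auto simp: emeasure_ball unit_ball_vol_2 mult.commute)
      finally show ?thesis using y by (simp add: ennreal_minus)
    qed
    also have "ennreal (1/pi) * \<dots> = ennreal (1 - y\<^sup>2)"
      by (simp add: diff_divide_distrib flip: ennreal_mult')
    also have "\<dots> = (\<integral>\<^sup>+s. ennreal (2 * s) * indicator {y..1} s \<partial>lborel)"
      using y by (subst nn_integral_FTC_Icc[where F = "\<lambda>s. s\<^sup>2"])
        (auto intro!: derivative_eq_intros)
    also have "\<dots> = (\<integral>\<^sup>+s. indicator {0..<1} s * ennreal (2 * s) * indicator {x<..} s \<partial>lborel)"
    proof (rule nn_integral_cong_AE)
      have "AE s in lborel. s \<noteq> y" "AE s in lborel. s \<noteq> (1::real)" by (rule AE_lborel_singleton)+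
      then show "AE s in lborel. ennreal (2 * s) * indicator {y..1} s
          = indicator {0..<1} s * ennreal (2 * s) * indicator {x<..} s"
        by eventually_elim (auto simp: indicator_def y_def split: if_splits)
    qed
    also have "\<dots> = emeasure ?N {x<..}"
      by (simp add: emeasure_density)
    finally show ?thesis .
  qed
qed auto

subsection \<open>Means over circles\<close>

lemma nn_integral_unit_interval:
  fixes f :: "real \<Rightarrow> real"
  assumes f: "continuous_on UNIV f" and nonneg: "\<And>t. 0 \<le> f t" and I: "(f has_integral I) {0..1}"
  shows "(\<integral>\<^sup>+t. ennreal (f t) * indicator {0..1} t \<partial>lborel) = ennreal I"
proof -
  have [measurable]: "f \<in> borel_measurable borel"
    using f by (rule borel_measurable_continuous_onI)
  have "((\<lambda>t. if t \<in> {0..1} then f t else 0) has_integral I) UNIV"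
    using I by (simp only: has_integral_restrict_UNIV)
  then have "(\<integral>\<^sup>+t. ennreal (if t \<in> {0..1} then f t else 0) \<partial>lborel) = ennreal I"
    by (intro nn_integral_has_integral_lborel) (auto simp: nonneg)
  moreover have "ennreal (f t) * indicator {0..1} t = ennreal (if t \<in> {0..1} then f t else 0)" for t
    by simp
  ultimately show ?thesis by (simp only:)
qed

lemma has_integral_cis:
  fixes k :: int
  shows "((\<lambda>t. cis (2 * pi * k * t)) has_integral (if k = 0 then 1 else 0)) {0..1}"
proof (cases "k = 0")
  case True
  then show ?thesis using has_integral_const_real[of "1::complex" 0 1] by simp
next
  case False
  define c where "c = 2 * pi * of_int k * \<i>"
  have "c \<noteq> 0" using False by (simp add: c_def)
  have "((\<lambda>t. exp (c * of_real t) / c) has_vector_derivative exp (c * of_real t)) (at t within {0..1})" for t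
    using \<open>c \<noteq> 0\<close> by (auto intro!: derivative_eq_intros has_vector_derivative_real_field)
  then have "((\<lambda>t. exp (c * of_real t)) has_integral (exp (c * of_real 1) / c - exp (c * of_real 0) / c)) {0..1}"
    by (intro fundamental_theorem_of_calculus) auto
  moreover have "exp c = 1"
    unfolding c_def using exp_integer_2pi[of "of_int k"] by (simp add: mult_ac)
  moreover have "exp (c * of_real t) = cis (2 * pi * k * t)" for t
    by (simp add: c_def cis_conv_exp mult_ac)
  ultimately show ?thesis using False by simp
qed

lemma parseval_polynomial:
  fixes c :: "nat \<Rightarrow> complex"
  shows "((\<lambda>t. (cmod (\<Sum>n<M. c n * (cis (2 * pi * t) * x) ^ n))\<^sup>2) has_integral
    (\<Sum>n<M. (cmod (c n) * cmod x ^ n)\<^sup>2)) {0..1}"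
proof -
  define d where "d = (\<lambda>n. c n * x ^ n)"
  have eq: "complex_of_real ((cmod (\<Sum>n<M. c n * (cis (2 * pi * t) * x) ^ n))\<^sup>2) =
     (\<Sum>n<M. \<Sum>m<M. d n * cnj (d m) * cis (2 * pi * of_int (int n - int m) * t))" for t
  proof -
    have "c n * (cis (2 * pi * t) * x) ^ n = d n * cis (2 * pi * real n * t)" for n
      using Complex.DeMoivre[of "2 * pi * t" n] by (simp add: d_def power_mult_distrib mult_ac)
    then have "complex_of_real ((cmod (\<Sum>n<M. c n * (cis (2 * pi * t) * x) ^ n))\<^sup>2) =
      (\<Sum>n<M. \<Sum>m<M. (d n * cis (2 * pi * real n * t)) * cnj (d m * cis (2 * pi * real m * t)))"
      by (simp only: complex_norm_square sum_product cnj_sum)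
    also have "\<dots> = (\<Sum>n<M. \<Sum>m<M. d n * cnj (d m) * cis (2 * pi * of_int (int n - int m) * t))"
    proof (intro sum.cong refl)
      fix n m
      have "cis (2 * pi * real n * t) * cnj (cis (2 * pi * real m * t)) = cis (2 * pi * of_int (int n - int m) * t)"
        by (simp add: cis_cnj cis_mult algebra_simps)
      moreover have "(d n * cis (2 * pi * real n * t)) * cnj (d m * cis (2 * pi * real m * t)) =
          d n * cnj (d m) * (cis (2 * pi * real n * t) * cnj (cis (2 * pi * real m * t)))"
        unfolding complex_cnj_mult by (simp only: mult_ac)
      ultimately show "(d n * cis (2 * pi * real n * t)) * cnj (d m * cis (2 * pi * real m * t)) =
          d n * cnj (d m) * cis (2 * pi * of_int (int n - int m) * t)"
        by (simp only:)
    qed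
    finally show ?thesis .
  qed
  have "((\<lambda>t. \<Sum>n<M. \<Sum>m<M. d n * cnj (d m) * cis (2 * pi * of_int (int n - int m) * t)) has_integral
     (\<Sum>n<M. \<Sum>m<M. d n * cnj (d m) * (if int n - int m = 0 then 1 else 0))) {0..1}"
    by (intro has_integral_sum has_integral_mult_right has_integral_cis) auto
  also have "(\<Sum>n<M. \<Sum>m<M. d n * cnj (d m) * (if int n - int m = 0 then 1 else 0)) = of_real (\<Sum>n<M. (cmod (c n) * cmod x ^ n)\<^sup>2)"
  proof -
    have "(\<Sum>m<M. d n * cnj (d m) * (if int n - int m = 0 then 1 else 0)) = of_real ((cmod (c n) * cmod x ^ n)\<^sup>2)"
      if "n < M" for n
    proof -
      have "(\<Sum>m<M. d n * cnj (d m) * (if int n - int m = 0 then 1 else 0)) = (\<Sum>m<M. if m = n then d n * cnj (d n) else 0)"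
        by (intro sum.cong) auto
      also have "\<dots> = of_real ((cmod (d n))\<^sup>2)"
        using that unfolding complex_norm_square by simp
      finally show ?thesis by (simp add: d_def norm_mult norm_power)
    qed
    then show ?thesis by simp
  qed
  finally have "((\<lambda>t. complex_of_real ((cmod (\<Sum>n<M. c n * (cis (2 * pi * t) * x) ^ n))\<^sup>2)) has_integral
    of_real (\<Sum>n<M. (cmod (c n) * cmod x ^ n)\<^sup>2)) {0..1}"
    unfolding eq .
  from has_integral_linear[OF this bounded_linear_Re] show ?thesis by (simp only: o_def Re_complex_of_real)
qed

text \<open>Absolute summability at the radius \<open>cmod x\<close> makes the partial sums converge
  uniformly on the circle with a common bound, so the identity for polynomials passes to the limit
  by dominated convergence. The left side is a nonnegative integral because it later appears inside
  an application of Tonelli's theorem.\<close>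

lemma parseval_circle:
  fixes c :: "nat \<Rightarrow> complex"
  assumes s: "summable (\<lambda>n. cmod (c n) * cmod x ^ n)"
  shows "(\<integral>\<^sup>+t. ennreal ((cmod (\<Sum>n. c n * (cis (2 * pi * t) * x) ^ n))\<^sup>2) * indicator {0..1} t \<partial>lborel)
    = ennreal (\<Sum>n. (cmod (c n) * cmod x ^ n)\<^sup>2)"
    and "summable (\<lambda>n. (cmod (c n) * cmod x ^ n)\<^sup>2)"
proof -
  define P where "P = (\<lambda>M t. \<Sum>n<M. c n * (cis (2 * pi * t) * x) ^ n)"
  define S where "S = (\<lambda>t. \<Sum>n. c n * (cis (2 * pi * t) * x) ^ n)"
  define B where "B = (\<Sum>n. cmod (c n) * cmod x ^ n)"
  have u: "uniform_limit UNIV P S sequentially"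
    unfolding P_def S_def
    by (rule Weierstrass_m_test[OF _ s]) (simp add: norm_mult norm_power)
  have contP: "continuous_on A (P M)" for A M
    unfolding P_def by (intro continuous_intros)
  have contS: "continuous_on UNIV S"
    by (rule uniform_limit_theorem[OF _ u]) (simp_all add: contP)
  have PB: "cmod (P M t) \<le> B" for M t
  proof -
    have "cmod (P M t) \<le> (\<Sum>n<M. cmod (c n) * cmod x ^ n)"
      unfolding P_def by (rule sum_norm_le) (simp add: norm_mult norm_power)
    also have "\<dots> \<le> B"
      unfolding B_def by (rule sum_le_suminf[OF s]) auto
    finally show ?thesis .
  qed
  have B0: "0 \<le> B" using PB[of 0 0] order_trans[OF norm_ge_zero] by blast
  have sq: "(cmod (c n) * cmod x ^ n)\<^sup>2 \<le> B * (cmod (c n) * cmod x ^ n)" for n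
  proof -
    have "cmod (c n) * cmod x ^ n \<le> B"
      unfolding B_def using sum_le_suminf[OF s, of "{n}"] by simp
    then show ?thesis unfolding power2_eq_square by (rule mult_right_mono) simp
  qed
  show s2: "summable (\<lambda>n. (cmod (c n) * cmod x ^ n)\<^sup>2)"
    by (rule summable_comparison_test'[OF summable_mult[OF s, of B], of 0]) (use sq in auto)
  have lim: "(\<lambda>M. P M t) \<longlonglongrightarrow> S t" for t
    using tendsto_uniform_limitI[OF u, of t] by simp
  have "((\<lambda>t. (cmod (S t))\<^sup>2) has_integral (\<Sum>n. (cmod (c n) * cmod x ^ n)\<^sup>2)) {0..1}"
  proof (rule has_integral_dominated_convergence)
    show "((\<lambda>t. (cmod (P M t))\<^sup>2) has_integral (\<Sum>n<M. (cmod (c n) * cmod x ^ n)\<^sup>2)) {0..1}" for M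
      unfolding P_def by (rule parseval_polynomial)
    show "(\<lambda>_. B\<^sup>2) integrable_on {0..1::real}" by (rule integrable_const_ivl)
    show "\<forall>t\<in>{0..1}. norm ((cmod (P M t))\<^sup>2) \<le> B\<^sup>2" for M
      using PB B0 by (auto intro!: power_mono)
    show "\<forall>t\<in>{0..1}. (\<lambda>M. (cmod (P M t))\<^sup>2) \<longlonglongrightarrow> (cmod (S t))\<^sup>2"
      using lim by (intro ballI tendsto_intros)
    show "(\<lambda>M. \<Sum>n<M. (cmod (c n) * cmod x ^ n)\<^sup>2) \<longlonglongrightarrow> (\<Sum>n. (cmod (c n) * cmod x ^ n)\<^sup>2)"
      by (rule summable_LIMSEQ[OF s2])
  qed
  then have "(\<integral>\<^sup>+t. ennreal ((cmod (S t))\<^sup>2) * indicator {0..1} t \<partial>lborel)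
    = ennreal (\<Sum>n. (cmod (c n) * cmod x ^ n)\<^sup>2)"
    by (intro nn_integral_unit_interval) (auto intro!: continuous_intros contS)
  then show "(\<integral>\<^sup>+t. ennreal ((cmod (\<Sum>n. c n * (cis (2 * pi * t) * x) ^ n))\<^sup>2) * indicator {0..1} t \<partial>lborel)
    = ennreal (\<Sum>n. (cmod (c n) * cmod x ^ n)\<^sup>2)"
    by (simp only: S_def)
qed

text \<open>Zeros are removed as in a finite Blaschke product scaled to radius
  \<open>\<rho>\<close>: the factor \<open>(w - a) ^ n\<close> is exchanged for the
  \<open>n\<close>-th power of \<open>(\<rho>\<^sup>2 - cnj a * w) / \<rho>\<close>, which has the
  same modulus on the circle, at least that modulus inside, and no zero in the closed disc. The
  induction is on the number of distinct zeros. It is finite because \<open>g\<close> has no zero on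
  the circle but one inside, and hence is not constant.\<close>

lemma zero_free_majorant:
  assumes "g holomorphic_on ball 0 R" "0 < \<rho>" "\<rho> < R" "\<forall>z\<in>sphere 0 \<rho>. g z \<noteq> 0"
  shows "\<exists>h. h holomorphic_on ball 0 R \<and> (\<forall>z\<in>cball 0 \<rho>. h z \<noteq> 0) \<and>
    (\<forall>z\<in>cball 0 \<rho>. cmod (g z) \<le> cmod (h z)) \<and> (\<forall>z\<in>sphere 0 \<rho>. cmod (h z) = cmod (g z))"
  using assms(1,4)
proof (induction "card {z\<in>cball 0 \<rho>. g z = 0}" arbitrary: g rule: less_induct)
  case (less g)
  note \<rho> = assms(2,3)
  show ?case
  proof (cases "\<forall>z\<in>cball 0 \<rho>. g z \<noteq> 0")
    case True
    then show ?thesis using less.prems by (intro exI[of _ g]) auto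
  next
    case False
    then obtain a where a: "a \<in> cball 0 \<rho>" "g a = 0" by auto
    then have a\<rho>: "cmod a < \<rho>" using less.prems(2) by (force simp: sphere_def)
    then have aR: "a \<in> ball 0 R" using \<rho> by simp
    have g\<rho>: "g (of_real \<rho>) \<noteq> 0" using less.prems(2) \<rho> by simp
    have nc: "\<not> g constant_on ball 0 R"
    proof
      assume "g constant_on ball 0 R"
      then obtain c where c: "\<And>w. w \<in> ball 0 R \<Longrightarrow> g w = c" by (auto simp: constant_on_def)
      have "g (of_real \<rho>) = g a" using c[of "of_real \<rho>"] c[OF aR] \<rho> by simp
      with g\<rho> a(2) show False by simp
    qed
    have fin: "finite {z\<in>cball 0 \<rho>. g z = 0}"
      by (rule holomorphic_compact_finite_zeros[OF less.prems(1) _ _ _ _ nc]) (use \<rho> in auto)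
    obtain g1 r n where n: "0 < n" "0 < r" "ball a r \<subseteq> ball 0 R" "g1 holomorphic_on ball a r"
        and g1: "\<And>w. w \<in> ball a r \<Longrightarrow> g w = (w - a) ^ n * g1 w"
        and g1_nz: "\<And>w. w \<in> ball a r \<Longrightarrow> g1 w \<noteq> 0"
      by (rule holomorphic_factor_zero_nonconstant[OF less.prems(1) open_ball connected_ball aR a(2) nc]) (rule that)
    \<comment> \<open>The quotient of \<open>g\<close> by \<open>(w - a) ^ n\<close>, with the
      singularity at \<open>a\<close> filled in by the local factor \<open>g1\<close>.\<close>
    define g2 where "g2 = (\<lambda>w. if w \<in> ball a r then g1 w else g w / (w - a) ^ n)"
    define b where "b = (\<lambda>w. (of_real (\<rho>\<^sup>2) - cnj a * w) / of_real \<rho>)"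
    have g2: "g w = (w - a) ^ n * g2 w" for w
    proof (cases "w \<in> ball a r")
      case False
      then have "w \<noteq> a" using n(2) by auto
      then show ?thesis unfolding g2_def using False by simp
    qed (simp add: g2_def g1)
    have "g2 holomorphic_on ball a r \<union> (ball 0 R - {a})"
    proof (rule holomorphic_on_Un)
      show "g2 holomorphic_on ball a r"
        using n(4) by (rule holomorphic_transform) (simp add: g2_def)
      have "(\<lambda>w. g w / (w - a) ^ n) holomorphic_on ball 0 R - {a}"
        by (intro holomorphic_intros holomorphic_on_subset[OF less.prems(1)]) auto
      then show "g2 holomorphic_on ball 0 R - {a}"
        by (rule holomorphic_transform) (auto simp: g2_def g1)
    qed auto
    moreover have "ball 0 R \<subseteq> ball a r \<union> (ball 0 R - {a})" using n by auto
    ultimately have "g2 holomorphic_on ball 0 R" by (rule holomorphic_on_subset)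
    then have hol: "(\<lambda>w. g2 w * b w ^ n) holomorphic_on ball 0 R"
      unfolding b_def using \<rho> by (intro holomorphic_intros) auto
    have b_nz: "b w \<noteq> 0" if "w \<in> cball 0 \<rho>" for w
    proof -
      have "cmod (cnj a * w) \<le> cmod a * \<rho>" using that by (simp add: norm_mult mult_left_mono)
      also have "\<dots> < \<rho>\<^sup>2" using a\<rho> \<rho> by (simp add: power2_eq_square)
      finally have "cnj a * w \<noteq> of_real (\<rho>\<^sup>2)" by (intro notI) (simp add: norm_of_real del: of_real_power)
      then show ?thesis using \<rho> by (simp add: b_def)
    qed
    \<comment> \<open>One identity serves twice: its right side is nonnegative for
      \<open>cmod w \<le> \<rho>\<close> and zero for \<open>cmod w = \<rho>\<close>.\<close>
    have b_id: "(cmod (b w))\<^sup>2 - (cmod (w - a))\<^sup>2 = (\<rho>\<^sup>2 - (cmod a)\<^sup>2) * (\<rho>\<^sup>2 - (cmod w)\<^sup>2) / \<rho>\<^sup>2" for w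
    proof -
      have "(cmod (b w))\<^sup>2 = (cmod (of_real (\<rho>\<^sup>2) - cnj a * w))\<^sup>2 / \<rho>\<^sup>2"
        by (simp add: b_def norm_divide power_divide)
      moreover have "(cmod (of_real (\<rho>\<^sup>2) - cnj a * w))\<^sup>2 - \<rho>\<^sup>2 * (cmod (w - a))\<^sup>2
          = (\<rho>\<^sup>2 - (cmod a)\<^sup>2) * (\<rho>\<^sup>2 - (cmod w)\<^sup>2)"
        unfolding cmod_power2 by (simp add: algebra_simps power2_eq_square)
      ultimately show ?thesis using \<rho> by (simp add: field_simps)
    qed
    have b_le: "cmod (w - a) \<le> cmod (b w)" if "w \<in> cball 0 \<rho>" for w
    proof -
      have "0 \<le> (\<rho>\<^sup>2 - (cmod a)\<^sup>2) * (\<rho>\<^sup>2 - (cmod w)\<^sup>2) / \<rho>\<^sup>2"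
        using that a\<rho> by (intro divide_nonneg_nonneg mult_nonneg_nonneg) (auto intro!: power_mono)
      then have "(cmod (w - a))\<^sup>2 \<le> (cmod (b w))\<^sup>2" using b_id[of w] by linarith
      then show ?thesis by (rule power2_le_imp_le) simp
    qed
    have b_eq: "cmod (w - a) = cmod (b w)" if "w \<in> sphere 0 \<rho>" for w
    proof -
      have "(cmod (w - a))\<^sup>2 = (cmod (b w))\<^sup>2" using b_id[of w] that by simp
      then show ?thesis by (simp only: power2_eq_iff_nonneg norm_ge_zero)
    qed
    \<comment> \<open>No zero is created, since \<open>b\<close> has none in the closed disc, and
      \<open>a\<close> itself disappears, since \<open>g1 a\<close> is nonzero. This is the strict
      decrease for the induction.\<close>
    have zeros: "{z\<in>cball 0 \<rho>. g2 z * b z ^ n = 0} \<subseteq> {z\<in>cball 0 \<rho>. g z = 0} - {a}"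
    proof
      fix w assume "w \<in> {z\<in>cball 0 \<rho>. g2 z * b z ^ n = 0}"
      then have w: "w \<in> cball 0 \<rho>" "g2 w = 0" using b_nz by auto
      then have "g w = 0" by (subst g2) simp
      moreover have "w \<noteq> a" using w(2) g1_nz[of a] n by (auto simp: g2_def)
      ultimately show "w \<in> {z\<in>cball 0 \<rho>. g z = 0} - {a}" using w by simp
    qed
    have "card {z\<in>cball 0 \<rho>. g2 z * b z ^ n = 0} < card {z\<in>cball 0 \<rho>. g z = 0}"
      using zeros a by (intro psubset_card_mono[OF fin]) blast
    moreover have "\<forall>z\<in>sphere 0 \<rho>. g2 z * b z ^ n \<noteq> 0"
    proof
      fix w :: complex assume w: "w \<in> sphere 0 \<rho>"
      then have "g w \<noteq> 0" "b w \<noteq> 0" using less.prems(2) b_nz[of w] by auto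
      moreover from this(1) have "g2 w \<noteq> 0" by (subst (asm) g2) simp
      ultimately show "g2 w * b w ^ n \<noteq> 0" by simp
    qed
    ultimately obtain h where h: "h holomorphic_on ball 0 R" "\<forall>z\<in>cball 0 \<rho>. h z \<noteq> 0"
      "\<forall>z\<in>cball 0 \<rho>. cmod (g2 z * b z ^ n) \<le> cmod (h z)"
      "\<forall>z\<in>sphere 0 \<rho>. cmod (h z) = cmod (g2 z * b z ^ n)"
      using less.hyps[OF _ hol] by blast
    have "cmod (g z) \<le> cmod (h z)" if "z \<in> cball 0 \<rho>" for z
    proof -
      have "cmod (g z) = cmod (g2 z) * cmod (z - a) ^ n" unfolding g2[of z] by (simp add: norm_mult norm_power)
      also have "\<dots> \<le> cmod (g2 z) * cmod (b z) ^ n"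
        using b_le[OF that] by (intro mult_left_mono power_mono) auto
      also have "\<dots> \<le> cmod (h z)" using h(3) that by (simp add: norm_mult norm_power)
      finally show ?thesis .
    qed
    moreover have "cmod (h z) = cmod (g z)" if "z \<in> sphere 0 \<rho>" for z
      using h(4) that b_eq[OF that] unfolding g2[of z] by (simp add: norm_mult norm_power)
    ultimately show ?thesis using h by blast
  qed
qed

text \<open>The zero-free majorant \<open>h\<close> has a holomorphic logarithm, so its
  \<open>q\<close>-th power exists for every \<open>q > 0\<close>, also below 1, and Cauchy's
  formula applies to it. Bounding the Cauchy kernel by its maximum is crude compared with the
  Poisson kernel, but it suffices because later \<open>z\<close> keeps a distance of at least
  \<open>(1 - cmod z) / 2\<close> from the circle.\<close>

lemma circle_mean_bound:
  fixes g :: "complex \<Rightarrow> complex"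
  assumes hol: "g holomorphic_on ball 0 R" and \<zeta>: "0 < cmod \<zeta>" "cmod \<zeta> < R"
    and nz: "\<And>w. cmod w = cmod \<zeta> \<Longrightarrow> g w \<noteq> 0" and z: "cmod z < cmod \<zeta>" and q: "0 < q"
  shows "ennreal (cmod (g z) powr q) \<le> ennreal (cmod \<zeta> / (cmod \<zeta> - cmod z)) *
    (\<integral>\<^sup>+t. ennreal (cmod (g (cis (2 * pi * t) * \<zeta>)) powr q) * indicator {0..1} t \<partial>lborel)"
proof -
  define \<rho> where "\<rho> = cmod \<zeta>"
  have \<rho>: "0 < \<rho>" "\<rho> < R" "cmod z < \<rho>" using \<zeta> z by (auto simp: \<rho>_def)
  obtain h where h: "h holomorphic_on ball 0 R" "\<forall>z\<in>cball 0 \<rho>. h z \<noteq> 0"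
    "\<forall>z\<in>cball 0 \<rho>. cmod (g z) \<le> cmod (h z)" "\<forall>z\<in>sphere 0 \<rho>. cmod (h z) = cmod (g z)"
    using zero_free_majorant[OF hol \<rho>(1,2)] nz by (auto simp: \<rho>_def)
  \<comment> \<open>By compactness, \<open>h\<close> is zero-free on a slightly larger disc. That
    open disc is contractible, which gives the logarithm, and it contains the closed disc on which
    Cauchy's formula is used.\<close>
  have "open (h -` (- {0}) \<inter> ball 0 R)"
    using continuous_open_preimage[OF holomorphic_on_imp_continuous_on[OF h(1)] open_ball, of "- {0}"]
    by (simp add: Int_commute open_Compl)
  moreover have "cball 0 \<rho> \<subseteq> h -` (- {0}) \<inter> ball 0 R" using h(2) \<rho> by auto
  ultimately obtain e where e: "e > 0" "(\<Union>x\<in>cball 0 \<rho>. ball x e) \<subseteq> h -` (- {0}) \<inter> ball 0 R"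
    using compact_subset_open_imp_ball_epsilon_subset[OF compact_cball] by metis
  have sub: "ball 0 (\<rho> + e) \<subseteq> h -` (- {0}) \<inter> ball 0 R"
  proof
    fix w :: complex assume w: "w \<in> ball 0 (\<rho> + e)"
    show "w \<in> h -` (- {0}) \<inter> ball 0 R"
    proof (cases "cmod w \<le> \<rho>")
      case True
      then show ?thesis using h(2) \<rho> by auto
    next
      case False
      \<comment> \<open>The radial projection of \<open>w\<close> to the circle of radius
        \<open>\<rho>\<close>; its distance to \<open>w\<close> is \<open>cmod w - \<rho>\<close>,
        below \<open>e\<close>.\<close>
      define v where "v = of_real (\<rho> / cmod w) * w"
      have w0: "cmod w > 0" using False \<rho> by linarith
      then have "v \<in> cball 0 \<rho>" using \<rho> w0 by (simp add: v_def norm_mult norm_divide)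
      moreover have "dist v w < e"
      proof -
        have "v - w = of_real (\<rho> / cmod w - 1) * w" by (simp add: v_def algebra_simps)
        then have "dist v w = \<bar>\<rho> / cmod w - 1\<bar> * cmod w" by (simp only: dist_norm norm_mult norm_of_real)
        also have "\<dots> = cmod w - \<rho>" using False \<rho> w0 by (simp add: abs_if field_simps)
        finally show ?thesis using w by simp
      qed
      ultimately show ?thesis using e(2) by force
    qed
  qed
  have "contractible (ball (0::complex) (\<rho> + e))" by (intro convex_imp_contractible convex_ball)
  then obtain L where L: "L holomorphic_on ball 0 (\<rho> + e)" "\<And>w. w \<in> ball 0 (\<rho> + e) \<Longrightarrow> h w = exp (L w)"
    using contractible_imp_holomorphic_log[of h "ball 0 (\<rho> + e)"] h(1) sub
    by (smt (verit) Compl_iff Int_iff holomorphic_on_subset insertI1 subset_iff vimageE)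
  define F where "F = (\<lambda>w. exp (of_real q * L w))"
  have F: "cmod (F w) = cmod (h w) powr q" if "w \<in> ball 0 (\<rho> + e)" for w
  proof -
    have "cmod (F w) = exp (q * Re (L w))" by (simp add: F_def norm_exp_eq_Re)
    also have "\<dots> = exp (Re (L w)) powr q" by (simp add: powr_def mult.commute)
    finally show ?thesis using L(2)[OF that] by (simp add: norm_exp_eq_Re)
  qed
  have \<zeta>0: "\<zeta> \<noteq> 0" using \<zeta> by auto
  \<comment> \<open>Rotating by \<open>u\<close> makes the standard circle path start at
    \<open>\<zeta>\<close>, so that it matches the parametrisation
    \<open>cis (2 * pi * t) * \<zeta>\<close> of the statement.\<close>
  define u where "u = \<zeta> / of_real \<rho>"
  have u: "cmod u = 1" "u \<noteq> 0" "of_real \<rho> * u = \<zeta>" using \<zeta>0 by (auto simp: u_def \<rho>_def norm_divide)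
  define F1 where "F1 = (\<lambda>w. F (w * u))"
  have F1_hol: "F1 holomorphic_on ball 0 (\<rho> + e)"
  proof -
    have "F holomorphic_on ball 0 (\<rho> + e)" unfolding F_def by (intro holomorphic_intros L(1))
    then show ?thesis unfolding F1_def
      by (intro holomorphic_on_compose_gen[of "\<lambda>w. w * u" _ F, unfolded o_def] holomorphic_intros)
         (auto simp: norm_mult u)
  qed
  define w0 where "w0 = z / u"
  have w0: "cmod w0 = cmod z" "F1 w0 = F z" using u by (auto simp: w0_def norm_divide F1_def)
  have sub': "cball 0 \<rho> \<subseteq> ball 0 (\<rho> + e)" "ball 0 \<rho> \<subseteq> ball 0 (\<rho> + e)" using e by auto
  have "((\<lambda>w. F1 w / (w - w0)) has_contour_integral 2 * of_real pi * \<i> * F1 w0) (circlepath 0 \<rho>)"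
  proof (rule Cauchy_integral_circlepath)
    show "continuous_on (cball 0 \<rho>) F1"
      using F1_hol holomorphic_on_subset[OF F1_hol sub'(1)] holomorphic_on_imp_continuous_on by blast
    show "F1 holomorphic_on ball 0 \<rho>" by (rule holomorphic_on_subset[OF F1_hol sub'(2)])
    show "cmod (w0 - 0) < \<rho>" using w0 \<rho> by simp
  qed
  then have I: "((\<lambda>t. F1 (circlepath 0 \<rho> t) / (circlepath 0 \<rho> t - w0) *
      vector_derivative (circlepath 0 \<rho>) (at t within {0..1})) has_integral 2 * of_real pi * \<i> * F1 w0) {0..1}"
    unfolding has_contour_integral_def .
  define G where "G = (\<lambda>t. cmod (F (cis (2 * pi * t) * \<zeta>)))"
  have circ: "circlepath 0 \<rho> t = of_real \<rho> * cis (2 * pi * t)" for t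
    by (simp add: circlepath_def part_circlepath_def linepath_def cis_conv_exp mult_ac)
  have in_ball: "cis (2 * pi * t) * \<zeta> \<in> ball 0 (\<rho> + e)" for t
    using e by (simp add: norm_mult \<rho>_def)
  have contG: "continuous_on UNIV G"
    unfolding G_def F_def
    by (intro continuous_intros continuous_on_compose2[OF holomorphic_on_imp_continuous_on[OF L(1)]])
       (use in_ball in auto)
  then have Gint: "(G has_integral integral {0..1} G) {0..1}"
    by (intro integrable_integral integrable_continuous_real) (auto intro: continuous_on_subset)
  have "2 * pi * cmod (F z) = cmod (2 * of_real pi * \<i> * F1 w0)" using w0 by (simp add: norm_mult)
  also have "\<dots> \<le> 2 * pi * \<rho> / (\<rho> - cmod z) * integral {0..1} G"
  proof -
    have "((\<lambda>t. 2 * pi * \<rho> / (\<rho> - cmod z) * G t) has_integral (2 * pi * \<rho> / (\<rho> - cmod z) * integral {0..1} G)) {0..1}"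
      by (rule has_integral_mult_right[OF Gint])
    then have Gm: "(\<lambda>t. 2 * pi * \<rho> / (\<rho> - cmod z) * G t) integrable_on {0..1}"
      "integral {0..1} (\<lambda>t. 2 * pi * \<rho> / (\<rho> - cmod z) * G t) = 2 * pi * \<rho> / (\<rho> - cmod z) * integral {0..1} G"
      by (auto simp: has_integral_iff)
    have "norm (integral {0..1} (\<lambda>t. F1 (circlepath 0 \<rho> t) / (circlepath 0 \<rho> t - w0) *
      vector_derivative (circlepath 0 \<rho>) (at t within {0..1})))
      \<le> integral {0..1} (\<lambda>t. 2 * pi * \<rho> / (\<rho> - cmod z) * G t)"
    proof (rule integral_norm_bound_integral[OF _ Gm(1)])
      show "(\<lambda>t. F1 (circlepath 0 \<rho> t) / (circlepath 0 \<rho> t - w0) *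
        vector_derivative (circlepath 0 \<rho>) (at t within {0..1})) integrable_on {0..1}"
        using I by blast
      fix t :: real assume t: "t \<in> {0..1}"
      have "vector_derivative (circlepath 0 \<rho>) (at t within {0..1}) = 2 * of_real pi * \<i> * of_real \<rho> * exp (2 * of_real pi * \<i> * t)"
        using t by (subst vector_derivative_circlepath01) auto
      then have vd: "cmod (vector_derivative (circlepath 0 \<rho>) (at t within {0..1})) = 2 * pi * \<rho>"
        using \<rho> by (simp add: norm_mult norm_exp_eq_Re)
      have den: "\<rho> - cmod z \<le> cmod (circlepath 0 \<rho> t - w0)"
        using norm_triangle_ineq2[of "circlepath 0 \<rho> t" w0] w0 \<rho> by (simp add: circ norm_mult)
      have "F1 (circlepath 0 \<rho> t) = F (cis (2 * pi * t) * \<zeta>)"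
        unfolding F1_def circ u(3)[symmetric] by (simp add: mult_ac)
      then have "cmod (F1 (circlepath 0 \<rho> t) / (circlepath 0 \<rho> t - w0) *
        vector_derivative (circlepath 0 \<rho>) (at t within {0..1})) = G t / cmod (circlepath 0 \<rho> t - w0) * (2 * pi * \<rho>)"
        unfolding norm_mult norm_divide vd G_def by simp
      also have "\<dots> \<le> G t / (\<rho> - cmod z) * (2 * pi * \<rho>)"
        using den \<rho> by (intro mult_right_mono divide_left_mono) (auto simp: G_def intro!: mult_pos_pos)
      finally show "cmod (F1 (circlepath 0 \<rho> t) / (circlepath 0 \<rho> t - w0) *
        vector_derivative (circlepath 0 \<rho>) (at t within {0..1})) \<le> 2 * pi * \<rho> / (\<rho> - cmod z) * G t"
        by (simp add: mult_ac)
    qed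
    then show ?thesis using I Gm(2) by (simp add: has_integral_iff)
  qed
  finally have "(2 * pi) * cmod (F z) \<le> (2 * pi) * (\<rho> / (\<rho> - cmod z) * integral {0..1} G)" by simp
  then have Fz: "cmod (F z) \<le> \<rho> / (\<rho> - cmod z) * integral {0..1} G"
    by (rule mult_left_le_imp_le) simp
  have "cmod (g z) powr q \<le> cmod (h z) powr q" using h(3) \<rho> q by (intro powr_mono2) auto
  also have "\<dots> = cmod (F z)" using F[of z] \<rho> e by simp
  also note Fz
  finally have "ennreal (cmod (g z) powr q) \<le> ennreal (\<rho> / (\<rho> - cmod z)) * ennreal (integral {0..1} G)"
    using \<rho> by (subst ennreal_mult'[symmetric]) (auto intro!: ennreal_leI)
  also have "ennreal (integral {0..1} G) = (\<integral>\<^sup>+t. ennreal (G t) * indicator {0..1} t \<partial>lborel)"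
    by (rule nn_integral_unit_interval[OF contG _ Gint, symmetric]) (simp add: G_def)
  also have "\<dots> = (\<integral>\<^sup>+t. ennreal (cmod (g (cis (2 * pi * t) * \<zeta>)) powr q) * indicator {0..1} t \<partial>lborel)"
  proof (rule nn_integral_cong)
    fix t
    have "cmod (h (cis (2 * pi * t) * \<zeta>)) = cmod (g (cis (2 * pi * t) * \<zeta>))"
      using h(4) by (simp add: norm_mult \<rho>_def)
    then have "G t = cmod (g (cis (2 * pi * t) * \<zeta>)) powr q"
      unfolding G_def by (simp add: F[OF in_ball])
    then show "ennreal (G t) * indicator {0..1} t = ennreal (cmod (g (cis (2 * pi * t) * \<zeta>)) powr q) * indicator {0..1} t"
      by (simp only:)
  qed
  finally show ?thesis unfolding \<rho>_def .
qed

subsection \<open>Tails of finite measures\<close>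

lemma power_le_fact_exp:
  fixes z :: real
  assumes "0 \<le> z"
  shows "z ^ p \<le> fact p * exp z"
proof -
  have "z ^ p /\<^sub>R fact p \<le> exp z"
    unfolding exp_def using assms sum_le_suminf[OF summable_exp_generic[of z], of "{p}"] by simp
  then show ?thesis by (simp add: field_simps)
qed

lemma dyadic_below:
  fixes x R :: real
  assumes "0 < x" "x \<le> R"
  shows "\<exists>j::nat. R / 2 ^ (j + 1) < x \<and> x \<le> R / 2 ^ j"
proof -
  have ex: "\<exists>n::nat. R / 2 ^ n < x"
    using real_arch_pow_inv[of "x / R" "1/2"] assms by (auto simp: field_simps power_divide)
  define n where "n = (LEAST n::nat. R / 2 ^ n < x)"
  have n: "R / 2 ^ n < x" unfolding n_def using ex by (rule LeastI_ex)
  then obtain j where j: "n = Suc j" using assms by (cases n) auto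
  have "\<not> R / 2 ^ j < x" using not_less_Least[of j "\<lambda>n. R / 2 ^ n < x"] j unfolding n_def by auto
  then show ?thesis using n j by (intro exI[of _ j]) auto
qed

lemma dyadic_above:
  fixes x R :: real
  assumes "0 < R" "R \<le> x"
  shows "\<exists>j::nat. R * 2 ^ j \<le> x \<and> x \<le> R * 2 ^ (j + 1)"
proof -
  obtain j where "x / 2 ^ (j + 1) < R" "R \<le> x / 2 ^ j" using dyadic_below[OF assms] by auto
  then show ?thesis by (intro exI[of _ j]) (auto simp: field_simps)
qed

locale real_finite_measure = finite_measure M for M :: "real measure" +
  assumes sets_M [simp, measurable_cong]: "sets M = sets borel"
begin

definition tail :: "real \<Rightarrow> real"
  where "tail r = measure M {r..}"

lemma tail_nonneg [simp]: "0 \<le> tail r"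
  by (simp add: tail_def)

lemma tail_antimono: "r \<le> s \<Longrightarrow> tail s \<le> tail r"
  unfolding tail_def by (rule finite_measure_mono) auto

lemma tail_measurable [measurable]: "tail \<in> borel_measurable borel"
proof -
  have "mono (\<lambda>s. - tail s)" by (intro monoI) (simp add: tail_antimono)
  then have "(\<lambda>s. - (- tail s)) \<in> borel_measurable borel"
    by (intro borel_measurable_uminus borel_measurable_mono)
  then show ?thesis by simp
qed

text \<open>The sublevel set is closed under going up, so it is an increasing union of rays
  \<open>{s n..}\<close> whose endpoints lie in the set. Each ray has measure
  \<open>tail (s n)\<close>, hence at most \<open>y\<close>, and continuity from below
  concludes.\<close>

lemma measure_tail_le:
  assumes "0 \<le> y"
  shows "measure M {s. tail s \<le> y} \<le> y"
proof -
  let ?A = "{s. tail s \<le> y}"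
  have up: "s' \<in> ?A" if "s \<in> ?A" "s \<le> s'" for s s'
    using tail_antimono[OF that(2)] that(1) by auto
  have "\<exists>X. incseq X \<and> (\<forall>n::nat. measure M (X n) \<le> y \<and> X n \<in> sets M) \<and> ?A = (\<Union>n. X n)"
  proof (cases "?A = {}")
    case True
    then show ?thesis using assms by (intro exI[of _ "\<lambda>_. {}"]) (auto simp: incseq_def)
  next
    case False
    \<comment> \<open>The endpoints are constant if the minimum is attained, approach the infimum
      from above if it is finite and not attained, and are \<open>- real n\<close> if the set is
      unbounded below, in which case it is the whole line.\<close>
    obtain s :: "nat \<Rightarrow> real" where s: "decseq s" "\<And>n. s n \<in> ?A" "\<And>x. x \<in> ?A \<Longrightarrow> \<exists>n. s n \<le> x"
    proof (cases "\<exists>a\<in>?A. \<forall>x\<in>?A. a \<le> x")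
      case True
      then obtain a where "a \<in> ?A" "\<And>x. x \<in> ?A \<Longrightarrow> a \<le> x" by blast
      then show ?thesis using that[of "\<lambda>_. a"] by (auto simp: decseq_def)
    next
      case no_min: False
      show ?thesis
      proof (cases "bdd_below ?A")
        case True
        let ?s = "\<lambda>n. Inf ?A + 1 / real (Suc n)"
        have notin: "Inf ?A \<notin> ?A" using no_min cInf_lower[OF _ True] by blast
        have gt: "x \<in> ?A \<longleftrightarrow> Inf ?A < x" for x
        proof
          assume "x \<in> ?A"
          then show "Inf ?A < x" using cInf_lower[OF _ True, of x] notin by (metis order_le_imp_less_or_eq)
        next
          assume "Inf ?A < x"
          then obtain a where "a \<in> ?A" "a < x" using cInf_lessD[OF False] by blast
          then show "x \<in> ?A" using up[of a x] by simp
        qed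
        show ?thesis
        proof (rule that[of ?s])
          show "decseq ?s" by (auto simp: decseq_def frac_le)
          show "?s n \<in> ?A" for n by (rule gt[THEN iffD2]) simp
          fix x assume "x \<in> ?A"
          then have "Inf ?A < x" by (rule gt[THEN iffD1])
          then have "0 < x - Inf ?A" by simp
          then obtain n where "1 / real (Suc n) < x - Inf ?A" by (rule nat_approx_posE)
          then show "\<exists>n. ?s n \<le> x" by (intro exI[of _ n]) auto
        qed
      next
        case unb: False
        have all: "x \<in> ?A" for x
        proof -
          obtain a where "a \<in> ?A" "\<not> x \<le> a" using unb unfolding bdd_below_def by blast
          then show ?thesis using up[of a x] by simp
        qed
        show ?thesis
        proof (rule that[of "\<lambda>n. - real n"])
          show "\<exists>n. - real n \<le> x" for x
            using real_arch_simple[of "-x"] by (auto simp: minus_le_iff)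
        qed (use all in \<open>auto simp: decseq_def\<close>)
      qed
    qed
    have "?A = (\<Union>n. {s n..})"
    proof (intro set_eqI iffI)
      fix x assume "x \<in> (\<Union>n. {s n..})"
      then obtain n where "s n \<le> x" by auto
      then show "x \<in> ?A" by (rule up[OF s(2)])
    next
      fix x assume "x \<in> ?A"
      then show "x \<in> (\<Union>n. {s n..})" using s(3) by auto
    qed
    moreover have "incseq (\<lambda>n. {s n..})" using s(1) by (auto simp: incseq_def decseq_def intro: order_trans)
    moreover have "measure M {s n..} \<le> y" for n using s(2)[of n] by (simp add: tail_def)
    ultimately show ?thesis by (intro exI[of _ "\<lambda>n. {s n..}"]) auto
  qed
  then obtain X :: "nat \<Rightarrow> real set" where X: "incseq X" "\<And>n. measure M (X n) \<le> y" "\<And>n. X n \<in> sets M" "?A = (\<Union>n. X n)"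
    by blast
  have "(\<lambda>n. measure M (X n)) \<longlonglongrightarrow> measure M (\<Union>n. X n)"
    using X by (intro finite_Lim_measure_incseq) auto
  then show ?thesis using X(2,4) by (auto intro: LIMSEQ_le_const2)
qed

text \<open>The value distribution of the tail function under \<open>M\<close> is dominated by Lebesgue measure,
  so integrals of functions of \<open>tail\<close> are estimated by summing over dyadic levels.\<close>

lemma nn_integral_tail_layers:
  assumes f: "AE s in M. f s = 0 \<or> (\<exists>j. tail s \<le> y j \<and> f s \<le> ennreal (c j))"
    and nonneg: "\<And>j. 0 \<le> c j" "\<And>j. 0 \<le> y j" and summable: "summable (\<lambda>j. c j * y j)"
  shows "(\<integral>\<^sup>+s. f s \<partial>M) \<le> ennreal (\<Sum>j. c j * y j)"
proof -
  have "f s \<le> (\<Sum>j. ennreal (c j) * indicator {s. tail s \<le> y j} s)"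
    if "f s = 0 \<or> (\<exists>j. tail s \<le> y j \<and> f s \<le> ennreal (c j))" for s
    using that
  proof
    assume "\<exists>j. tail s \<le> y j \<and> f s \<le> ennreal (c j)"
    then obtain j where j: "tail s \<le> y j" "f s \<le> ennreal (c j)" by blast
    have "(\<Sum>i\<in>{j}. ennreal (c i) * indicator {s. tail s \<le> y i} s) \<le> (\<Sum>j. ennreal (c j) * indicator {s. tail s \<le> y j} s)"
      by (rule sum_le_suminf) auto
    moreover have "(\<Sum>i\<in>{j}. ennreal (c i) * indicator {s. tail s \<le> y i} s) = ennreal (c j)" using j by simp
    ultimately show ?thesis using j(2) by simp
  qed simp
  then have "(\<integral>\<^sup>+s. f s \<partial>M) \<le> (\<integral>\<^sup>+s. (\<Sum>j. ennreal (c j) * indicator {s. tail s \<le> y j} s) \<partial>M)"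
    using f by (intro nn_integral_mono_AE) (auto elim!: eventually_mono)
  also have "\<dots> = (\<Sum>j. \<integral>\<^sup>+s. ennreal (c j) * indicator {s. tail s \<le> y j} s \<partial>M)"
    by (rule nn_integral_suminf) measurable
  also have "\<dots> = (\<Sum>j. ennreal (c j) * emeasure M {s. tail s \<le> y j})"
  proof (intro suminf_cong nn_integral_cmult_indicator)
    show "{s. tail s \<le> y j} \<in> sets M" for j
      using borel_measurable_le[OF tail_measurable borel_measurable_const, of "y j"] by simp
  qed
  also have "\<dots> \<le> (\<Sum>j. ennreal (c j * y j))"
    using nonneg measure_tail_le
    by (intro suminf_le) (auto simp: emeasure_eq_measure ennreal_mult intro!: mult_left_mono ennreal_leI)
  also have "\<dots> = ennreal (\<Sum>j. c j * y j)"
    using nonneg by (intro suminf_ennreal2 summable) auto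
  finally show ?thesis .
qed

text \<open>Dyadic levels going down from \<open>R\<close>: level \<open>j\<close> is at most twice
  \<open>R / 2 ^ (j + 1)\<close>, so its contribution is a multiple of
  \<open>2 powr (- (1 - b) * j)\<close>. The geometric series converges exactly because
  \<open>b < 1\<close>, and the constant is independent of \<open>R\<close>.\<close>

lemma nn_integral_tail_low:
  assumes b: "0 \<le> b" "b < 1"
  shows "\<exists>K>0. \<forall>R>0. (\<integral>\<^sup>+s. ennreal (tail s powr (- b)) * indicator {s. tail s \<le> R} s \<partial>M)
    \<le> ennreal (K * R powr (1 - b))"
proof -
  define p :: real where "p = 2 powr (- (1 - b))"
  have p: "0 < p" "p < 1" using b by (auto simp: p_def intro!: powr_less_one)
  define K where "K = 2 * p * (\<Sum>j. p ^ j)"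
  have "0 < (\<Sum>j. p ^ j)" using p by (subst suminf_geometric) auto
  then have "0 < K" using p by (simp add: K_def)
  moreover have "(\<integral>\<^sup>+s. ennreal (tail s powr (- b)) * indicator {s. tail s \<le> R} s \<partial>M)
    \<le> ennreal (K * R powr (1 - b))" if R: "R > 0" for R
  proof -
    define c where "c = (\<lambda>j::nat. (R / 2 ^ (j + 1)) powr (- b))"
    define y where "y = (\<lambda>j::nat. R / 2 ^ j)"
    have cy: "c j * y j = (2 * p * R powr (1 - b)) * p ^ j" for j
    proof -
      have "c j * y j = 2 * ((R / 2 ^ (j + 1)) powr (- b) * (R / 2 ^ (j + 1)) powr 1)"
        using R by (simp add: c_def y_def)
      also have "\<dots> = 2 * (R / 2 ^ (j + 1)) powr (1 - b)"
        using R by (subst powr_add[symmetric]) simp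
      also have "(R / 2 ^ (j + 1)) powr (1 - b) = R powr (1 - b) * (2 ^ (j + 1)) powr (- (1 - b))"
        using R by (subst powr_divide) (auto simp: powr_minus_divide[of _ "1 - b"] simp del: minus_diff_eq)
      also have "((2::real) ^ (j + 1)) powr (- (1 - b)) = (2 powr real (j + 1)) powr (- (1 - b))"
        by (subst powr_realpow) auto
      also have "\<dots> = (2 powr (- (1 - b))) powr real (j + 1)"
        by (simp only: powr_powr mult.commute)
      also have "\<dots> = p ^ (j + 1)"
        unfolding p_def by (rule powr_realpow) simp
      finally show ?thesis by simp
    qed
    have "(\<integral>\<^sup>+s. ennreal (tail s powr (- b)) * indicator {s. tail s \<le> R} s \<partial>M) \<le> ennreal (\<Sum>j. c j * y j)"
    proof (rule nn_integral_tail_layers)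
      show "AE s in M. ennreal (tail s powr (- b)) * indicator {s. tail s \<le> R} s = 0 \<or>
          (\<exists>j. tail s \<le> y j \<and> ennreal (tail s powr (- b)) * indicator {s. tail s \<le> R} s \<le> ennreal (c j))"
      proof (rule AE_I2)
        fix s
        show "ennreal (tail s powr (- b)) * indicator {s. tail s \<le> R} s = 0 \<or>
          (\<exists>j. tail s \<le> y j \<and> ennreal (tail s powr (- b)) * indicator {s. tail s \<le> R} s \<le> ennreal (c j))"
        proof (cases "0 < tail s \<and> tail s \<le> R")
          case True
          then obtain j where j: "R / 2 ^ (j + 1) < tail s" "tail s \<le> R / 2 ^ j"
            using dyadic_below by blast
          have "tail s powr (- b) \<le> c j"
            unfolding c_def using j R b by (intro powr_mono2') auto
          then show ?thesis
            using j True by (intro disjI2 exI[of _ j]) (simp add: y_def ennreal_leI)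
        next
          case False
          \<comment> \<open>By convention \<open>0 powr (- b) = 0\<close>, so points with vanishing
            tail contribute nothing.\<close>
          then have "tail s = 0 \<or> R < tail s" using tail_nonneg[of s] by linarith
          then show ?thesis by auto
        qed
      qed
      show "summable (\<lambda>j. c j * y j)" unfolding cy using p by (intro summable_mult summable_geometric) auto
    qed (use R in \<open>auto simp: c_def y_def\<close>)
    also have "(\<Sum>j. c j * y j) = K * R powr (1 - b)"
      unfolding cy K_def using p by (subst suminf_mult) (auto intro: summable_geometric)
    finally show ?thesis .
  qed
  ultimately show ?thesis by blast
qed

text \<open>The mirror image, with dyadic levels going up from \<open>R\<close>. The exponent
  exceeds 1 by \<open>d\<close>, so the contributions form a geometric series of ratio
  \<open>2 powr (- d)\<close>.\<close>

lemma nn_integral_tail_high: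
  assumes d: "0 < d"
  shows "\<exists>K>0. \<forall>R>0. (\<integral>\<^sup>+s. ennreal (tail s powr (- (1 + d))) * indicator {s. R \<le> tail s} s \<partial>M)
    \<le> ennreal (K * R powr (- d))"
proof -
  define p :: real where "p = 2 powr (- d)"
  have p: "0 < p" "p < 1" using d by (auto simp: p_def intro!: powr_less_one)
  define K where "K = 2 * (\<Sum>j. p ^ j)"
  have "0 < (\<Sum>j. p ^ j)" using p by (subst suminf_geometric) auto
  then have "0 < K" by (simp add: K_def)
  moreover have "(\<integral>\<^sup>+s. ennreal (tail s powr (- (1 + d))) * indicator {s. R \<le> tail s} s \<partial>M)
    \<le> ennreal (K * R powr (- d))" if R: "R > 0" for R
  proof -
    define c where "c = (\<lambda>j::nat. (R * 2 ^ j) powr (- (1 + d)))"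
    define y where "y = (\<lambda>j::nat. R * 2 ^ (j + 1))"
    have cy: "c j * y j = (2 * R powr (- d)) * p ^ j" for j
    proof -
      have "c j * y j = 2 * ((R * 2 ^ j) powr (- (1 + d)) * (R * 2 ^ j) powr 1)"
        using R by (simp add: c_def y_def)
      also have "\<dots> = 2 * (R * 2 ^ j) powr (- d)"
        using R by (subst powr_add[symmetric]) simp
      also have "\<dots> = 2 * (R powr (- d) * (2 ^ j) powr (- d))"
        using R by (subst powr_mult) auto
      also have "(2 ^ j) powr (- d) = p ^ j"
        by (simp add: p_def powr_powr mult.commute flip: powr_realpow)
      finally show ?thesis by simp
    qed
    have "(\<integral>\<^sup>+s. ennreal (tail s powr (- (1 + d))) * indicator {s. R \<le> tail s} s \<partial>M) \<le> ennreal (\<Sum>j. c j * y j)"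
    proof (rule nn_integral_tail_layers)
      show "AE s in M. ennreal (tail s powr (- (1 + d))) * indicator {s. R \<le> tail s} s = 0 \<or>
          (\<exists>j. tail s \<le> y j \<and> ennreal (tail s powr (- (1 + d))) * indicator {s. R \<le> tail s} s \<le> ennreal (c j))"
      proof (rule AE_I2)
        fix s
        show "ennreal (tail s powr (- (1 + d))) * indicator {s. R \<le> tail s} s = 0 \<or>
          (\<exists>j. tail s \<le> y j \<and> ennreal (tail s powr (- (1 + d))) * indicator {s. R \<le> tail s} s \<le> ennreal (c j))"
        proof (cases "R \<le> tail s")
          case True
          then obtain j where j: "R * 2 ^ j \<le> tail s" "tail s \<le> R * 2 ^ (j + 1)"
            using dyadic_above R by blast
          have "tail s powr (- (1 + d)) \<le> c j"
            unfolding c_def using j R d by (intro powr_mono2') auto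
          then show ?thesis
            using j True by (intro disjI2 exI[of _ j]) (simp add: y_def ennreal_leI)
        qed auto
      qed
      show "summable (\<lambda>j. c j * y j)" unfolding cy using p by (intro summable_mult summable_geometric) auto
    qed (use R in \<open>auto simp: c_def y_def\<close>)
    also have "(\<Sum>j. c j * y j) = K * R powr (- d)"
      unfolding cy K_def using p by (subst suminf_mult) (auto intro: summable_geometric)
    finally show ?thesis .
  qed
  ultimately show ?thesis by blast
qed

end

subsection \<open>Radial weights\<close>

text \<open>The image of area under the modulus has a density with respect to Lebesgue measure, so
  null sets of radii pull back to null sets of the disc.\<close>

lemma AE_cmod_disc:
  assumes "AE s in lborel. s \<in> {0..<1} \<longrightarrow> P s"
  shows "AE z in lborel. z \<in> \<bbbD> \<longrightarrow> P (cmod z)"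
proof -
  obtain A where A: "A \<in> null_sets lborel" "{s \<in> space lborel. \<not> (s \<in> {0..<1} \<longrightarrow> P s)} \<subseteq> A"
    using assms unfolding eventually_ae_filter by blast
  have "AE s in lborel. s \<notin> A" using A(1) by (rule AE_not_in)
  then have "AE s in density lborel (\<lambda>s. indicator {0..<1} s * ennreal (2 * s)). s \<notin> A"
    by (subst AE_density) (auto elim: eventually_mono)
  then have "AE z in density lborel (\<lambda>z::complex. indicator \<bbbD> z * ennreal (1 / pi)). cmod z \<notin> A"
    unfolding distr_cmod_disc[symmetric] by (rule AE_distrD[rotated]) simp
  then have "AE z::complex in lborel. z \<in> \<bbbD> \<longrightarrow> cmod z \<notin> A"
    by (subst (asm) AE_density) (measurable, simp, auto elim!: eventually_mono split: split_indicator)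
  then show ?thesis
  proof eventually_elim
    fix z :: complex assume "z \<in> \<bbbD> \<longrightarrow> cmod z \<notin> A"
    then show "z \<in> \<bbbD> \<longrightarrow> P (cmod z)" using A(2) norm_ge_zero[of z] by (auto simp del: norm_ge_zero)
  qed
qed

lemma space_dA [simp]: "space dA = \<bbbD>"
  by (simp add: dA_def space_restrict_space)

lemma sets_dA: "A \<in> sets dA \<longleftrightarrow> A \<subseteq> \<bbbD> \<and> A \<in> sets lebesgue"
  by (simp add: dA_def sets_restrict_space_iff)

lemma borel_measurable_dA: "f \<in> borel_measurable borel \<Longrightarrow> f \<in> borel_measurable dA"
  unfolding dA_def measurable_density_eq2
  by (auto intro!: measurable_restrict_space1 measurable_completion)

lemma borel_measurable_dA_continuous: 
  fixes f :: "complex \<Rightarrow> 'a :: topological_space"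
  assumes "continuous_on \<bbbD> f"
  shows "f \<in> borel_measurable dA"
proof (rule measurableI)
  fix S :: "'a set" assume "S \<in> sets borel"
  have "f \<in> borel_measurable (restrict_space borel \<bbbD>)"
    using assms by (rule borel_measurable_continuous_on_restrict)
  from measurable_sets[OF this \<open>S \<in> sets borel\<close>]
  have "f -` S \<inter> \<bbbD> \<in> sets borel" by (simp add: space_restrict_space sets_restrict_space_iff)
  then show "f -` S \<inter> space dA \<in> sets dA" by (simp add: sets_dA)
qed auto

lemma nn_integral_dA:
  assumes [measurable]: "f \<in> borel_measurable dA"
  shows "(\<integral>\<^sup>+z. f z \<partial>dA) = (\<integral>\<^sup>+z. f z * (indicator \<bbbD> z * ennreal (1 / pi)) \<partial>lebesgue)"
proof -
  have "f \<in> borel_measurable (lebesgue_on \<bbbD>)" using assms by (simp add: dA_def)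
  then show ?thesis
    unfolding dA_def
    by (subst nn_integral_density) (auto simp: nn_integral_restrict_space mult_ac)
qed

text \<open>\<open>u\<close> is a Borel representative of the Lebesgue measurable radial profile of \<open>\<omega>\<close>.\<close>

locale radial_weight =
  fixes \<omega> :: "complex \<Rightarrow> real" and u :: "real \<Rightarrow> real"
  assumes weight: "is_weight \<omega>" and radial: "radial \<omega>"
    and u [measurable]: "u \<in> borel_measurable borel" and u_nonneg: "\<And>s. 0 \<le> u s"
    and \<omega>_real: "(\<lambda>s. indicator {0..<1} s * \<omega> (of_real s)) \<in> borel_measurable lebesgue"
    and AE_u: "AE s in lborel. s \<in> {0..<1} \<longrightarrow> \<omega> (of_real s) = u s"
    and u_finite: "(\<integral>\<^sup>+s. indicator {0..<1} s * ennreal (u s) \<partial>lborel) < \<infinity>"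
begin

text \<open>The area factor \<open>2 * s\<close> is deliberately left out: in this form the tail of
  \<open>\<mu>\<close> is exactly \<open>weight_hat\<close>, and the factor reappears only in
  \<open>nn_integral_N_radial\<close>.\<close>

definition \<mu> :: "real measure"
  where "\<mu> = density lborel (\<lambda>s. indicator {0..<1} s * ennreal (u s))"

definition N :: "complex measure"
  where "N = density dA \<omega>"

lemma sets_\<mu> [simp, measurable_cong]: "sets \<mu> = sets borel"
  and space_\<mu> [simp]: "space \<mu> = UNIV"
  by (simp_all add: \<mu>_def)

lemma sets_N [simp, measurable_cong]: "sets N = sets dA"
  and space_N [simp]: "space N = \<bbbD>"
  by (simp_all add: N_def)

lemma \<omega>_measurable [measurable]: "\<omega> \<in> borel_measurable dA"
  using weight unfolding is_weight_def by (blast intro: borel_measurable_integrable)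

lemma finite_\<mu>: "finite_measure \<mu>"
  by standard (use u_finite in \<open>simp add: \<mu>_def emeasure_density\<close>)

lemma finite_N: "finite_measure N"
proof
  have "emeasure N (space N) = (\<integral>\<^sup>+z. ennreal (\<omega> z) \<partial>dA)"
    unfolding space_N unfolding N_def
    by (subst emeasure_density) (auto simp: sets_dA intro!: nn_integral_cong)
  also have "\<dots> < \<infinity>"
    using weight integrableD(2)[of dA \<omega>] unfolding is_weight_def
    by (subst nn_integral_cong[of _ _ "\<lambda>z. ennreal (norm (\<omega> z))"]) (auto simp: integrable_iff_bounded)
  finally show "emeasure N (space N) \<noteq> \<infinity>" by simp
qed

sublocale \<mu>: real_finite_measure \<mu>
  by (intro real_finite_measure.intro finite_\<mu> real_finite_measure_axioms.intro sets_\<mu>)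

sublocale N: finite_measure N by (rule finite_N)

lemma AE_\<mu>: "AE s in \<mu>. 0 \<le> s \<and> s < 1"
  unfolding \<mu>_def by (subst AE_density) (auto split: split_indicator)

lemma AE_\<omega>: "AE z in lborel. z \<in> \<bbbD> \<longrightarrow> \<omega> z = u (cmod z)"
  using AE_cmod_disc[OF AE_u]
proof eventually_elim
  fix z assume "z \<in> \<bbbD> \<longrightarrow> \<omega> (of_real (cmod z)) = u (cmod z)"
  then show "z \<in> \<bbbD> \<longrightarrow> \<omega> z = u (cmod z)"
    using radial unfolding radial_def by metis
qed

text \<open>Passing from \<open>\<omega>\<close> to the Borel function \<open>u\<close> of the
  modulus makes the integrand Borel and visibly rotation invariant in its weight, which the
  change-of-variable lemmas for \<open>lborel\<close> require.\<close>

lemma nn_integral_N_lborel: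
  assumes [measurable]: "\<phi> \<in> borel_measurable borel"
  shows "(\<integral>\<^sup>+z. \<phi> z \<partial>N) 
    = (\<integral>\<^sup>+z. \<phi> z * (indicator \<bbbD> z * ennreal (1 / pi) * ennreal (u (cmod z))) \<partial>lborel)"
proof -
  have [measurable]: "\<phi> \<in> borel_measurable dA" by (rule borel_measurable_dA) simp
  have "(\<integral>\<^sup>+z. \<phi> z \<partial>N) = (\<integral>\<^sup>+z. ennreal (\<omega> z) * \<phi> z \<partial>dA)"
    unfolding N_def by (subst nn_integral_density) auto
  also have "\<dots> = (\<integral>\<^sup>+z. ennreal (\<omega> z) * \<phi> z * (indicator \<bbbD> z * ennreal (1 / pi)) \<partial>lebesgue)"
    by (subst nn_integral_dA) auto
  also have "\<dots> = (\<integral>\<^sup>+z. \<phi> z * (indicator \<bbbD> z * ennreal (1 / pi) * ennreal (u (cmod z))) \<partial>lebesgue)"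
    using AE_completion[OF AE_\<omega>]
    by (intro nn_integral_cong_AE) (auto elim!: eventually_mono simp: mult_ac split: split_indicator)
  also have "\<dots> = (\<integral>\<^sup>+z. \<phi> z * (indicator \<bbbD> z * ennreal (1 / pi) * ennreal (u (cmod z))) \<partial>lborel)"
    by (rule nn_integral_completion)
  finally show ?thesis .
qed

lemma nn_integral_N_radial:
  assumes [measurable]: "G \<in> borel_measurable borel"
  shows "(\<integral>\<^sup>+z. G (cmod z) \<partial>N) = (\<integral>\<^sup>+s. ennreal (2 * s) * G s \<partial>\<mu>)"
proof -
  have [measurable]: "(\<lambda>z::complex. indicator \<bbbD> z :: ennreal) \<in> borel_measurable borel"
    by measurable simp
  have "(\<integral>\<^sup>+z. G (cmod z) \<partial>N) = 
     (\<integral>\<^sup>+z. (indicator \<bbbD> z * ennreal (1 / pi)) * (G (cmod z) * ennreal (u (cmod z))) \<partial>lborel)"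
    by (subst nn_integral_N_lborel) (simp_all add: mult_ac)
  also have "\<dots> = (\<integral>\<^sup>+s. G s * ennreal (u s) \<partial>distr (density lborel (\<lambda>z. indicator \<bbbD> z * ennreal (1 / pi))) borel cmod)"
    by (subst nn_integral_distr) (simp_all add: nn_integral_density)
  also have "\<dots> = (\<integral>\<^sup>+s. ennreal (2 * s) * G s \<partial>\<mu>)"
    unfolding distr_cmod_disc \<mu>_def by (simp add: nn_integral_density mult_ac)
  finally show ?thesis .
qed

lemma nn_integral_N_rotate:
  assumes [measurable]: "\<phi> \<in> borel_measurable borel" and v: "cmod v = 1"
  shows "(\<integral>\<^sup>+z. \<phi> (v * z) \<partial>N) = (\<integral>\<^sup>+z. \<phi> z \<partial>N)"
proof -
  have [measurable]: "(\<lambda>z::complex. indicator \<bbbD> z :: ennreal) \<in> borel_measurable borel"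
    by measurable simp
  have i: "indicator \<bbbD> (v * z) = (indicator \<bbbD> z :: ennreal)" for z
    using v by (simp add: indicator_def norm_mult)
  show ?thesis
    using nn_integral_rotate[of "\<lambda>z. \<phi> z * (indicator \<bbbD> z * ennreal (1 / pi) * ennreal (u (cmod z)))" v] v
    by (subst (1 2) nn_integral_N_lborel) (simp_all add: norm_mult i)
qed

text \<open>Every rotation preserves the integral, hence so does averaging over all of them;
  Tonelli's theorem moves the average inside. Together with the image under the modulus this
  replaces polar coordinates.\<close>

lemma nn_integral_N_circle_average:
  assumes [measurable]: "\<phi> \<in> borel_measurable borel"
  shows "(\<integral>\<^sup>+z. \<phi> z \<partial>N) = (\<integral>\<^sup>+z. (\<integral>\<^sup>+t. \<phi> (cis (2 * pi * t) * z) * indicator {0..1} t \<partial>lborel) \<partial>N)"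
proof -
  have [measurable]: "(\<lambda>x. cis (2 * pi * x)) \<in> borel \<rightarrow>\<^sub>M borel"
    by (intro borel_measurable_continuous_onI continuous_intros)
  have id: "(\<lambda>z. z) \<in> N \<rightarrow>\<^sub>M borel"
    using borel_measurable_dA[of "\<lambda>z. z"] by (subst measurable_cong_sets[OF sets_N refl]) simp
  interpret pair_sigma_finite N lborel ..
  have p: "(\<lambda>p. (fst p, snd p)) \<in> N \<Otimes>\<^sub>M lborel \<rightarrow>\<^sub>M (borel \<Otimes>\<^sub>M borel :: (complex \<times> real) measure)"
    by (rule measurable_Pair) (auto intro: measurable_compose[OF measurable_fst id])
  have m: "(\<lambda>p. \<phi> (cis (2 * pi * snd p) * fst p) * indicator {0..1} (snd p))
      \<in> borel_measurable (borel \<Otimes>\<^sub>M borel :: (complex \<times> real) measure)"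
    by measurable
  have m2: "(\<lambda>(z,t). \<phi> (cis (2 * pi * t) * z) * indicator {0..1} t) \<in> borel_measurable (N \<Otimes>\<^sub>M lborel)"
    using measurable_compose[OF p m] by (simp only: split_beta' fst_conv snd_conv)
  have m1: "(\<lambda>z. \<phi> (cis (2 * pi * t) * z)) \<in> borel_measurable N" for t
    by (rule measurable_compose[OF id]) measurable
  have "(\<integral>\<^sup>+z. \<phi> (cis (2 * pi * t) * z) * indicator {0..1} t \<partial>N) = (\<integral>\<^sup>+z. \<phi> z \<partial>N) * indicator {0..1} t"
    for t :: real
  proof -
    have "(\<integral>\<^sup>+z. \<phi> (cis (2 * pi * t) * z) * indicator {0..1} t \<partial>N)
      = (\<integral>\<^sup>+z. \<phi> (cis (2 * pi * t) * z) \<partial>N) * indicator {0..1} t"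
      by (rule nn_integral_multc) (rule m1)
    then show ?thesis
      by (simp only: nn_integral_N_rotate[OF assms norm_cis])
  qed
  then have "(\<integral>\<^sup>+t. (\<integral>\<^sup>+z. \<phi> (cis (2 * pi * t) * z) * indicator {0..1} t \<partial>N) \<partial>lborel)
    = (\<integral>\<^sup>+t. (\<integral>\<^sup>+z. \<phi> z \<partial>N) * indicator {0..1} (t::real) \<partial>lborel)"
    by (rule nn_integral_cong)
  moreover have "(\<integral>\<^sup>+t. (\<integral>\<^sup>+z. \<phi> z \<partial>N) * indicator {0..1} (t::real) \<partial>lborel) = (\<integral>\<^sup>+z. \<phi> z \<partial>N)"
    by (rule trans[OF nn_integral_cmult_indicator]) simp_all
  moreover have "(\<integral>\<^sup>+t. (\<integral>\<^sup>+z. \<phi> (cis (2 * pi * t) * z) * indicator {0..1} t \<partial>N) \<partial>lborel)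
    = (\<integral>\<^sup>+z. (\<integral>\<^sup>+t. \<phi> (cis (2 * pi * t) * z) * indicator {0..1} t \<partial>lborel) \<partial>N)"
    by (rule Fubini') (rule m2)
  ultimately show ?thesis by (simp only:)
qed

end

subsection \<open>Doubling weights: moments and kernel series\<close>

text \<open>The doubling constant is enlarged to a power of two, so that iterating it yields integer
  powers of the ratio of distances to 1.\<close>

locale doubling_weight = radial_weight +
  fixes m :: nat
  assumes tail_pos: "\<And>r. 0 \<le> r \<Longrightarrow> r < 1 \<Longrightarrow> 0 < \<mu>.tail r"
    and doubling: "\<And>r. 0 \<le> r \<Longrightarrow> r < 1 \<Longrightarrow> \<mu>.tail r \<le> 2 ^ m * \<mu>.tail ((1 + r) / 2)"
begin

abbreviation F :: "real \<Rightarrow> real"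
  where "F \<equiv> \<mu>.tail"

definition mom :: "nat \<Rightarrow> real"
  where "mom n = (LINT s|\<mu>. s ^ (2 * n + 1))"

definition coef :: "nat \<Rightarrow> real"
  where "coef n = 1 / (2 * mom n)"

lemma tail_iterate:
  assumes "0 \<le> x" "x < 1"
  shows "F x \<le> 2 ^ (m * j) * F (1 - (1 - x) / 2 ^ j)"
proof (induction j)
  case (Suc j)
  let ?y = "1 - (1 - x) / 2 ^ j"
  have "(1 - x) / 2 ^ j \<le> 1 / 1" using assms by (intro frac_le) auto
  then have "0 \<le> ?y" "?y < 1" using assms by auto
  then have "F ?y \<le> 2 ^ m * F ((1 + ?y) / 2)" by (rule doubling)
  also have "(1 + ?y) / 2 = 1 - (1 - x) / 2 ^ Suc j" by (simp add: field_simps)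
  finally have "2 ^ (m * j) * F ?y \<le> 2 ^ (m * j) * (2 ^ m * F (1 - (1 - x) / 2 ^ Suc j))"
    by (rule mult_left_mono) simp
  also have "\<dots> = 2 ^ (m * Suc j) * F (1 - (1 - x) / 2 ^ Suc j)" by (simp add: power_add mult_ac)
  finally show ?case using Suc by linarith
qed simp

text \<open>Each use of doubling halves the distance to 1. If \<open>2 ^ j\<close> is about
  \<open>(1 - x) / (1 - y)\<close>, then \<open>j + 1\<close> uses starting from \<open>x\<close>
  reach or pass \<open>y\<close>; the rounding accounts for the factor 2 inside the power.\<close>

lemma tail_compare:
  assumes "0 \<le> x" "x \<le> y" "y < 1"
  shows "F x \<le> (2 * (1 - x) / (1 - y)) ^ m * F y"
proof -
  have "1 - y \<le> 1 - x" "0 < 1 - y" using assms by auto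
  then obtain j where j: "(1 - y) * 2 ^ j \<le> 1 - x" "1 - x \<le> (1 - y) * 2 ^ (j + 1)"
    using dyadic_above[of "1 - y" "1 - x"] by auto
  have "F x \<le> 2 ^ (m * (j + 1)) * F (1 - (1 - x) / 2 ^ (j + 1))"
    using assms by (intro tail_iterate) auto
  also have "\<dots> \<le> 2 ^ (m * (j + 1)) * F y"
    using j assms by (intro mult_left_mono \<mu>.tail_antimono) (auto simp: field_simps)
  also have "2 ^ (m * (j + 1)) = ((2::real) * 2 ^ j) ^ m"
    by (simp add: power_add power_mult mult.commute flip: power_mult_distrib power_Suc)
  also have "\<dots> \<le> (2 * (1 - x) / (1 - y)) ^ m"
    using j assms by (intro power_mono) (auto simp: field_simps)
  finally show ?thesis by (simp add: mult_right_mono)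
qed

lemma integrable_power: "integrable \<mu> (\<lambda>s. s ^ n)"
  by (rule \<mu>.integrable_const_bound[of _ 1])
     (rule eventually_mono[OF AE_\<mu>], auto simp: power_le_one)

text \<open>By Bernoulli's inequality the power is at least 1/2 beyond
  \<open>y = 1 - 1 / (4 (n + 1))\<close>, so the moment is at least \<open>F y / 2\<close>. This
  \<open>y\<close> is four times closer to 1 than the point of the statement, and
  \<open>tail_compare\<close> charges \<open>8 ^ m\<close> for that.\<close>

lemma mom_lower: "F (1 - 1 / (n + 1)) \<le> 2 * 8 ^ m * mom n"
proof -
  define x y where "x = 1 - 1 / real (n + 1)" and "y = 1 - 1 / (4 * real (n + 1))"
  have xy: "0 \<le> x" "x \<le> y" "y < 1" "0 \<le> y" by (auto simp: x_def y_def field_simps)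
  have "F x \<le> (2 * (1 - x) / (1 - y)) ^ m * F y" by (rule tail_compare) (use xy in auto)
  also have "2 * (1 - x) / (1 - y) = 8" by (simp add: x_def y_def field_simps)
  finally have Fx: "F x \<le> 8 ^ m * F y" .
  have "F y / 2 \<le> mom n"
  proof -
    have "F y / 2 = (LINT s|\<mu>. 1 / 2 * indicator {y..} s)" by (simp add: \<mu>.tail_def)
    also have "\<dots> \<le> mom n"
      unfolding mom_def
    proof (rule integral_mono_AE)
      show "AE s in \<mu>. 1 / 2 * indicator {y..} s \<le> s ^ (2 * n + 1)"
        using AE_\<mu>
      proof eventually_elim
        fix s :: real assume s: "0 \<le> s \<and> s < 1"
        show "1 / 2 * indicator {y..} s \<le> s ^ (2 * n + 1)"
        proof (cases "y \<le> s")
          case True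
          have "1 / 2 \<le> 1 + real (2 * n + 1) * (y - 1)" by (simp add: y_def field_simps)
          also have "\<dots> \<le> (1 + (y - 1)) ^ (2 * n + 1)" using xy by (intro Bernoulli_inequality) auto
          also have "\<dots> \<le> s ^ (2 * n + 1)" using True xy by (intro power_mono) auto
          finally show ?thesis using True by simp
        qed (use s in auto)
      qed
    next
      show "integrable \<mu> (\<lambda>s. 1 / 2 * indicator {y..} s :: real)"
        by (intro integrable_mult_right integrable_real_indicator) (auto simp: \<mu>.emeasure_eq_measure)
    qed (rule integrable_power)
    finally show ?thesis .
  qed
  then have "8 ^ m * F y \<le> 8 ^ m * (2 * mom n)" by (intro mult_left_mono) auto
  with Fx have "F x \<le> 8 ^ m * (2 * mom n)" by linarith
  then show ?thesis by (simp add: x_def mult_ac add.commute)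
qed

lemma mom_pos: "0 < mom n"
proof -
  have "0 < F (1 - 1 / (real n + 1))" by (rule tail_pos) (auto simp: field_simps)
  with mom_lower[of n] have "0 < (2 * 8 ^ m) * mom n" by linarith
  then show ?thesis by (simp add: zero_less_mult_iff)
qed

lemma coef_pos: "0 < coef n"
  using mom_pos[of n] by (simp add: coef_def)

text \<open>By \<open>mom_lower\<close> the coefficient is controlled by the tail at
  \<open>1 - 1 / (n + 1)\<close>. If \<open>x\<close> lies to the left of that point, moving to
  \<open>F x\<close> costs a power of \<open>2 (1 - x) (n + 1)\<close>; otherwise monotonicity
  suffices. The summand 1 covers both cases.\<close>

lemma coef_upper:
  assumes x: "0 \<le> x" "x < 1"
  shows "coef n \<le> 8 ^ m * (1 + 2 * (1 - x) * (n + 1)) ^ m / F x"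
proof -
  define y where "y = 1 - 1 / real (n + 1)"
  have y: "0 \<le> y" "y < 1" by (auto simp: y_def field_simps)
  have "F x \<le> (1 + 2 * (1 - x) * (n + 1)) ^ m * F y"
  proof (cases "x \<le> y")
    case True
    have "F x \<le> (2 * (1 - x) / (1 - y)) ^ m * F y" using True x y by (intro tail_compare) auto
    also have "2 * (1 - x) / (1 - y) = 2 * (1 - x) * (n + 1)" by (simp add: y_def)
    also have "(2 * (1 - x) * (n + 1)) ^ m * F y \<le> (1 + 2 * (1 - x) * (n + 1)) ^ m * F y"
      using x by (intro mult_right_mono power_mono) auto
    finally show ?thesis .
  next
    case False
    then have "F x \<le> 1 * F y" by (simp add: \<mu>.tail_antimono)
    also have "\<dots> \<le> (1 + 2 * (1 - x) * (n + 1)) ^ m * F y"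
      using x by (intro mult_right_mono one_le_power) auto
    finally show ?thesis .
  qed
  also have "\<dots> \<le> (1 + 2 * (1 - x) * (n + 1)) ^ m * (2 * 8 ^ m * mom n)"
    using x mom_lower[of n] by (intro mult_left_mono) (auto simp: y_def add.commute)
  finally show ?thesis
    using mom_pos[of n] tail_pos[OF x] by (simp add: coef_def field_simps)
qed

end

section \<open>Growth of the kernel series near the boundary\<close>

lemma one_minus_exp_lower:
  fixes v :: real
  assumes "0 \<le> v" "v \<le> 1"
  shows "v / 2 \<le> 1 - exp (- v)"
proof -
  have "exp (- v) * (1 + v) \<le> exp (- v) * exp v" by (intro mult_left_mono exp_ge_add_one_self) auto
  then have "exp (- v) * (1 + v) \<le> 1" by (simp flip: exp_add)
  then have "exp (- v) \<le> 1 / (1 + v)" using assms by (simp add: field_simps)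
  also have "\<dots> \<le> 1 - v / 2" using assms by (simp add: field_simps mult_left_le)
  finally show ?thesis by simp
qed

text \<open>The power \<open>x ^ n\<close> decays like \<open>exp (- (1 - x) n)\<close>. Half of
  this exponent absorbs the polynomial in \<open>(1 - x) n\<close>, and the other half leaves a
  geometric series of sum comparable to \<open>1 / (1 - x)\<close>.\<close>

lemma weighted_geometric_sum:
  "\<exists>K>0. \<forall>x. 0 \<le> x \<and> x < 1 \<longrightarrow> summable (\<lambda>n. (1 + 2 * (1 - x) * (real n + 1)) ^ p * x ^ n) \<and>
     (\<Sum>n. (1 + 2 * (1 - x) * (real n + 1)) ^ p * x ^ n) \<le> K / (1 - x)"
proof -
  define A where "A = 4 ^ p * fact p * exp (3 / 4 :: real)"
  have "A > 0" by (simp add: A_def)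
  moreover have "summable (\<lambda>n. (1 + 2 * (1 - x) * (real n + 1)) ^ p * x ^ n) \<and>
     (\<Sum>n. (1 + 2 * (1 - x) * (real n + 1)) ^ p * x ^ n) \<le> 4 * A / (1 - x)" if x: "0 \<le> x" "x < 1" for x
  proof -
    define v where "v = (1 - x) / 2"
    have v: "0 < v" "v \<le> 1" using x by (auto simp: v_def)
    have bnd: "(1 + 2 * (1 - x) * (real n + 1)) ^ p * x ^ n \<le> A * exp (- v) ^ n" for n
    proof -
      \<comment> \<open>Division by 4 makes \<open>z\<close> equal to
        \<open>1 / 4 + v * (n + 1)\<close> with \<open>v \<le> 1 / 2\<close>. Hence
        \<open>exp z\<close> uses up only \<open>exp (v * n)\<close> of the decay
        \<open>exp (- 2 * v * n)\<close>, and 3/4 collects the constants.\<close>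
      define z where "z = (1 + 2 * (1 - x) * (real n + 1)) / 4"
      have "(1 + 2 * (1 - x) * (real n + 1)) ^ p = 4 ^ p * z ^ p" by (simp add: z_def power_divide)
      also have "\<dots> \<le> 4 ^ p * (fact p * exp z)"
        using x by (intro mult_left_mono power_le_fact_exp) (auto simp: z_def)
      also have "exp z \<le> exp (3 / 4 + v * n)" using x by (simp add: z_def v_def field_simps)
      finally have 1: "(1 + 2 * (1 - x) * (real n + 1)) ^ p \<le> A * exp (v * n)"
        by (simp add: A_def exp_add mult_ac)
      have "x ^ n \<le> exp (- (2 * v)) ^ n"
      proof (intro power_mono)
        have "x = 1 + - (2 * v)" by (simp add: v_def field_simps)
        also have "\<dots> \<le> exp (- (2 * v))" by (rule exp_ge_add_one_self)
        finally show "x \<le> exp (- (2 * v))" .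
      qed (use x in auto)
      then have "(1 + 2 * (1 - x) * (real n + 1)) ^ p * x ^ n \<le> (A * exp (v * n)) * exp (- (2 * v)) ^ n"
        using 1 x \<open>A > 0\<close> by (intro mult_mono) auto
      also have "\<dots> = A * exp (- v) ^ n"
        by (simp add: exp_of_nat_mult[symmetric] mult_ac exp_add[symmetric] algebra_simps)
      finally show ?thesis .
    qed
    have g: "summable (\<lambda>n. A * exp (- v) ^ n)" using v by (intro summable_mult summable_geometric) auto
    have s: "summable (\<lambda>n. (1 + 2 * (1 - x) * (real n + 1)) ^ p * x ^ n)"
      by (rule summable_comparison_test'[OF g, of 0]) (use bnd x in auto)
    have "(\<Sum>n. (1 + 2 * (1 - x) * (real n + 1)) ^ p * x ^ n) \<le> (\<Sum>n. A * exp (- v) ^ n)"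
      by (rule suminf_le[OF bnd s g])
    also have "\<dots> = A * (1 / (1 - exp (- v)))"
      using v by (subst suminf_mult) (auto simp: suminf_geometric intro: summable_geometric)
    also have "\<dots> \<le> A * (1 / (v / 2))"
      using v \<open>A > 0\<close> one_minus_exp_lower[of v] by (intro mult_left_mono divide_left_mono) auto
    also have "\<dots> = 4 * A / (1 - x)" by (simp add: v_def)
    finally show ?thesis using s by blast
  qed
  ultimately show ?thesis by (intro exI[of _ "4 * A"]) auto
qed

context doubling_weight
begin

text \<open>The exponent \<open>j\<close> is left general because two cases are needed:
  \<open>j = 1\<close> bounds the kernel itself and \<open>j = 2\<close> bounds its quadratic circle
  means.\<close>

lemma coef_series_upper:
  "\<exists>K>0. \<forall>x. 0 \<le> x \<and> x < 1 \<longrightarrow> summable (\<lambda>n. coef n ^ j * x ^ n) \<and>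
     (\<Sum>n. coef n ^ j * x ^ n) \<le> K / ((1 - x) * F x ^ j)"
proof -
  obtain K where K: "K > 0" "\<And>x. 0 \<le> x \<and> x < 1 \<longrightarrow> summable (\<lambda>n. (1 + 2 * (1 - x) * (real n + 1)) ^ (m * j) * x ^ n) \<and>
     (\<Sum>n. (1 + 2 * (1 - x) * (real n + 1)) ^ (m * j) * x ^ n) \<le> K / (1 - x)"
    using weighted_geometric_sum[of "m * j"] by blast
  have "summable (\<lambda>n. coef n ^ j * x ^ n) \<and>
     (\<Sum>n. coef n ^ j * x ^ n) \<le> 8 ^ (m * j) * K / ((1 - x) * F x ^ j)" if x: "0 \<le> x" "x < 1" for x
  proof -
    define w where "w = (\<lambda>n. (1 + 2 * (1 - x) * (real n + 1)) ^ (m * j) * x ^ n)"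
    define B where "B = 8 ^ (m * j) / F x ^ j"
    have "B > 0" using tail_pos[OF x] by (simp add: B_def)
    have w: "summable w" "suminf w \<le> K / (1 - x)" using K x by (auto simp: w_def)
    have bnd: "coef n ^ j * x ^ n \<le> B * w n" for n
    proof -
      have "coef n ^ j \<le> (8 ^ m * (1 + 2 * (1 - x) * (real n + 1)) ^ m / F x) ^ j"
        using coef_upper[OF x] coef_pos[of n] by (intro power_mono) (auto simp: less_imp_le)
      also have "\<dots> = B * (1 + 2 * (1 - x) * (real n + 1)) ^ (m * j)"
        by (simp add: B_def power_divide power_mult_distrib power_mult)
      finally have "coef n ^ j * x ^ n \<le> (B * (1 + 2 * (1 - x) * (real n + 1)) ^ (m * j)) * x ^ n"
        using x by (intro mult_right_mono) auto
      then show ?thesis by (simp add: w_def mult_ac)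
    qed
    have s: "summable (\<lambda>n. coef n ^ j * x ^ n)"
      by (rule summable_comparison_test'[OF summable_mult[OF w(1), of B], of 0])
        (use bnd x coef_pos in \<open>auto simp: less_imp_le abs_mult\<close>)
    have "(\<Sum>n. coef n ^ j * x ^ n) \<le> (\<Sum>n. B * w n)"
      by (rule suminf_le[OF bnd s summable_mult[OF w(1)]])
    also have "\<dots> = B * suminf w" by (rule suminf_mult[OF w(1)])
    also have "\<dots> \<le> B * (K / (1 - x))" using w(2) \<open>B > 0\<close> by (intro mult_left_mono) auto
    finally show ?thesis using s by (simp add: B_def mult_ac)
  qed
  then show ?thesis using K(1) by (intro exI[of _ "8 ^ (m * j) * K"]) auto
qed

text \<open>The part beyond \<open>r\<close> is at most \<open>F r\<close>. Below \<open>r\<close>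
  the factor \<open>s ^ (2 * n + 1)\<close> decays faster than any power of
  \<open>(1 - s) / (1 - r)\<close>, and by doubling the \<open>m\<close>-th power of
  \<open>(1 - r) / (1 - s)\<close> is at most a constant times \<open>F r / F s\<close>. Two such
  factors are taken: they leave \<open>1 / F\<^sup>2\<close>, whose integral over the levels above
  \<open>F r\<close> is of order \<open>1 / F r\<close>, whereas a single \<open>1 / F\<close> would
  be borderline.\<close>

lemma mom_upper:
  "\<exists>K>0. \<forall>r n. 0 \<le> r \<and> r < 1 \<and> 1 \<le> (2 * real n + 1) * (1 - r) \<longrightarrow> mom n \<le> K * F r"
proof -
  obtain H where H: "H > 0" "\<And>R. R > 0 \<Longrightarrow> 
      (\<integral>\<^sup>+s. ennreal (F s powr (- (1 + 1))) * indicator {s. R \<le> F s} s \<partial>\<mu>) \<le> ennreal (H * R powr (- 1))"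
    using \<mu>.nn_integral_tail_high[of 1] by auto
  define A :: real where "A = fact (2 * m) * 4 ^ m"
  have "A > 0" by (simp add: A_def)
  have "mom n \<le> (1 + A * H) * F r" if r: "0 \<le> r" "r < 1" and n: "1 \<le> (2 * real n + 1) * (1 - r)" for r n
  proof -
    have Fr: "0 < F r" using tail_pos r by simp
    have bound: "ennreal (s ^ (2 * n + 1)) \<le> indicator {r..} s +
        ennreal (A * (F r)\<^sup>2) * (ennreal (F s powr (- (1 + 1))) * indicator {s. F r \<le> F s} s)"
      if s: "0 \<le> s" "s < 1" for s
    proof (cases "r \<le> s")
      case True
      have "s ^ (2 * n + 1) \<le> 1" using s by (intro power_le_one) auto
      then have "ennreal (s ^ (2 * n + 1)) \<le> ennreal 1" by (rule ennreal_leI)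
      also have "\<dots> \<le> indicator {r..} s + ennreal (A * (F r)\<^sup>2) * (ennreal (F s powr (- (1 + 1))) * indicator {s. F r \<le> F s} s)"
        using True by simp
      finally show ?thesis .
    next
      case False
      then have sr: "s < r" by simp
      \<comment> \<open>\<open>z\<close> is the exponent in
        \<open>s ^ (2 * n + 1) \<le> exp (- z)\<close> and \<open>q\<close> the ratio of distances
        to 1; the lower bound on \<open>n\<close> says precisely that \<open>z\<close> is at least
        \<open>1 / q\<close>.\<close>
      define z where "z = (2 * real n + 1) * (1 - s)"
      define q where "q = (1 - r) / (1 - s)"
      have q: "0 < q" using sr r s by (simp add: q_def)
      have zq: "1 / q \<le> z"
      proof -
        have "1 / q \<le> ((2 * real n + 1) * (1 - r)) * (1 / q)"
          using n q by (simp add: field_simps)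
        also have "\<dots> = z" using sr r s by (simp add: z_def q_def)
        finally show ?thesis .
      qed
      have "0 < 1 / q" using q by simp
      then have z: "z > 0" using zq by linarith
      have Fs: "0 < F s" using tail_pos s by simp
      have "s ^ (2 * n + 1) \<le> exp (- (1 - s)) ^ (2 * n + 1)"
        using s exp_ge_add_one_self[of "- (1 - s)"] by (intro power_mono) auto
      also have "\<dots> = exp (- z)"
        by (subst exp_of_nat_mult[symmetric]) (simp add: z_def algebra_simps)
      also have "\<dots> \<le> fact (2 * m) / z ^ (2 * m)"
        using power_le_fact_exp[of z "2 * m"] z by (simp add: exp_minus field_simps)
      also have "\<dots> \<le> fact (2 * m) / (1 / q) ^ (2 * m)"
        using zq q z by (intro divide_left_mono power_mono mult_pos_pos) auto
      also have "\<dots> = fact (2 * m) * (q ^ m)\<^sup>2"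
        by (simp add: power_divide power_mult[symmetric] mult.commute)
      also have "q ^ m \<le> 2 ^ m * F r / F s"
      proof -
        have "F s \<le> (2 * (1 - s) / (1 - r)) ^ m * F r" using s sr r by (intro tail_compare) auto
        also have "2 * (1 - s) / (1 - r) = 2 / q" by (simp add: q_def)
        also have "(2 / q) ^ m = 2 ^ m / q ^ m" by (rule power_divide)
        finally show ?thesis using q Fs by (simp add: field_simps)
      qed
      then have "fact (2 * m) * (q ^ m)\<^sup>2 \<le> fact (2 * m) * (2 ^ m * F r / F s)\<^sup>2"
        using q by (intro mult_left_mono power_mono) auto
      also have "\<dots> = A * (F r)\<^sup>2 * F s powr (- (1 + 1))"
      proof -
        have "(4::real) ^ m = (2 ^ m)\<^sup>2" by (simp add: power2_eq_square flip: power_mult_distrib)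
        moreover have "F s powr (- (1 + 1)) = 1 / (F s)\<^sup>2" using Fs by (simp add: powr_minus_divide)
        ultimately show ?thesis by (simp add: A_def power_divide power_mult_distrib)
      qed
      finally have "ennreal (s ^ (2 * n + 1)) \<le> ennreal (A * (F r)\<^sup>2 * F s powr (- (1 + 1)))"
        by (rule ennreal_leI)
      also have "\<dots> = ennreal (A * (F r)\<^sup>2) * (ennreal (F s powr (- (1 + 1))) * indicator {s. F r \<le> F s} s)"
        using \<mu>.tail_antimono[of s r] sr \<open>A > 0\<close> by (simp add: ennreal_mult)
      also have "\<dots> \<le> indicator {r..} s + \<dots>" by simp
      finally show ?thesis .
    qed
    have "ennreal (mom n) = (\<integral>\<^sup>+s. ennreal (s ^ (2 * n + 1)) \<partial>\<mu>)"
      unfolding mom_def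
      by (rule nn_integral_eq_integral[symmetric, OF integrable_power])
         (rule eventually_mono[OF AE_\<mu>], simp)
    also have "\<dots> \<le> (\<integral>\<^sup>+s. indicator {r..} s +
        ennreal (A * (F r)\<^sup>2) * (ennreal (F s powr (- (1 + 1))) * indicator {s. F r \<le> F s} s) \<partial>\<mu>)"
      by (rule nn_integral_mono_AE, rule eventually_mono[OF AE_\<mu>]) (use bound in blast)
    also have "\<dots> = emeasure \<mu> {r..} + ennreal (A * (F r)\<^sup>2) *
        (\<integral>\<^sup>+s. ennreal (F s powr (- (1 + 1))) * indicator {s. F r \<le> F s} s \<partial>\<mu>)"
    proof -
      have [measurable]: "{s. F r \<le> F s} \<in> sets borel"
        using borel_measurable_le[OF borel_measurable_const \<mu>.tail_measurable, of "F r"] by simp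
      have "(\<lambda>s. ennreal (F s powr (- (1 + 1))) * indicator {s. F r \<le> F s} s) \<in> borel_measurable \<mu>"
        by measurable
      then show ?thesis by (simp add: nn_integral_add nn_integral_cmult del: minus_add_distrib)
    qed
    also have "\<dots> \<le> ennreal (F r) + ennreal (A * (F r)\<^sup>2) * ennreal (H * F r powr (- 1))"
    proof (intro add_mono mult_left_mono H(2)[OF Fr])
      show "emeasure \<mu> {r..} \<le> ennreal (F r)"
        unfolding \<mu>.tail_def by (simp only: \<mu>.emeasure_eq_measure order_refl)
    qed simp
    also have "\<dots> = ennreal (F r + A * (F r)\<^sup>2 * (H * F r powr (- 1)))"
      using Fr \<open>A > 0\<close> H(1) by (subst ennreal_mult[symmetric]) auto
    also have "F r + A * (F r)\<^sup>2 * (H * F r powr (- 1)) = (1 + A * H) * F r"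
      using Fr by (simp add: powr_minus_divide power2_eq_square algebra_simps)
    finally show ?thesis
      using Fr \<open>A > 0\<close> H(1) by (subst (asm) ennreal_le_iff) auto
  qed
  then show ?thesis using \<open>A > 0\<close> H(1) by (intro exI[of _ "1 + A * H"]) (auto intro!: add_pos_pos)
qed

text \<open>From index \<open>N\<close>, about \<open>1 / (2 (1 - r))\<close>, onwards
  \<open>mom_upper\<close> makes all coefficients at least a constant over \<open>F r\<close>, and
  the geometric tail from \<open>N\<close> on is still of order \<open>1 / (1 - r)\<close>. For
  \<open>r \<le> 1 / 2\<close> the constant term alone is enough.\<close>

lemma coef_series_lower:
  "\<exists>c>0. \<forall>r. 0 \<le> r \<and> r < 1 \<longrightarrow> c / ((1 - r) * F r) \<le> (\<Sum>n. coef n * (r\<^sup>2) ^ n)"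
proof -
  obtain K where K: "K > 0" "\<And>r n. 0 \<le> r \<and> r < 1 \<and> 1 \<le> (2 * real n + 1) * (1 - r) \<Longrightarrow> mom n \<le> K * F r"
    using mom_upper by blast
  have summ: "summable (\<lambda>n. coef n * (r\<^sup>2) ^ n)" if "0 \<le> r" "r < 1" for r
    using coef_series_upper[of 1] that by (auto simp: power_less_one_iff abs_square_less_1)
  \<comment> \<open>In \<open>c1\<close>, \<open>exp (- 4)\<close> is the lower bound for
    \<open>r ^ (2 * N)\<close>, and the 4 comes from \<open>coef n = 1 / (2 * mom n)\<close> and
    \<open>1 - r\<^sup>2 \<le> 2 (1 - r)\<close>. In \<open>c2\<close>, \<open>F (1 / 2) / 2\<close>
    is the least possible value of \<open>(1 - r) F r\<close> allowed by monotonicity for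
    \<open>r \<le> 1 / 2\<close>.\<close>
  define c1 where "c1 = exp (- 4) / (4 * K)"
  define c2 where "c2 = coef 0 * F (1 / 2) / 2"
  have F2: "0 < F (1 / 2)" by (rule tail_pos) auto
  have c: "0 < c1" "0 < c2" using K(1) F2 coef_pos[of 0] by (auto simp: c1_def c2_def)
  have "min c1 c2 / ((1 - r) * F r) \<le> (\<Sum>n. coef n * (r\<^sup>2) ^ n)" if r: "0 \<le> r" "r < 1" for r
  proof (cases "r \<le> 1 / 2")
    case True
    have "min c1 c2 / ((1 - r) * F r) \<le> c2 / (1 / 2 * F (1 / 2))"
      using True c F2 tail_pos[OF r] by (intro frac_le mult_mono \<mu>.tail_antimono) auto
    also have "\<dots> = (\<Sum>n\<in>{0}. coef n * (r\<^sup>2) ^ n)" using F2 by (simp add: c2_def)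
    also have "\<dots> \<le> (\<Sum>n. coef n * (r\<^sup>2) ^ n)"
      using coef_pos r by (intro sum_le_suminf summ) (auto simp: less_imp_le)
    finally show ?thesis .
  next
    case False
    define v where "v = 1 - r"
    have v: "0 < v" "v \<le> 1 / 2" using False r by (auto simp: v_def)
    define N where "N = nat \<lceil>1 / (2 * v)\<rceil>"
    have N: "1 / (2 * v) \<le> real N" "real N \<le> 1 / (2 * v) + 1"
      using v by (auto simp: N_def of_nat_ceiling intro: order_trans[OF _ of_int_ceiling_le_add_one])
    have lower: "1 / (2 * (K * F r)) \<le> coef n" if "N \<le> n" for n
    proof -
      have "1 / (2 * v) \<le> real n" using N(1) that by linarith
      then have "1 \<le> (2 * real n + 1) * (1 - r)" using v by (simp add: v_def field_simps)
      then have "mom n \<le> K * F r" using K(2) r by blast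
      then show ?thesis unfolding coef_def using mom_pos[of n] by (intro frac_le) auto
    qed
    have r2: "r\<^sup>2 < 1" using r by (simp add: abs_square_less_1)
    \<comment> \<open>For \<open>v \<le> 1 / 2\<close> the logarithm of \<open>1 - v\<close> is at
      least \<open>- 2 * v\<close>, and \<open>N * v \<le> 1\<close> by the choice of
      \<open>N\<close>; together they give the exponent -4.\<close>
    have "exp (- 4) \<le> r ^ (2 * N)"
    proof -
      have "- v - 2 * v\<^sup>2 \<le> ln (1 - v)" using v by (intro ln_one_minus_pos_lower_bound) auto
      moreover have "v\<^sup>2 \<le> v / 2" using v by (simp add: power2_eq_square)
      ultimately have ln: "- 2 * v \<le> ln r" by (simp add: v_def)
      have "real N * v \<le> (1 / (2 * v) + 1) * v" using N(2) v by (intro mult_right_mono) auto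
      also have "\<dots> \<le> 1" using v by (simp add: field_simps)
      finally have "- 4 \<le> (2 * real N) * (- 2 * v)" by simp
      also have "\<dots> \<le> (2 * real N) * ln r" using ln by (intro mult_left_mono) auto
      finally have "exp (- 4) \<le> exp (real (2 * N) * ln r)" by simp
      also have "\<dots> = exp (ln r) ^ (2 * N)" by (rule exp_of_nat_mult)
      also have "exp (ln r) = r" using False by simp
      finally show ?thesis .
    qed
    have "c1 / ((1 - r) * F r) = (1 / (2 * (K * F r))) * (exp (- 4) / (2 * (1 - r)))"
      by (simp add: c1_def)
    also have "\<dots> \<le> (1 / (2 * (K * F r))) * (r ^ (2 * N) / (1 - r\<^sup>2))"
    proof (intro mult_left_mono frac_le)
      have "1 - r\<^sup>2 = (1 - r) * (1 + r)" by (simp add: power2_eq_square algebra_simps)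
      also have "\<dots> \<le> (1 - r) * 2" using r by (intro mult_left_mono) auto
      finally show "1 - r\<^sup>2 \<le> 2 * (1 - r)" by simp
      show "0 \<le> 1 / (2 * (K * F r))" using K(1) by simp
    qed (use \<open>exp (- 4) \<le> r ^ (2 * N)\<close> r2 r in auto)
    also have "\<dots> = (\<Sum>n. (1 / (2 * (K * F r))) * (r ^ (2 * N) * (r\<^sup>2) ^ n))"
    proof -
      have "(\<lambda>n. (r\<^sup>2) ^ n) sums (1 / (1 - r\<^sup>2))" using r2 by (intro geometric_sums) simp
      from sums_unique[OF sums_mult[OF sums_mult[OF this]]] show ?thesis
        by (simp only: times_divide_eq_right mult_1_right)
    qed
    also have "\<dots> \<le> (\<Sum>n. coef (n + N) * (r\<^sup>2) ^ (n + N))"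
    proof (rule suminf_le)
      show "1 / (2 * (K * F r)) * (r ^ (2 * N) * (r\<^sup>2) ^ n) \<le> coef (n + N) * (r\<^sup>2) ^ (n + N)" for n
      proof -
        have "r ^ (2 * N) * (r\<^sup>2) ^ n = (r\<^sup>2) ^ (n + N)" by (simp add: power_add power_mult)
        then show ?thesis using lower[of "n + N"] by (simp only:) (intro mult_right_mono, auto)
      qed
      show "summable (\<lambda>n. 1 / (2 * (K * F r)) * (r ^ (2 * N) * (r\<^sup>2) ^ n))"
        using r2 by (intro summable_mult summable_geometric) auto
      show "summable (\<lambda>n. coef (n + N) * (r\<^sup>2) ^ (n + N))"
        using summ[OF r] by (rule summable_ignore_initial_segment)
    qed
    also have "\<dots> \<le> (\<Sum>n. coef n * (r\<^sup>2) ^ n)"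
    proof -
      have "0 \<le> (\<Sum>n<N. coef n * (r\<^sup>2) ^ n)" using coef_pos by (intro sum_nonneg) (auto simp: less_imp_le)
      then show ?thesis using suminf_split_initial_segment[OF summ[OF r], of N] by simp
    qed
    finally have "c1 / ((1 - r) * F r) \<le> (\<Sum>n. coef n * (r\<^sup>2) ^ n)" .
    moreover have "min c1 c2 / ((1 - r) * F r) \<le> c1 / ((1 - r) * F r)"
      using r by (intro divide_right_mono) auto
    ultimately show ?thesis by linarith
  qed
  then show ?thesis using c by (intro exI[of _ "min c1 c2"]) auto
qed

end

subsection \<open>The Bergman kernel\<close>

context radial_weight
begin

lemma integral_\<mu>:
  assumes [measurable]: "g \<in> borel_measurable borel"
  shows "(LINT s|lebesgue. indicator {0..<1} s * \<omega> (of_real s) * g s) = (LINT s|\<mu>. g s)"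
proof -
  have "(LINT s|lebesgue. indicator {0..<1} s * \<omega> (of_real s) * g s) = (LINT s|lebesgue. indicator {0..<1} s * u s * g s)"
  proof (rule integral_cong_AE)
    show "(\<lambda>s. indicator {0..<1} s * \<omega> (of_real s) * g s) \<in> borel_measurable lebesgue"
      by (rule borel_measurable_times[OF \<omega>_real]) (rule measurable_completion, simp)
    show "(\<lambda>s. indicator {0..<1} s * u s * g s) \<in> borel_measurable lebesgue"
      by (intro measurable_completion) measurable
    show "AE s in lebesgue. indicator {0..<1} s * \<omega> (of_real s) * g s = indicator {0..<1} s * u s * g s"
      by (rule AE_completion, rule eventually_mono[OF AE_u]) (auto split: split_indicator)
  qed
  also have "\<dots> = (LINT s|lborel. indicator {0..<1} s * u s * g s)"
    by (rule integral_completion) measurable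
  also have "\<dots> = (LINT s|density lborel (\<lambda>s. ennreal (indicator {0..<1} s * u s)). g s)"
    by (subst integral_density) (auto simp: u_nonneg)
  also have "(\<lambda>s. ennreal (indicator {0..<1} s * u s)) = (\<lambda>s. indicator {0..<1} s * ennreal (u s))"
    by (auto split: split_indicator)
  finally show ?thesis by (simp only: \<mu>_def)
qed

lemma weight_hat_eq:
  assumes "z \<in> \<bbbD>"
  shows "weight_hat \<omega> z = \<mu>.tail (cmod z)"
proof -
  have "weight_hat \<omega> z = (LINT s|lebesgue. indicator {0..<1} s * \<omega> (of_real s) * indicator {cmod z..} s)"
    unfolding weight_hat_def set_lebesgue_integral_def
    by (intro Bochner_Integration.integral_cong) (auto split: split_indicator dest: order_trans[OF norm_ge_zero])
  also have "\<dots> = \<mu>.tail (cmod z)"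
    by (subst integral_\<mu>) (auto simp: \<mu>.tail_def)
  finally show ?thesis .
qed

lemma integral_dA_N:
  assumes "g \<in> borel_measurable dA"
  shows "(LINT z|dA. g z * \<omega> z) = (LINT z|N. g z)"
    and "integrable dA (\<lambda>z. g z * \<omega> z) \<longleftrightarrow> integrable N g"
proof -
  have "AE z in dA. 0 \<le> \<omega> z"
    using weight by (intro AE_I2) (simp add: is_weight_def)
  then show "(LINT z|dA. g z * \<omega> z) = (LINT z|N. g z)" "integrable dA (\<lambda>z. g z * \<omega> z) \<longleftrightarrow> integrable N g"
    unfolding N_def using assms by (simp_all add: integral_density integrable_density mult.commute)
qed

end

context doubling_weight
begin

lemma weight_moment_eq: "weight_moment \<omega> (2 * real n + 1) = mom n"
proof -
  have eq: "s powr (2 * real n + 1) = s ^ (2 * n + 1)" if "0 \<le> s" for s :: real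
    using that powr_realpow[of s "2 * n + 1"] by (cases "s = 0") (auto simp: add.commute)
  have "weight_moment \<omega> (2 * real n + 1) = (LINT s|lebesgue. indicator {0..<1} s * \<omega> (of_real s) * s ^ (2 * n + 1))"
    unfolding weight_moment_def set_lebesgue_integral_def
    by (intro Bochner_Integration.integral_cong) (auto simp: eq split: split_indicator)
  also have "\<dots> = mom n" unfolding mom_def by (rule integral_\<mu>) measurable
  finally show ?thesis .
qed

definition kernel_fun :: "complex \<Rightarrow> complex"
  where "kernel_fun x = (\<Sum>n. of_real (coef n) * x ^ n)"

definition kernel_real :: "real \<Rightarrow> real"
  where "kernel_real x = (\<Sum>n. coef n * x ^ n)"

text \<open>By Parseval this is the mean of the squared modulus of \<open>kernel_fun\<close> over
  the circle of radius \<open>x\<close>.\<close>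

definition kernel_mean :: "real \<Rightarrow> real"
  where "kernel_mean x = (\<Sum>n. (coef n * x ^ n)\<^sup>2)"

lemma bergman_kernel_eq: "bergman_kernel \<omega> z \<zeta> = kernel_fun (cnj z * \<zeta>)"
  unfolding bergman_kernel_def kernel_fun_def weight_moment_eq coef_def
  by (intro arg_cong[where f = suminf] ext) simp

lemma summable_coef: "0 \<le> x \<Longrightarrow> x < 1 \<Longrightarrow> summable (\<lambda>n. coef n * x ^ n)"
  using coef_series_upper[of 1] by auto

lemma summable_kernel: 
  assumes "cmod x < 1"
  shows "summable (\<lambda>n. cmod (of_real (coef n)) * cmod x ^ n)" "summable (\<lambda>n. complex_of_real (coef n) * x ^ n)"
proof -
  show s: "summable (\<lambda>n. cmod (of_real (coef n)) * cmod x ^ n)"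
    using summable_coef[of "cmod x"] assms coef_pos by (simp add: less_imp_le abs_of_pos)
  show "summable (\<lambda>n. complex_of_real (coef n) * x ^ n)"
    by (rule summable_norm_cancel) (use s in \<open>simp add: norm_mult norm_power\<close>)
qed

lemma kernel_fun_holomorphic: "kernel_fun holomorphic_on \<bbbD>"
proof (rule power_series_holomorphic)
  fix w :: complex assume "w \<in> \<bbbD>"
  then show "(\<lambda>n. complex_of_real (coef n) * (w - 0) ^ n) sums kernel_fun w"
    using summable_kernel(2)[of w] by (simp add: kernel_fun_def summable_sums)
qed

lemma kernel_fun_le: "cmod x < 1 \<Longrightarrow> cmod (kernel_fun x) \<le> kernel_real (cmod x)"
  unfolding kernel_fun_def kernel_real_def
  using summable_norm[of "\<lambda>n. complex_of_real (coef n) * x ^ n"] summable_kernel(1)[of x] coef_pos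
  by (simp add: norm_mult norm_power less_imp_le abs_of_pos)

lemma kernel_fun_of_real: "0 \<le> x \<Longrightarrow> x < 1 \<Longrightarrow> kernel_fun (of_real x) = of_real (kernel_real x)"
proof -
  assume "0 \<le> x" "x < 1"
  then have "complex_of_real (\<Sum>n. coef n * x ^ n) = (\<Sum>n. complex_of_real (coef n * x ^ n))"
    by (intro suminf_of_real summable_coef)
  then show ?thesis by (simp add: kernel_fun_def kernel_real_def)
qed

text \<open>The coefficients are real. This gives the symmetry of the modulus of the kernel in its
  two arguments, needed when the Schur test integrates in \<open>z\<close> instead of
  \<open>\<zeta>\<close>.\<close>

lemma kernel_fun_cnj: "cmod x < 1 \<Longrightarrow> cmod (kernel_fun (cnj x)) = cmod (kernel_fun x)"
proof -
  assume "cmod x < 1"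
  then have "(\<lambda>n. cnj (complex_of_real (coef n) * x ^ n)) sums cnj (kernel_fun x)"
    unfolding sums_cnj kernel_fun_def by (intro summable_sums summable_kernel)
  then have "kernel_fun (cnj x) = cnj (kernel_fun x)"
    unfolding kernel_fun_def by (simp add: sums_iff)
  then show ?thesis by simp
qed

lemma kernel_real_mono: "0 \<le> x \<Longrightarrow> x \<le> y \<Longrightarrow> y < 1 \<Longrightarrow> kernel_real x \<le> kernel_real y"
  unfolding kernel_real_def
  using coef_pos by (intro suminf_le summable_coef) (auto intro!: mult_left_mono power_mono simp: less_imp_le)

lemma kernel_real_pos: "0 \<le> x \<Longrightarrow> x < 1 \<Longrightarrow> 0 < kernel_real x"
proof -
  assume x: "0 \<le> x" "x < 1"
  have "(\<Sum>n\<in>{0}. coef n * x ^ n) \<le> kernel_real x"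
    unfolding kernel_real_def using coef_pos x by (intro sum_le_suminf summable_coef) (auto simp: less_imp_le)
  then show ?thesis using coef_pos[of 0] by simp
qed

lemma summable_kernel_mean: "0 \<le> x \<Longrightarrow> x < 1 \<Longrightarrow> summable (\<lambda>n. (coef n * x ^ n)\<^sup>2)"
  using parseval_circle(2)[OF summable_kernel(1), of "of_real x"] coef_pos by (simp add: abs_of_pos less_imp_le)

lemma kernel_mean_measurable [measurable]: "kernel_mean \<in> borel_measurable borel"
  unfolding kernel_mean_def by measurable

lemma circle_mean_kernel:
  assumes "cmod x < 1"
  shows "(\<integral>\<^sup>+t. ennreal ((cmod (kernel_fun (cis (2 * pi * t) * x)))\<^sup>2) * indicator {0..1} t \<partial>lborel)
    = ennreal (kernel_mean (cmod x))"
  using parseval_circle(1)[OF summable_kernel(1)[OF assms]] coef_pos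
  unfolding kernel_fun_def kernel_mean_def by (simp add: abs_of_pos less_imp_le)

lemma kernel_real_upper: "\<exists>K>0. \<forall>x. 0 \<le> x \<and> x < 1 \<longrightarrow> kernel_real x \<le> K / ((1 - x) * F x)"
  unfolding kernel_real_def using coef_series_upper[of 1] by auto

lemma kernel_real_lower: "\<exists>c>0. \<forall>r. 0 \<le> r \<and> r < 1 \<longrightarrow> c / ((1 - r) * F r) \<le> kernel_real (r\<^sup>2)"
  unfolding kernel_real_def by (rule coef_series_lower)

text \<open>Replacing \<open>x ^ (2 * n)\<close> by the larger \<open>x ^ n\<close> loses only a
  constant in the end and allows the tail to be evaluated at \<open>x\<close> itself.\<close>

lemma kernel_mean_upper: "\<exists>K>0. \<forall>x. 0 \<le> x \<and> x < 1 \<longrightarrow> kernel_mean x \<le> K / ((1 - x) * (F x)\<^sup>2)"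
proof -
  obtain K where K: "K > 0" "\<And>x. 0 \<le> x \<and> x < 1 \<Longrightarrow> summable (\<lambda>n. coef n ^ 2 * x ^ n) \<and>
     (\<Sum>n. coef n ^ 2 * x ^ n) \<le> K / ((1 - x) * F x ^ 2)"
    using coef_series_upper[of 2] by blast
  have "kernel_mean x \<le> K / ((1 - x) * (F x)\<^sup>2)" if x: "0 \<le> x" "x < 1" for x
  proof -
    have "kernel_mean x \<le> (\<Sum>n. coef n ^ 2 * x ^ n)"
      unfolding kernel_mean_def
    proof (rule suminf_le)
      show "(coef n * x ^ n)\<^sup>2 \<le> coef n ^ 2 * x ^ n" for n
        using x unfolding power_mult_distrib
        by (intro mult_left_mono) (auto simp: power2_eq_square mult_left_le power_le_one)
    qed (use K x summable_kernel_mean in auto)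
    also have "\<dots> \<le> K / ((1 - x) * (F x)\<^sup>2)" using K x by blast
    finally show ?thesis .
  qed
  then show ?thesis using K(1) by blast
qed

text \<open>The other factor is constant on circles, so averaging over rotations acts on the squared
  kernel only and turns it into \<open>kernel_mean\<close>. This is the reduction of both Schur
  estimates to one variable.\<close>

lemma nn_integral_kernel_radial:
  assumes G [measurable]: "G \<in> borel_measurable borel" and z: "z \<in> \<bbbD>"
  shows "(\<integral>\<^sup>+\<zeta>. ennreal ((cmod (kernel_fun (cnj z * \<zeta>)))\<^sup>2) * G (cmod \<zeta>) \<partial>N)
    = (\<integral>\<^sup>+s. ennreal (2 * s) * (ennreal (kernel_mean (cmod z * s)) * G s) \<partial>\<mu>)"
proof -
  have small: "cmod (cnj z * \<zeta>) < 1" if "\<zeta> \<in> \<bbbD>" for \<zeta>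
    using z that mult_strict_mono'[of "cmod z" 1 "cmod \<zeta>" 1] by (simp add: norm_mult)
  \<comment> \<open>Extension by zero outside the disc gives a Borel function on the whole plane, as
    the averaging lemma requires.\<close>
  define \<phi> where "\<phi> = (\<lambda>\<zeta>. ennreal (indicator \<bbbD> \<zeta> *\<^sub>R (cmod (kernel_fun (cnj z * \<zeta>)))\<^sup>2) * G (cmod \<zeta>))"
  have "continuous_on \<bbbD> (\<lambda>\<zeta>. (cmod (kernel_fun (cnj z * \<zeta>)))\<^sup>2)"
    by (intro continuous_intros continuous_on_compose2[OF holomorphic_on_imp_continuous_on[OF kernel_fun_holomorphic]])
       (use small in \<open>auto simp: dist_norm\<close>)
  then have [measurable]: "\<phi> \<in> borel_measurable borel"
    unfolding \<phi>_def by (intro borel_measurable_times_ennreal measurable_compose[OF _ measurable_ennreal]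
      borel_measurable_continuous_on_indicator) auto
  have "(\<integral>\<^sup>+\<zeta>. ennreal ((cmod (kernel_fun (cnj z * \<zeta>)))\<^sup>2) * G (cmod \<zeta>) \<partial>N) = (\<integral>\<^sup>+\<zeta>. \<phi> \<zeta> \<partial>N)"
    by (intro nn_integral_cong) (simp add: \<phi>_def)
  also have "\<dots> = (\<integral>\<^sup>+\<zeta>. (\<integral>\<^sup>+t. \<phi> (cis (2 * pi * t) * \<zeta>) * indicator {0..1} t \<partial>lborel) \<partial>N)"
    by (rule nn_integral_N_circle_average) measurable
  also have "\<dots> = (\<integral>\<^sup>+\<zeta>. ennreal (kernel_mean (cmod z * cmod \<zeta>)) * G (cmod \<zeta>) \<partial>N)"
  proof (rule nn_integral_cong)
    fix \<zeta> assume "\<zeta> \<in> space N"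
    then have \<zeta>: "\<zeta> \<in> \<bbbD>" by simp
    have eq: "\<phi> (cis (2 * pi * t) * \<zeta>) * indicator {0..1} t =
       G (cmod \<zeta>) * (ennreal ((cmod (kernel_fun (cis (2 * pi * t) * (cnj z * \<zeta>))))\<^sup>2) * indicator {0..1} t)" for t
      using \<zeta> by (simp add: \<phi>_def norm_mult mult_ac)
    have [measurable]: "(\<lambda>t. kernel_fun (cis (2 * pi * t) * (cnj z * \<zeta>))) \<in> borel_measurable borel"
      by (intro borel_measurable_continuous_onI continuous_intros continuous_on_compose2[OF holomorphic_on_imp_continuous_on[OF kernel_fun_holomorphic]])
         (use small[OF \<zeta>] in \<open>auto simp: norm_mult\<close>)
    have "(\<integral>\<^sup>+t. \<phi> (cis (2 * pi * t) * \<zeta>) * indicator {0..1} t \<partial>lborel) = G (cmod \<zeta>) *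
        (\<integral>\<^sup>+t. ennreal ((cmod (kernel_fun (cis (2 * pi * t) * (cnj z * \<zeta>))))\<^sup>2) * indicator {0..1} t \<partial>lborel)"
      unfolding eq by (rule nn_integral_cmult) measurable
    also have "\<dots> = ennreal (kernel_mean (cmod z * cmod \<zeta>)) * G (cmod \<zeta>)"
      unfolding circle_mean_kernel[OF small[OF \<zeta>]] by (simp add: norm_mult mult.commute)
    finally show "(\<integral>\<^sup>+t. \<phi> (cis (2 * pi * t) * \<zeta>) * indicator {0..1} t \<partial>lborel)
      = ennreal (kernel_mean (cmod z * cmod \<zeta>)) * G (cmod \<zeta>)" .
  qed
  also have "\<dots> = (\<integral>\<^sup>+s. ennreal (2 * s) * (ennreal (kernel_mean (cmod z * s)) * G s) \<partial>\<mu>)"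
    by (rule nn_integral_N_radial) measurable
  finally show ?thesis .
qed

text \<open>The reproducing identity for the norm of the kernel, obtained term by term: integrating
  the \<open>n\<close>-th term of the circle mean produces \<open>2 * mom n\<close>, which cancels
  one of the two factors \<open>coef n\<close>.\<close>

lemma nn_integral_kernel:
  assumes z: "z \<in> \<bbbD>"
  shows "(\<integral>\<^sup>+\<zeta>. ennreal ((cmod (kernel_fun (cnj z * \<zeta>)))\<^sup>2) \<partial>N) = ennreal (kernel_real ((cmod z)\<^sup>2))"
proof -
  define r where "r = cmod z"
  have r: "0 \<le> r" "r < 1" using z by (auto simp: r_def)
  have rs: "0 \<le> r * s" "r * s < 1" if "0 \<le> s" "s < 1" for s
    using r that mult_strict_mono'[of r 1 s 1] by auto
  have "(\<integral>\<^sup>+\<zeta>. ennreal ((cmod (kernel_fun (cnj z * \<zeta>)))\<^sup>2) \<partial>N) = (\<integral>\<^sup>+s. ennreal (2 * s) * ennreal (kernel_mean (r * s)) \<partial>\<mu>)"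
    using nn_integral_kernel_radial[OF _ z, of "\<lambda>_. 1"] by (simp add: r_def)
  also have "\<dots> = (\<integral>\<^sup>+s. (\<Sum>n. ennreal (2 * (coef n)\<^sup>2 * (r\<^sup>2) ^ n) * ennreal (s ^ (2 * n + 1))) \<partial>\<mu>)"
  proof (rule nn_integral_cong_AE, rule eventually_mono[OF AE_\<mu>])
    fix s :: real assume s: "0 \<le> s \<and> s < 1"
    have sm: "summable (\<lambda>n. (coef n * (r * s) ^ n)\<^sup>2)" using rs s by (intro summable_kernel_mean) auto
    have "ennreal (2 * s) * ennreal (kernel_mean (r * s)) = ennreal (2 * s * kernel_mean (r * s))"
      using s by (simp add: ennreal_mult')
    also have "2 * s * kernel_mean (r * s) = (\<Sum>n. 2 * s * (coef n * (r * s) ^ n)\<^sup>2)"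
      unfolding kernel_mean_def by (rule suminf_mult[OF sm, symmetric])
    also have "ennreal \<dots> = (\<Sum>n. ennreal (2 * s * (coef n * (r * s) ^ n)\<^sup>2))"
      using s by (intro suminf_ennreal2[symmetric] summable_mult sm) auto
    also have "\<dots> = (\<Sum>n. ennreal (2 * (coef n)\<^sup>2 * (r\<^sup>2) ^ n) * ennreal (s ^ (2 * n + 1)))"
    proof (intro arg_cong[where f = suminf] ext)
      fix n
      have "2 * s * (coef n * (r * s) ^ n)\<^sup>2 = (2 * (coef n)\<^sup>2 * (r\<^sup>2) ^ n) * s ^ (2 * n + 1)"
        by (simp add: power_mult_distrib power_mult[symmetric] power_add mult_ac)
      then show "ennreal (2 * s * (coef n * (r * s) ^ n)\<^sup>2) = ennreal (2 * (coef n)\<^sup>2 * (r\<^sup>2) ^ n) * ennreal (s ^ (2 * n + 1))"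
        using s by (simp only: ennreal_mult zero_le_power zero_le_mult_iff) (simp add: ennreal_mult)
    qed
    finally show "ennreal (2 * s) * ennreal (kernel_mean (r * s)) =
       (\<Sum>n. ennreal (2 * (coef n)\<^sup>2 * (r\<^sup>2) ^ n) * ennreal (s ^ (2 * n + 1)))" .
  qed
  also have "\<dots> = (\<Sum>n. \<integral>\<^sup>+s. ennreal (2 * (coef n)\<^sup>2 * (r\<^sup>2) ^ n) * ennreal (s ^ (2 * n + 1)) \<partial>\<mu>)"
    by (rule nn_integral_suminf) measurable
  also have "\<dots> = (\<Sum>n. ennreal (coef n * (r\<^sup>2) ^ n))"
  proof (intro arg_cong[where f = suminf] ext)
    fix n
    have "(\<integral>\<^sup>+s. ennreal (2 * (coef n)\<^sup>2 * (r\<^sup>2) ^ n) * ennreal (s ^ (2 * n + 1)) \<partial>\<mu>)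
      = ennreal (2 * (coef n)\<^sup>2 * (r\<^sup>2) ^ n) * (\<integral>\<^sup>+s. ennreal (s ^ (2 * n + 1)) \<partial>\<mu>)"
      by (rule nn_integral_cmult) measurable
    also have "(\<integral>\<^sup>+s. ennreal (s ^ (2 * n + 1)) \<partial>\<mu>) = ennreal (mom n)"
      unfolding mom_def
      by (rule nn_integral_eq_integral[OF integrable_power])
         (rule eventually_mono[OF AE_\<mu>], simp)
    also have "ennreal (2 * (coef n)\<^sup>2 * (r\<^sup>2) ^ n) * ennreal (mom n) = ennreal (2 * (coef n)\<^sup>2 * (r\<^sup>2) ^ n * mom n)"
      using mom_pos[of n] by (intro ennreal_mult[symmetric]) auto
    also have "2 * (coef n)\<^sup>2 * (r\<^sup>2) ^ n * mom n = coef n * (r\<^sup>2) ^ n"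
      using mom_pos[of n] by (simp add: coef_def power2_eq_square)
    finally show "(\<integral>\<^sup>+s. ennreal (2 * (coef n)\<^sup>2 * (r\<^sup>2) ^ n) * ennreal (s ^ (2 * n + 1)) \<partial>\<mu>) = ennreal (coef n * (r\<^sup>2) ^ n)" .
  qed
  also have "\<dots> = ennreal (kernel_real (r\<^sup>2))"
    unfolding kernel_real_def using coef_pos r
    by (intro suminf_ennreal2 summable_coef) (auto simp: less_imp_le abs_square_less_1)
  finally show ?thesis by (simp only: r_def)
qed

end

subsection \<open>Pointwise estimates\<close>

text \<open>Exhaustion by closed discs; it serves to conclude that a non-constant holomorphic
  function has only countably many zeros in the disc.\<close>

lemma fsigma_unit_disc: "fsigma \<bbbD>"
proof -
  have "\<exists>n::nat. z \<in> cball 0 (1 - 1 / real (Suc n))" if "z \<in> \<bbbD>" for z :: complex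
  proof -
    have "0 < 1 - cmod z" using that by simp
    then obtain n where "1 / real (Suc n) < 1 - cmod z" by (rule nat_approx_posE)
    then show ?thesis by (intro exI[of _ n]) simp
  qed
  moreover have "z \<in> \<bbbD>" if "z \<in> cball 0 (1 - 1 / real (Suc n))" for z :: complex and n
  proof -
    have "0 < 1 / real (Suc n)" by simp
    moreover have "cmod z \<le> 1 - 1 / real (Suc n)" using that by simp
    ultimately have "cmod z < 1" by linarith
    then show ?thesis by simp
  qed
  ultimately have "\<bbbD> = (\<Union>n::nat. cball (0::complex) (1 - 1 / real (Suc n)))" by blast
  then show ?thesis
    unfolding fsigma_Union_compact by (intro exI[of _ "\<lambda>n::nat. cball 0 (1 - 1 / real (Suc n))"]) auto
qed

context radial_weight
begin

lemma AE_N_cmod: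
  assumes "AE s in lborel. P s"
  shows "AE \<zeta> in N. P (cmod \<zeta>)"
proof -
  have "AE s in lborel. s \<in> {0..<1} \<longrightarrow> P s" using assms by eventually_elim simp
  then have "AE z in lebesgue. z \<in> \<bbbD> \<longrightarrow> P (cmod z)"
    by (intro AE_completion AE_cmod_disc)
  then have "AE z in lebesgue_on \<bbbD>. P (cmod z)"
    by (subst AE_restrict_space_iff) auto
  then have "AE z in dA. P (cmod z)"
    unfolding dA_def by (subst AE_density) (auto elim: eventually_mono)
  then show ?thesis
    unfolding N_def by (subst AE_density) (auto elim: eventually_mono)
qed

end

context doubling_weight
begin

text \<open>The circle estimate is integrated over all radii beyond the midpoint
  \<open>(1 + r) / 2\<close>. These radii are at distance at least \<open>(1 - r) / 2\<close> from
  \<open>r\<close>, and by doubling they carry mass at least \<open>F r / 2 ^ m\<close>. Circles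
  through a zero of \<open>g\<close> are excluded from the circle estimate, but countably many zeros
  give only a null set of radii.\<close>

lemma bergman_pointwise_bound:
  assumes hol: "g holomorphic_on \<bbbD>" and z: "z \<in> \<bbbD>" and q: "0 < q"
  shows "ennreal (cmod (g z) powr q) \<le>
    ennreal (2 * 2 ^ m / ((1 - cmod z) * F (cmod z))) * (\<integral>\<^sup>+\<zeta>. ennreal (cmod (g \<zeta>) powr q) \<partial>N)"
proof (cases "g z = 0")
  case False
  define r where "r = cmod z"
  have r: "0 \<le> r" "r < 1" using z by (auto simp: r_def)
  define \<rho> where "\<rho> = (1 + r) / 2"
  have \<rho>: "r < \<rho>" "\<rho> < 1" "0 < \<rho>" "1 / 2 \<le> \<rho>" using r by (auto simp: \<rho>_def)
  define \<phi> where "\<phi> = (\<lambda>\<zeta>. ennreal (indicator \<bbbD> \<zeta> *\<^sub>R (cmod (g \<zeta>) powr q)))"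
  have "continuous_on \<bbbD> (\<lambda>\<zeta>. cmod (g \<zeta>) powr q)"
    using q holomorphic_on_imp_continuous_on[OF hol]
    by (intro continuous_on_powr' continuous_intros) auto
  then have \<phi>m [measurable]: "\<phi> \<in> borel_measurable borel"
    unfolding \<phi>_def by (intro measurable_compose[OF _ measurable_ennreal]
      borel_measurable_continuous_on_indicator) auto
  define A where "A = (\<lambda>\<zeta>. \<integral>\<^sup>+t. \<phi> (cis (2 * pi * t) * \<zeta>) * indicator {0..1} t \<partial>lborel)"
  \<comment> \<open>The value at \<open>z\<close> divided by \<open>2 / (1 - r)\<close>, the worst
    Cauchy factor over the radii used.\<close>
  define c where "c = cmod (g z) powr q * ((1 - r) / 2)"
  have Aeq: "A \<zeta> = (\<integral>\<^sup>+t. ennreal (cmod (g (cis (2 * pi * t) * \<zeta>)) powr q) * indicator {0..1} t \<partial>lborel)"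
    if "\<zeta> \<in> \<bbbD>" for \<zeta>
    using that unfolding A_def by (intro nn_integral_cong) (simp add: \<phi>_def norm_mult)
  have nz_AE: "AE \<zeta> in N. \<forall>w\<in>\<bbbD>. g w = 0 \<longrightarrow> cmod w \<noteq> cmod \<zeta>"
  proof (cases "g constant_on \<bbbD>")
    case True
    then have "\<forall>w\<in>\<bbbD>. g w \<noteq> 0" using False z unfolding constant_on_def by metis
    then show ?thesis by simp
  next
    case nc: False
    have "countable {w\<in>\<bbbD>. g w = 0}"
      by (rule holomorphic_countable_zeros[OF hol _ _ _ nc]) (auto intro: fsigma_unit_disc)
    then have "cmod ` {w\<in>\<bbbD>. g w = 0} \<in> null_sets lborel"
      by (intro countable_imp_null_set_lborel countable_image)
    then have "AE s in lborel. s \<notin> cmod ` {w\<in>\<bbbD>. g w = 0}" by (rule AE_not_in)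
    then have "AE \<zeta> in N. cmod \<zeta> \<notin> cmod ` {w\<in>\<bbbD>. g w = 0}" by (rule AE_N_cmod)
    then show ?thesis
    proof (rule eventually_mono, intro ballI impI notI)
      fix \<zeta> w assume *: "cmod \<zeta> \<notin> cmod ` {w\<in>\<bbbD>. g w = 0}" "w \<in> \<bbbD>" "g w = 0" "cmod w = cmod \<zeta>"
      have "cmod w \<in> cmod ` {w\<in>\<bbbD>. g w = 0}" using *(2,3) by (intro imageI) simp
      then show False using *(1) unfolding *(4) by (rule notE[rotated])
    qed
  qed
  have c0: "0 \<le> c" using r by (simp add: c_def)
  have "AE \<zeta> in N. ennreal c * indicator {\<rho>..} (cmod \<zeta>) \<le> A \<zeta>"
    using nz_AE AE_space
  proof eventually_elim
    fix \<zeta> assume nz: "\<forall>w\<in>\<bbbD>. g w = 0 \<longrightarrow> cmod w \<noteq> cmod \<zeta>" and "\<zeta> \<in> space N"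
    then have \<zeta>: "\<zeta> \<in> \<bbbD>" by simp
    show "ennreal c * indicator {\<rho>..} (cmod \<zeta>) \<le> A \<zeta>"
    proof (cases "\<rho> \<le> cmod \<zeta>")
      case True
      have "ennreal (cmod (g z) powr q) \<le> ennreal (cmod \<zeta> / (cmod \<zeta> - cmod z)) * A \<zeta>"
        unfolding Aeq[OF \<zeta>]
        by (rule circle_mean_bound[OF hol]) (use True \<zeta> \<rho> q nz in \<open>auto simp: r_def\<close>)
      also have "\<dots> \<le> ennreal (2 / (1 - r)) * A \<zeta>"
      proof (intro mult_right_mono ennreal_leI)
        have "cmod \<zeta> / (cmod \<zeta> - cmod z) \<le> 1 / ((1 - r) / 2)"
          using True \<zeta> r by (intro frac_le) (auto simp: \<rho>_def r_def[symmetric])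
        then show "cmod \<zeta> / (cmod \<zeta> - cmod z) \<le> 2 / (1 - r)" by simp
      qed simp
      finally have "ennreal ((1 - r) / 2) * ennreal (cmod (g z) powr q) \<le> ennreal ((1 - r) / 2) * (ennreal (2 / (1 - r)) * A \<zeta>)"
        by (rule mult_left_mono) simp
      also have "\<dots> = A \<zeta>"
      proof -
        have "ennreal ((1 - r) / 2) * ennreal (2 / (1 - r)) = ennreal ((1 - r) / 2 * (2 / (1 - r)))"
          using r by (intro ennreal_mult[symmetric]) auto
        also have "\<dots> = 1" using r by simp
        finally show ?thesis by (simp only: mult.assoc[symmetric] mult_1_left)
      qed
      finally show ?thesis
        using True r by (simp add: c_def ennreal_mult'' mult.commute del: times_divide_eq_left times_divide_eq_right)
    qed simp
  qed
  then have "(\<integral>\<^sup>+\<zeta>. ennreal c * indicator {\<rho>..} (cmod \<zeta>) \<partial>N) \<le> (\<integral>\<^sup>+\<zeta>. A \<zeta> \<partial>N)"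
    by (rule nn_integral_mono_AE)
  also have "\<dots> = (\<integral>\<^sup>+\<zeta>. \<phi> \<zeta> \<partial>N)"
    unfolding A_def by (rule nn_integral_N_circle_average[symmetric]) measurable
  also have "\<dots> = (\<integral>\<^sup>+\<zeta>. ennreal (cmod (g \<zeta>) powr q) \<partial>N)"
    by (intro nn_integral_cong) (simp add: \<phi>_def)
  finally have 1: "(\<integral>\<^sup>+\<zeta>. ennreal c * indicator {\<rho>..} (cmod \<zeta>) \<partial>N) \<le> (\<integral>\<^sup>+\<zeta>. ennreal (cmod (g \<zeta>) powr q) \<partial>N)" .
  have "F r \<le> 2 ^ m * F \<rho>" unfolding \<rho>_def by (rule doubling[OF r])
  then have "ennreal (c * (F r / 2 ^ m)) \<le> ennreal (c * F \<rho>)"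
    using c0 by (intro ennreal_leI mult_left_mono) (auto simp: field_simps)
  also have "\<dots> = ennreal c * emeasure \<mu> {\<rho>..}"
    using c0 by (simp add: \<mu>.emeasure_eq_measure \<mu>.tail_def ennreal_mult)
  also have "\<dots> = (\<integral>\<^sup>+s. ennreal c * indicator {\<rho>..} s \<partial>\<mu>)"
    by (rule nn_integral_cmult_indicator[symmetric]) simp
  \<comment> \<open>The area factor \<open>2 * s\<close> may be inserted because
    \<open>\<rho>\<close> is at least 1/2.\<close>
  also have "\<dots> \<le> (\<integral>\<^sup>+s. ennreal (2 * s) * (ennreal c * indicator {\<rho>..} s) \<partial>\<mu>)"
  proof (rule nn_integral_mono)
    fix s
    show "ennreal c * indicator {\<rho>..} s \<le> ennreal (2 * s) * (ennreal c * indicator {\<rho>..} s)"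
    proof (cases "\<rho> \<le> s")
      case True
      then have "1 \<le> ennreal (2 * s)" using \<rho> by simp
      then show ?thesis using mult_right_mono[of 1 "ennreal (2 * s)" "ennreal c * indicator {\<rho>..} s"] by simp
    qed simp
  qed
  also have "\<dots> = (\<integral>\<^sup>+\<zeta>. ennreal c * indicator {\<rho>..} (cmod \<zeta>) \<partial>N)"
    by (rule nn_integral_N_radial[symmetric]) measurable
  also note 1
  finally have 2: "ennreal (c * (F r / 2 ^ m)) \<le> (\<integral>\<^sup>+\<zeta>. ennreal (cmod (g \<zeta>) powr q) \<partial>N)" .
  have Fr: "0 < F r" by (rule tail_pos[OF r])
  have "cmod (g z) powr q = 2 * 2 ^ m / ((1 - r) * F r) * (c * (F r / 2 ^ m))"
    using r Fr by (simp add: c_def)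
  then have "ennreal (cmod (g z) powr q) = ennreal (2 * 2 ^ m / ((1 - r) * F r)) * ennreal (c * (F r / 2 ^ m))"
    using r Fr by (subst ennreal_mult[symmetric]) (auto simp: c_def)
  also have "\<dots> \<le> ennreal (2 * 2 ^ m / ((1 - r) * F r)) * (\<integral>\<^sup>+\<zeta>. ennreal (cmod (g \<zeta>) powr q) \<partial>N)"
    using 2 by (rule mult_left_mono) simp
  finally show ?thesis by (simp only: r_def)
qed (use q in simp)

section \<open>The Berezin kernel and the pointwise estimate\<close>

lemma berezin_kernel_eq:
  assumes z: "z \<in> \<bbbD>"
  shows "berezin_kernel \<omega> z \<zeta> = (cmod (kernel_fun (cnj z * \<zeta>)))\<^sup>2 / kernel_real ((cmod z)\<^sup>2)"
proof -
  have small: "cmod (cnj z * \<zeta>) < 1" if "\<zeta> \<in> \<bbbD>" for \<zeta>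
    using z that mult_strict_mono'[of "cmod z" 1 "cmod \<zeta>" 1] by (simp add: norm_mult)
  have meas: "(\<lambda>\<zeta>. (cmod (kernel_fun (cnj z * \<zeta>)))\<^sup>2) \<in> borel_measurable dA"
    by (intro borel_measurable_dA_continuous continuous_intros continuous_on_compose2[OF holomorphic_on_imp_continuous_on[OF kernel_fun_holomorphic]])
       (use small in \<open>auto simp: dist_norm\<close>)
  have k: "0 < kernel_real ((cmod z)\<^sup>2)" using z by (intro kernel_real_pos) (auto simp: abs_square_less_1)
  have "(LINT \<zeta>|dA. cmod (bergman_kernel \<omega> z \<zeta>) powr 2 * \<omega> \<zeta>) = (LINT \<zeta>|dA. (cmod (kernel_fun (cnj z * \<zeta>)))\<^sup>2 * \<omega> \<zeta>)"
    by (simp add: bergman_kernel_eq)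
  also have "\<dots> = (LINT \<zeta>|N. (cmod (kernel_fun (cnj z * \<zeta>)))\<^sup>2)"
    by (rule integral_dA_N[OF meas])
  also have "\<dots> = kernel_real ((cmod z)\<^sup>2)"
    using nn_integral_kernel[OF z] meas k by (subst integral_eq_nn_integral) (auto cong: measurable_cong_sets)
  finally have "(bergman_norm 2 \<omega> (bergman_kernel \<omega> z))\<^sup>2 = kernel_real ((cmod z)\<^sup>2)"
    using k unfolding bergman_norm_def by (simp add: powr_half_sqrt)
  then show ?thesis by (simp add: berezin_kernel_def bergman_kernel_eq)
qed

lemma cnj_mult_in_disc: "z \<in> \<bbbD> \<Longrightarrow> \<zeta> \<in> \<bbbD> \<Longrightarrow> cmod (cnj z * \<zeta>) < 1"
  using mult_strict_mono'[of "cmod z" 1 "cmod \<zeta>" 1] by (simp add: norm_mult)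

lemma kernel_section_holomorphic:
  assumes "z \<in> \<bbbD>"
  shows "(\<lambda>\<zeta>. kernel_fun (cnj z * \<zeta>)) holomorphic_on \<bbbD>"
  by (rule holomorphic_on_compose_gen[of "\<lambda>\<zeta>. cnj z * \<zeta>" _ kernel_fun \<bbbD>, unfolded o_def])
     (use cnj_mult_in_disc[OF assms] in \<open>auto intro!: holomorphic_intros kernel_fun_holomorphic simp: dist_norm\<close>)

lemma kernel_section_bound:
  assumes "z \<in> \<bbbD>" "\<zeta> \<in> \<bbbD>"
  shows "cmod (kernel_fun (cnj z * \<zeta>)) \<le> kernel_real (cmod z)"
proof -
  have "cmod (kernel_fun (cnj z * \<zeta>)) \<le> kernel_real (cmod (cnj z * \<zeta>))"
    by (rule kernel_fun_le[OF cnj_mult_in_disc[OF assms]])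
  also have "\<dots> \<le> kernel_real (cmod z)"
    using assms by (intro kernel_real_mono) (auto simp: norm_mult mult_left_le)
  finally show ?thesis .
qed

lemma powr_norm_measurable:
  assumes "f holomorphic_on \<bbbD>" "0 < q"
  shows "(\<lambda>\<zeta>. cmod (f \<zeta>) powr q) \<in> borel_measurable dA"
  using assms
  by (intro borel_measurable_dA_continuous continuous_on_powr' continuous_intros holomorphic_on_imp_continuous_on) auto

lemma berezin_kernel_measurable:
  assumes "z \<in> \<bbbD>"
  shows "berezin_kernel \<omega> z \<in> borel_measurable dA"
  unfolding berezin_kernel_eq[OF assms, abs_def]
  by (intro borel_measurable_divide borel_measurable_const borel_measurable_dA_continuous continuous_intros
      holomorphic_on_imp_continuous_on kernel_section_holomorphic assms)

lemma kernel_real_sq_pos: "z \<in> \<bbbD> \<Longrightarrow> 0 < kernel_real ((cmod z)\<^sup>2)"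
  by (intro kernel_real_pos) (auto simp: abs_square_less_1)

lemma berezin_kernel_nonneg: "z \<in> \<bbbD> \<Longrightarrow> 0 \<le> berezin_kernel \<omega> z \<zeta>"
  using kernel_real_sq_pos[of z] by (simp add: berezin_kernel_eq)

text \<open>For fixed \<open>z\<close> the kernel is bounded on the disc, so integrability carries
  over from the power of \<open>f\<close>. This has to be secured because a Bochner integral of a
  non-integrable function is 0, which would falsify the size of the Berezin transform.\<close>

lemma berezin_integral:
  assumes f: "f holomorphic_on \<bbbD>" and q: "0 < q" and int: "integrable N (\<lambda>\<zeta>. cmod (f \<zeta>) powr q)" and z: "z \<in> \<bbbD>"
  shows "integrable N (\<lambda>\<zeta>. cmod (f \<zeta>) powr q * berezin_kernel \<omega> z \<zeta>)"
    and "(LINT \<zeta>|dA. cmod (f \<zeta>) powr q * berezin_kernel \<omega> z \<zeta> * \<omega> \<zeta>) = (LINT \<zeta>|N. cmod (f \<zeta>) powr q * berezin_kernel \<omega> z \<zeta>)"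
proof -
  have m: "(\<lambda>\<zeta>. cmod (f \<zeta>) powr q * berezin_kernel \<omega> z \<zeta>) \<in> borel_measurable dA"
    using powr_norm_measurable[OF f q] berezin_kernel_measurable[OF z] by (rule borel_measurable_times)
  then show "(LINT \<zeta>|dA. cmod (f \<zeta>) powr q * berezin_kernel \<omega> z \<zeta> * \<omega> \<zeta>) = (LINT \<zeta>|N. cmod (f \<zeta>) powr q * berezin_kernel \<omega> z \<zeta>)"
    by (rule integral_dA_N)
  define M where "M = (kernel_real (cmod z))\<^sup>2 / kernel_real ((cmod z)\<^sup>2)"
  have M: "berezin_kernel \<omega> z \<zeta> \<le> M" if "\<zeta> \<in> \<bbbD>" for \<zeta>
    unfolding M_def berezin_kernel_eq[OF z]
    using kernel_section_bound[OF z that] kernel_real_sq_pos[OF z] by (intro divide_right_mono power_mono) auto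
  show "integrable N (\<lambda>\<zeta>. cmod (f \<zeta>) powr q * berezin_kernel \<omega> z \<zeta>)"
  proof (rule Bochner_Integration.integrable_bound[OF integrable_mult_left[OF int, of M]])
    show "(\<lambda>\<zeta>. cmod (f \<zeta>) powr q * berezin_kernel \<omega> z \<zeta>) \<in> borel_measurable N"
      using m by (subst measurable_cong_sets[OF sets_N refl])
    show "AE \<zeta> in N. norm (cmod (f \<zeta>) powr q * berezin_kernel \<omega> z \<zeta>) \<le> norm (cmod (f \<zeta>) powr q * M)"
    proof (rule AE_I2)
      fix \<zeta> assume "\<zeta> \<in> space N"
      then have "berezin_kernel \<omega> z \<zeta> \<le> M" "0 \<le> berezin_kernel \<omega> z \<zeta>"
        using M berezin_kernel_nonneg[OF z] by auto
      then show "norm (cmod (f \<zeta>) powr q * berezin_kernel \<omega> z \<zeta>) \<le> norm (cmod (f \<zeta>) powr q * M)"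
        by (simp add: abs_mult mult_left_mono)
    qed
  qed
qed

text \<open>Of the \<open>a = n q\<close> powers of the kernel in the integrand, two form the
  Berezin kernel and the remaining \<open>a - 2\<close> are estimated by the maximum
  \<open>k1\<close>. On the left stands the value at \<open>\<zeta> = z\<close>, the
  \<open>a\<close>-th power of \<open>k2\<close>. Since \<open>k1\<close> is at most
  \<open>K / c\<close> times \<open>k2\<close>, both sides balance.\<close>

lemma berezin_pointwise_bound:
  assumes q: "0 < q"
  shows "\<exists>C>0. \<forall>f\<in>bergman_space q \<omega>. \<forall>z\<in>\<bbbD>. cmod (f z) powr q
    \<le> C * (LINT \<zeta>|dA. cmod (f \<zeta>) powr q * berezin_kernel \<omega> z \<zeta> * \<omega> \<zeta>)"
proof -
  obtain n :: nat where "2 / q \<le> real n" using real_arch_simple by blast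
  define a where "a = real n * q"
  have a: "2 \<le> a" using \<open>2 / q \<le> real n\<close> q by (simp add: a_def field_simps)
  have n: "n > 0" using a by (cases n) (auto simp: a_def)
  obtain c where c: "c > 0" "\<And>r. 0 \<le> r \<and> r < 1 \<Longrightarrow> c / ((1 - r) * F r) \<le> kernel_real (r\<^sup>2)"
    using kernel_real_lower by blast
  obtain K where K: "K > 0" "\<And>x. 0 \<le> x \<and> x < 1 \<Longrightarrow> kernel_real x \<le> K / ((1 - x) * F x)"
    using kernel_real_upper by blast
  \<comment> \<open>The factor \<open>2 * 2 ^ m / c\<close> comes from the Bergman estimate with
    \<open>1 / ((1 - r) * F r)\<close> replaced by \<open>k2 / c\<close>; the last factor pays for
    the surplus power.\<close>
  define C where "C = 2 * 2 ^ m / c * (K / c) powr (a - 2)"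
  have "C > 0" using c K by (simp add: C_def)
  moreover have "cmod (f z) powr q \<le> C * (LINT \<zeta>|dA. cmod (f \<zeta>) powr q * berezin_kernel \<omega> z \<zeta> * \<omega> \<zeta>)"
    if f: "f \<in> bergman_space q \<omega>" and z: "z \<in> \<bbbD>" for f z
  proof -
    have hol: "f holomorphic_on \<bbbD>" and int: "integrable N (\<lambda>\<zeta>. cmod (f \<zeta>) powr q)"
      using f integral_dA_N(2)[OF powr_norm_measurable] q by (auto simp: bergman_space_def)
    define r where "r = cmod z"
    have r: "0 \<le> r" "r < 1" using z by (auto simp: r_def)
    define W where "W = 1 / ((1 - r) * F r)"
    have W: "0 < W" using r tail_pos[OF r] by (simp add: W_def)
    define k1 k2 where "k1 = kernel_real r" and "k2 = kernel_real (r\<^sup>2)"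
    have k: "c * W \<le> k2" "k1 \<le> K * W" "0 < k2" "0 < k1"
      using c(2)[of r] K(2)[of r] r kernel_real_sq_pos[OF z] kernel_real_pos[OF r]
      by (auto simp: k1_def k2_def W_def r_def)
    define B where "B = (\<lambda>\<zeta>. kernel_fun (cnj z * \<zeta>))"
    have Bz: "B z = of_real k2"
    proof -
      have "cnj z * z = of_real (r\<^sup>2)" unfolding r_def complex_norm_square by (rule mult.commute)
      then show ?thesis using kernel_fun_of_real[of "r\<^sup>2"] r by (simp add: B_def k2_def abs_square_less_1)
    qed
    have Ble: "cmod (B \<zeta>) \<le> k1" if "\<zeta> \<in> \<bbbD>" for \<zeta>
      using kernel_section_bound[OF z that] by (simp add: B_def k1_def r_def)
    define I where "I = (LINT \<zeta>|N. cmod (f \<zeta>) powr q * berezin_kernel \<omega> z \<zeta>)"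
    have "0 \<le> I" unfolding I_def using berezin_kernel_nonneg[OF z] by (intro integral_nonneg_AE AE_I2) auto
    define g where "g = (\<lambda>\<zeta>. f \<zeta> * B \<zeta> ^ n)"
    have "g holomorphic_on \<bbbD>"
      unfolding g_def B_def by (intro holomorphic_intros hol kernel_section_holomorphic z)
    then have 1: "ennreal (cmod (g z) powr q) \<le> ennreal (2 * 2 ^ m * W) * (\<integral>\<^sup>+\<zeta>. ennreal (cmod (g \<zeta>) powr q) \<partial>N)"
      using bergman_pointwise_bound[OF _ z q, of g] by (simp add: W_def r_def)
    have gq: "cmod (g \<zeta>) powr q = cmod (f \<zeta>) powr q * cmod (B \<zeta>) powr a" for \<zeta>
      using n by (cases "B \<zeta> = 0") (auto simp: g_def a_def norm_mult norm_power powr_mult powr_powr simp flip: powr_realpow)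
    have "(\<integral>\<^sup>+\<zeta>. ennreal (cmod (g \<zeta>) powr q) \<partial>N) \<le>
        (\<integral>\<^sup>+\<zeta>. ennreal (k1 powr (a - 2) * k2 * (cmod (f \<zeta>) powr q * berezin_kernel \<omega> z \<zeta>)) \<partial>N)"
    proof (intro nn_integral_mono ennreal_leI)
      fix \<zeta> assume "\<zeta> \<in> space N"
      then have \<zeta>: "\<zeta> \<in> \<bbbD>" by simp
      have "cmod (B \<zeta>) powr a = cmod (B \<zeta>) powr (a - 2) * (cmod (B \<zeta>))\<^sup>2"
      proof (cases "B \<zeta> = 0")
        case False
        then have "(cmod (B \<zeta>))\<^sup>2 = cmod (B \<zeta>) powr 2" by simp
        then show ?thesis by (simp only: powr_add[symmetric]) simp
      qed simp
      also have "\<dots> \<le> k1 powr (a - 2) * (cmod (B \<zeta>))\<^sup>2"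
        using Ble[OF \<zeta>] a by (intro mult_right_mono powr_mono2) auto
      also have "(cmod (B \<zeta>))\<^sup>2 = k2 * berezin_kernel \<omega> z \<zeta>"
        unfolding berezin_kernel_eq[OF z] using k(3) by (simp add: B_def k2_def r_def)
      finally have "cmod (f \<zeta>) powr q * cmod (B \<zeta>) powr a \<le> cmod (f \<zeta>) powr q * (k1 powr (a - 2) * (k2 * berezin_kernel \<omega> z \<zeta>))"
        by (rule mult_left_mono) simp
      then show "cmod (g \<zeta>) powr q \<le> k1 powr (a - 2) * k2 * (cmod (f \<zeta>) powr q * berezin_kernel \<omega> z \<zeta>)"
        unfolding gq by (simp only: mult_ac)
    qed
    also have "\<dots> = ennreal (LINT \<zeta>|N. k1 powr (a - 2) * k2 * (cmod (f \<zeta>) powr q * berezin_kernel \<omega> z \<zeta>))"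
      using berezin_integral(1)[OF hol q int z] k berezin_kernel_nonneg[OF z]
      by (intro nn_integral_eq_integral integrable_mult_right AE_I2) auto
    also have "(LINT \<zeta>|N. k1 powr (a - 2) * k2 * (cmod (f \<zeta>) powr q * berezin_kernel \<omega> z \<zeta>)) = k1 powr (a - 2) * k2 * I"
      unfolding I_def by (rule integral_mult_right_zero)
    finally have "ennreal (cmod (g z) powr q) \<le> ennreal (2 * 2 ^ m * W) * ennreal (k1 powr (a - 2) * k2 * I)"
      using 1 by (meson mult_left_mono order_trans zero_le)
    also have "\<dots> = ennreal (2 * 2 ^ m * W * (k1 powr (a - 2) * k2 * I))"
      using W k \<open>0 \<le> I\<close> by (intro ennreal_mult[symmetric]) auto
    finally have "cmod (f z) powr q * k2 powr a \<le> 2 * 2 ^ m * W * (k1 powr (a - 2) * k2 * I)"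
      using W k \<open>0 \<le> I\<close> unfolding gq Bz by (subst (asm) ennreal_le_iff) auto
    also have "\<dots> \<le> 2 * 2 ^ m * (k2 / c) * (((K / c) * k2) powr (a - 2) * k2 * I)"
    proof (intro mult_mono powr_mono2)
      show "W \<le> k2 / c" using k(1) c(1) by (simp add: field_simps)
      have "k1 \<le> K * W" by (rule k(2))
      also have "\<dots> \<le> K * (k2 / c)" using K(1) \<open>W \<le> k2 / c\<close> by (intro mult_left_mono) auto
      finally show "k1 \<le> K / c * k2" by simp
    qed (use W k a c(1) K(1) \<open>0 \<le> I\<close> in auto)
    \<comment> \<open>The exponents \<open>a - 2\<close> and 2 recombine to \<open>a\<close>, so the
      power of \<open>k2\<close> cancels against the left side.\<close>
    also have "\<dots> = C * I * (k2 powr (a - 2) * k2\<^sup>2)"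
    proof -
      have "((K / c) * k2) powr (a - 2) = (K / c) powr (a - 2) * k2 powr (a - 2)"
        by (rule powr_mult)
      then show ?thesis by (simp add: C_def power2_eq_square mult_ac)
    qed
    also have "k2 powr (a - 2) * k2\<^sup>2 = k2 powr a"
    proof -
      have "k2\<^sup>2 = k2 powr 2" using k by simp
      then show ?thesis by (simp only: powr_add[symmetric] diff_add_cancel)
    qed
    finally have "cmod (f z) powr q \<le> C * I"
      using k(3) by simp
    then show ?thesis unfolding I_def berezin_integral(2)[OF hol q int z] .
  qed
  ultimately show ?thesis by blast
qed

end

subsection \<open>Schur test for the Berezin transform\<close>

text \<open>Young's inequality after normalisation. The right side is extended-real, so no
  integrability of \<open>f powr t\<close> has to be known; the values infinity and 0 are treated
  apart because the normalising constant must be finite and positive.\<close>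

lemma holder_nn_integral:
  fixes f g :: "'a \<Rightarrow> real"
  assumes [measurable]: "f \<in> borel_measurable M" "g \<in> borel_measurable M"
    and nonneg: "\<And>x. x \<in> space M \<Longrightarrow> 0 \<le> f x" "\<And>x. x \<in> space M \<Longrightarrow> 0 \<le> g x"
    and ts: "1 < t" "s = t / (t - 1)" and H: "0 < H"
    and g: "(\<integral>\<^sup>+x. ennreal (g x powr s) \<partial>M) \<le> ennreal H"
  shows "ennreal ((LINT x|M. f x * g x) powr t) \<le> ennreal (H powr (t - 1)) * (\<integral>\<^sup>+x. ennreal (f x powr t) \<partial>M)"
proof -
  have s: "1 < s" "1 / t + 1 / s = 1" "t / s = t - 1"
    unfolding ts(2) using ts(1) by (simp_all add: less_divide_eq field_simps)
  define X where "X = (\<integral>\<^sup>+x. ennreal (f x powr t) \<partial>M)"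
  consider "X = \<infinity>" | "X = 0" | x where "X = ennreal x" "x > 0"
    by (cases X rule: ennreal_cases) (force simp: less_le)+
  then show ?thesis
  proof cases
    case 1
    have "ennreal (H powr (t - 1)) \<noteq> 0" using H by simp
    then show ?thesis unfolding X_def[symmetric] 1 by (simp add: ennreal_mult_top)
  next
    case 2
    then have "AE x in M. ennreal (f x powr t) = 0"
      unfolding X_def by (subst (asm) nn_integral_0_iff_AE) auto
    then have "AE x in M. f x * g x = 0"
    proof (rule eventually_mono)
      fix x assume "ennreal (f x powr t) = 0"
      then have "f x powr t = 0" using powr_ge_zero[of "f x" t] by (simp only: ennreal_eq_0_iff antisym)
      then show "f x * g x = 0" by simp
    qed
    then have "(LINT x|M. f x * g x) = 0" by (rule integral_eq_zero_AE)
    then show ?thesis using ts by simp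
  next
    case 3
    \<comment> \<open>\<open>\<alpha>\<close> is the exact norm of \<open>f\<close>, while
      \<open>\<beta>\<close> is only the given bound for the norm of \<open>g\<close>.\<close>
    define \<alpha> \<beta> where "\<alpha> = x powr (1 / t)" and "\<beta> = H powr (1 / s)"
    have ab: "0 < \<alpha>" "0 < \<beta>" "\<alpha> powr t = x" "\<beta> powr s = H"
      using 3 H ts s by (auto simp: \<alpha>_def \<beta>_def powr_powr)
    have fg: "f y * g y \<le> \<alpha> * \<beta> / (t * x) * f y powr t + \<alpha> * \<beta> / (s * H) * g y powr s" if "y \<in> space M" for y
    proof -
      have "(f y / \<alpha>) * (g y / \<beta>) \<le> (f y / \<alpha>) powr t / t + (g y / \<beta>) powr s / s"
        using that ts s ab nonneg by (intro Youngs_inequality) auto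
      also have "(f y / \<alpha>) powr t = f y powr t / x" using ab nonneg that by (simp add: powr_divide)
      also have "(g y / \<beta>) powr s = g y powr s / H" using ab nonneg that by (simp add: powr_divide)
      finally have "(\<alpha> * \<beta>) * ((f y / \<alpha>) * (g y / \<beta>)) \<le> (\<alpha> * \<beta>) * (f y powr t / x / t + g y powr s / H / s)"
        using ab by (intro mult_left_mono) auto
      then show ?thesis using ab by (simp add: algebra_simps)
    qed
    have combine: "ennreal (c1 * a1 + c2 * a2) = ennreal c1 * ennreal a1 + ennreal c2 * ennreal a2"
      if "0 \<le> c1" "0 \<le> c2" "0 \<le> a1" "0 \<le> a2" for c1 c2 a1 a2 :: real
      using that by (simp add: ennreal_mult ennreal_plus)
    have c: "0 \<le> \<alpha> * \<beta> / (t * x)" "0 \<le> \<alpha> * \<beta> / (s * H)" using ab 3 H ts(1) s(1) by auto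
    have "(\<integral>\<^sup>+y. ennreal (f y * g y) \<partial>M) \<le>
        (\<integral>\<^sup>+y. ennreal (\<alpha> * \<beta> / (t * x)) * ennreal (f y powr t) + ennreal (\<alpha> * \<beta> / (s * H)) * ennreal (g y powr s) \<partial>M)"
    proof (rule nn_integral_mono)
      fix y assume "y \<in> space M"
      from ennreal_leI[OF fg[OF this]] show "ennreal (f y * g y) \<le>
        ennreal (\<alpha> * \<beta> / (t * x)) * ennreal (f y powr t) + ennreal (\<alpha> * \<beta> / (s * H)) * ennreal (g y powr s)"
        by (simp only: combine[OF c powr_ge_zero powr_ge_zero])
    qed
    also have "\<dots> = ennreal (\<alpha> * \<beta> / (t * x)) * ennreal x + ennreal (\<alpha> * \<beta> / (s * H)) * (\<integral>\<^sup>+y. ennreal (g y powr s) \<partial>M)"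
      unfolding 3(1)[symmetric] X_def by (simp add: nn_integral_add nn_integral_cmult)
    also have "\<dots> \<le> ennreal (\<alpha> * \<beta> / (t * x)) * ennreal x + ennreal (\<alpha> * \<beta> / (s * H)) * ennreal H"
      using g by (intro add_left_mono mult_left_mono) auto
    also have "\<dots> = ennreal (\<alpha> * \<beta> / (t * x) * x + \<alpha> * \<beta> / (s * H) * H)"
      using 3(2) H by (subst combine[OF c]) auto
    also have "\<alpha> * \<beta> / (t * x) * x + \<alpha> * \<beta> / (s * H) * H = \<alpha> * \<beta> * (1 / t + 1 / s)"
      using 3 H by (simp add: algebra_simps)
    also have "\<dots> = \<alpha> * \<beta>" using s by simp
    finally have "(LINT x|M. f x * g x) \<le> \<alpha> * \<beta>"
      using ab nonneg by (subst integral_eq_nn_integral) (auto intro!: enn2real_leI AE_I2)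
    moreover have "0 \<le> (LINT x|M. f x * g x)" using nonneg by (intro integral_nonneg_AE AE_I2) auto
    ultimately have "(LINT x|M. f x * g x) powr t \<le> (\<alpha> * \<beta>) powr t" using ts by (intro powr_mono2) auto
    also have "\<dots> = H powr (t - 1) * x"
      using ab H s by (simp add: powr_mult \<beta>_def powr_powr)
    finally show ?thesis
      unfolding X_def[symmetric] 3(1) using 3(2) by (subst ennreal_mult[symmetric]) (auto intro: ennreal_leI)
  qed
qed

text \<open>The kernel is split as \<open>K powr (1 / t)\<close> times \<open>K powr (1 / s)\<close>
  and the factor \<open>h / h\<close> is inserted. In Hoelder's inequality the row condition
  controls the factor with exponent \<open>s\<close>; after Tonelli's theorem the column condition
  controls what is left of the other.\<close>

lemma (in sigma_finite_measure) schur_test: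
  fixes K :: "'a \<Rightarrow> 'a \<Rightarrow> real" and \<phi> h :: "'a \<Rightarrow> real"
  assumes K [measurable]: "(\<lambda>(x, y). K x y) \<in> borel_measurable (M \<Otimes>\<^sub>M M)"
    and K_nonneg: "\<And>x y. x \<in> space M \<Longrightarrow> y \<in> space M \<Longrightarrow> 0 \<le> K x y"
    and h [measurable]: "h \<in> borel_measurable M" and h_pos: "\<And>x. x \<in> space M \<Longrightarrow> 0 < h x"
    and \<phi> [measurable]: "\<phi> \<in> borel_measurable M" and \<phi>_nonneg: "\<And>x. x \<in> space M \<Longrightarrow> 0 \<le> \<phi> x"
    and ts: "1 < t" "s = t / (t - 1)" and AB: "0 < A" "0 \<le> B"
    and row: "\<And>x. x \<in> space M \<Longrightarrow> (\<integral>\<^sup>+y. ennreal (K x y * h y powr s) \<partial>M) \<le> ennreal (A * h x powr s)"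
    and col: "\<And>y. y \<in> space M \<Longrightarrow> (\<integral>\<^sup>+x. ennreal (K x y * h x powr t) \<partial>M) \<le> ennreal (B * h y powr t)"
  shows "(\<integral>\<^sup>+x. ennreal ((LINT y|M. \<phi> y * K x y) powr t) \<partial>M) \<le> ennreal (A powr (t - 1) * B) * (\<integral>\<^sup>+y. ennreal (\<phi> y powr t) \<partial>M)"
proof -
  have s: "1 < s" "1 / t + 1 / s = 1" "s * (t - 1) = t"
    unfolding ts(2) using ts(1) by (simp_all add: less_divide_eq field_simps)
  interpret pair_sigma_finite M M ..
  have Kx [measurable]: "K x \<in> borel_measurable M" if "x \<in> space M" for x
    using measurable_Pair2[OF K that] by simp
  have Ky [measurable]: "(\<lambda>x. K x y) \<in> borel_measurable M" if "y \<in> space M" for y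
    using measurable_Pair1[OF K that] by simp
  \<comment> \<open>The \<open>t\<close>-th power of \<open>\<phi> / h\<close>, written with a
    negative exponent to stay measurable by rule.\<close>
  define w where "w = (\<lambda>y. \<phi> y powr t * h y powr (- t))"
  have w [measurable]: "w \<in> borel_measurable M" unfolding w_def by measurable
  have pt: "ennreal ((LINT y|M. \<phi> y * K x y) powr t) \<le>
      (\<integral>\<^sup>+y. ennreal (A powr (t - 1) * h x powr t * (K x y * w y)) \<partial>M)" if x: "x \<in> space M" for x
  proof -
    have Hpos: "0 < A * h x powr s" using AB h_pos[OF x] by simp
    have "ennreal ((LINT y|M. (\<phi> y / h y * K x y powr (1 / t)) * (h y * K x y powr (1 / s))) powr t) \<le>
       ennreal ((A * h x powr s) powr (t - 1)) * (\<integral>\<^sup>+y. ennreal ((\<phi> y / h y * K x y powr (1 / t)) powr t) \<partial>M)"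
    proof (rule holder_nn_integral[OF _ _ _ _ ts Hpos])
      have "(h y * K x y powr (1 / s)) powr s = K x y * h y powr s" if "y \<in> space M" for y
        using K_nonneg[OF x that] h_pos[OF that] s by (simp add: powr_mult powr_powr)
      then have "(\<integral>\<^sup>+y. ennreal ((h y * K x y powr (1 / s)) powr s) \<partial>M) = (\<integral>\<^sup>+y. ennreal (K x y * h y powr s) \<partial>M)"
        by (intro nn_integral_cong) simp
      then show "(\<integral>\<^sup>+y. ennreal ((h y * K x y powr (1 / s)) powr s) \<partial>M) \<le> ennreal (A * h x powr s)"
        using row[OF x] by (simp only:)
    qed (use x h_pos \<phi>_nonneg in \<open>auto simp: less_imp_le intro!: mult_nonneg_nonneg divide_nonneg_nonneg\<close>)
    also have "(LINT y|M. (\<phi> y / h y * K x y powr (1 / t)) * (h y * K x y powr (1 / s))) = (LINT y|M. \<phi> y * K x y)"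
    proof (rule Bochner_Integration.integral_cong)
      fix y assume y: "y \<in> space M"
      have "K x y powr (1 / t) * K x y powr (1 / s) = K x y"
        using K_nonneg[OF x y] by (simp only: powr_add[symmetric] s) simp
      then show "(\<phi> y / h y * K x y powr (1 / t)) * (h y * K x y powr (1 / s)) = \<phi> y * K x y"
        using h_pos[OF y] by (simp add: mult_ac)
    qed simp
    \<comment> \<open>Here conjugacy enters as \<open>s * (t - 1) = t\<close>: the row bound returns
      the power \<open>t\<close> of \<open>h\<close> that the column condition expects.\<close>
    also have "(A * h x powr s) powr (t - 1) = A powr (t - 1) * h x powr t"
      using AB h_pos[OF x] s by (simp add: powr_mult powr_powr)
    also have "(\<integral>\<^sup>+y. ennreal ((\<phi> y / h y * K x y powr (1 / t)) powr t) \<partial>M) = (\<integral>\<^sup>+y. ennreal (K x y * w y) \<partial>M)"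
    proof (rule nn_integral_cong)
      fix y assume y: "y \<in> space M"
      show "ennreal ((\<phi> y / h y * K x y powr (1 / t)) powr t) = ennreal (K x y * w y)"
        using K_nonneg[OF x y] h_pos[OF y] \<phi>_nonneg[OF y] ts
        by (simp add: w_def powr_mult powr_divide powr_powr powr_minus_divide)
    qed
    also have "ennreal (A powr (t - 1) * h x powr t) * (\<integral>\<^sup>+y. ennreal (K x y * w y) \<partial>M) =
        (\<integral>\<^sup>+y. ennreal (A powr (t - 1) * h x powr t) * ennreal (K x y * w y) \<partial>M)"
      using x by (intro nn_integral_cmult[symmetric]) measurable
    also have "\<dots> = (\<integral>\<^sup>+y. ennreal (A powr (t - 1) * h x powr t * (K x y * w y)) \<partial>M)"
      by (intro nn_integral_cong ennreal_mult'[symmetric]) auto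
    finally show ?thesis .
  qed
  have "(\<integral>\<^sup>+x. ennreal ((LINT y|M. \<phi> y * K x y) powr t) \<partial>M) \<le>
      (\<integral>\<^sup>+x. (\<integral>\<^sup>+y. ennreal (A powr (t - 1) * h x powr t * (K x y * w y)) \<partial>M) \<partial>M)"
    by (intro nn_integral_mono pt)
  also have "\<dots> = (\<integral>\<^sup>+y. (\<integral>\<^sup>+x. ennreal (A powr (t - 1) * h x powr t * (K x y * w y)) \<partial>M) \<partial>M)"
    by (rule Fubini'[symmetric]) measurable
  also have "\<dots> \<le> (\<integral>\<^sup>+y. ennreal (A powr (t - 1) * B) * ennreal (\<phi> y powr t) \<partial>M)"
  proof (rule nn_integral_mono)
    fix y assume y: "y \<in> space M"
    have w0: "0 \<le> w y" by (simp add: w_def)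
    have "(\<integral>\<^sup>+x. ennreal (A powr (t - 1) * h x powr t * (K x y * w y)) \<partial>M) =
        (\<integral>\<^sup>+x. ennreal (A powr (t - 1) * w y) * ennreal (K x y * h x powr t) \<partial>M)"
      using w0 by (intro nn_integral_cong) (simp add: ennreal_mult'[symmetric] mult_ac)
    also have "\<dots> = ennreal (A powr (t - 1) * w y) * (\<integral>\<^sup>+x. ennreal (K x y * h x powr t) \<partial>M)"
      using y by (intro nn_integral_cmult) measurable
    also have "\<dots> \<le> ennreal (A powr (t - 1) * w y) * ennreal (B * h y powr t)"
      by (intro mult_left_mono col y) simp
    also have "\<dots> = ennreal (A powr (t - 1) * w y * (B * h y powr t))"
      using w0 AB by (intro ennreal_mult[symmetric]) auto
    also have "A powr (t - 1) * w y * (B * h y powr t) = A powr (t - 1) * B * \<phi> y powr t"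
      using h_pos[OF y] by (simp add: w_def powr_minus_divide)
    also have "ennreal \<dots> = ennreal (A powr (t - 1) * B) * ennreal (\<phi> y powr t)"
      using AB by (intro ennreal_mult) auto
    finally show "(\<integral>\<^sup>+x. ennreal (A powr (t - 1) * h x powr t * (K x y * w y)) \<partial>M)
      \<le> ennreal (A powr (t - 1) * B) * ennreal (\<phi> y powr t)" .
  qed
  also have "\<dots> = ennreal (A powr (t - 1) * B) * (\<integral>\<^sup>+y. ennreal (\<phi> y powr t) \<partial>M)"
    by (rule nn_integral_cmult) measurable
  finally show ?thesis .
qed

section \<open>Kernel integrals against negative powers of the tail\<close>

context doubling_weight
begin

text \<open>The common form of the one-dimensional integrals in rows and columns. Points below
  \<open>r\<close> have tail at least \<open>F r\<close> and points above have tail at most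
  \<open>F r\<close>, so the split by position is majorised by the split by level. The constant is
  fixed before \<open>r\<close>, \<open>\<alpha>\<close> and \<open>\<beta>\<close>, which are
  allowed to depend on each other.\<close>

lemma nn_integral_tail_split:
  assumes b: "0 \<le> b" "b < 1" and d: "0 < d"
  shows "\<exists>K>0. \<forall>f r \<alpha> \<beta>. 0 \<le> r \<and> r < 1 \<and> 0 \<le> \<alpha> \<and> 0 \<le> \<beta> \<and>
      (\<forall>s. 0 \<le> s \<and> s < r \<longrightarrow> f s \<le> ennreal (\<alpha> * F s powr (- (1 + d)))) \<and>
      (\<forall>s. r \<le> s \<and> s < 1 \<longrightarrow> f s \<le> ennreal (\<beta> * F s powr (- b))) \<longrightarrow>
    (\<integral>\<^sup>+s. f s \<partial>\<mu>) \<le> ennreal (K * (\<alpha> * F r powr (- d) + \<beta> * F r powr (1 - b)))"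
proof -
  obtain H where H: "H > 0" "\<And>R. R > 0 \<Longrightarrow>
      (\<integral>\<^sup>+s. ennreal (F s powr (- (1 + d))) * indicator {s. R \<le> F s} s \<partial>\<mu>) \<le> ennreal (H * R powr (- d))"
    using \<mu>.nn_integral_tail_high[OF d] by auto
  obtain L where L: "L > 0" "\<And>R. R > 0 \<Longrightarrow>
      (\<integral>\<^sup>+s. ennreal (F s powr (- b)) * indicator {s. F s \<le> R} s \<partial>\<mu>) \<le> ennreal (L * R powr (1 - b))"
    using \<mu>.nn_integral_tail_low[OF b] by auto
  have "(\<integral>\<^sup>+s. f s \<partial>\<mu>) \<le> ennreal ((H + L) * (\<alpha> * F r powr (- d) + \<beta> * F r powr (1 - b)))"
    if r: "0 \<le> r" "r < 1" and \<alpha>\<beta>: "0 \<le> \<alpha>" "0 \<le> \<beta>"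
      and low: "\<And>s. 0 \<le> s \<Longrightarrow> s < r \<Longrightarrow> f s \<le> ennreal (\<alpha> * F s powr (- (1 + d)))"
      and high: "\<And>s. r \<le> s \<Longrightarrow> s < 1 \<Longrightarrow> f s \<le> ennreal (\<beta> * F s powr (- b))"
    for f r \<alpha> \<beta>
  proof -
    have Fr: "0 < F r" by (rule tail_pos[OF r])
    have m1 [measurable]: "(\<lambda>s. ennreal (F s powr (- (1 + d))) * indicator {s. F r \<le> F s} s) \<in> borel_measurable \<mu>"
      using borel_measurable_le[OF borel_measurable_const \<mu>.tail_measurable, of "F r"] by measurable
    have m2 [measurable]: "(\<lambda>s. ennreal (F s powr (- b)) * indicator {s. F s \<le> F r} s) \<in> borel_measurable \<mu>"
      using borel_measurable_le[OF \<mu>.tail_measurable borel_measurable_const, of "F r"] by measurable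
    have "(\<integral>\<^sup>+s. f s \<partial>\<mu>) \<le> (\<integral>\<^sup>+s. ennreal \<alpha> * (ennreal (F s powr (- (1 + d))) * indicator {s. F r \<le> F s} s)
        + ennreal \<beta> * (ennreal (F s powr (- b)) * indicator {s. F s \<le> F r} s) \<partial>\<mu>)"
    proof (rule nn_integral_mono_AE, rule eventually_mono[OF AE_\<mu>])
      fix s :: real assume s: "0 \<le> s \<and> s < 1"
      show "f s \<le> ennreal \<alpha> * (ennreal (F s powr (- (1 + d))) * indicator {s. F r \<le> F s} s)
        + ennreal \<beta> * (ennreal (F s powr (- b)) * indicator {s. F s \<le> F r} s)"
      proof (cases "s < r")
        case True
        then have "f s \<le> ennreal \<alpha> * (ennreal (F s powr (- (1 + d))) * indicator {s. F r \<le> F s} s)"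
          using low[of s] s \<alpha>\<beta> \<mu>.tail_antimono[of s r] by (simp add: ennreal_mult)
        then show ?thesis by (rule order_trans) simp
      next
        case False
        then have "f s \<le> ennreal \<beta> * (ennreal (F s powr (- b)) * indicator {s. F s \<le> F r} s)"
          using high[of s] s \<alpha>\<beta> \<mu>.tail_antimono[of r s] by (simp add: ennreal_mult)
        then show ?thesis by (rule order_trans) simp
      qed
    qed
    also have "\<dots> = ennreal \<alpha> * (\<integral>\<^sup>+s. ennreal (F s powr (- (1 + d))) * indicator {s. F r \<le> F s} s \<partial>\<mu>)
        + ennreal \<beta> * (\<integral>\<^sup>+s. ennreal (F s powr (- b)) * indicator {s. F s \<le> F r} s \<partial>\<mu>)"
      using m1 m2 by (simp only: nn_integral_add nn_integral_cmult borel_measurable_times_ennreal borel_measurable_const)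
    also have "\<dots> \<le> ennreal \<alpha> * ennreal (H * F r powr (- d)) + ennreal \<beta> * ennreal (L * F r powr (1 - b))"
      using H(2)[OF Fr] L(2)[OF Fr] by (intro add_mono mult_left_mono) auto
    also have "\<dots> = ennreal (\<alpha> * (H * F r powr (- d)) + \<beta> * (L * F r powr (1 - b)))"
      using \<alpha>\<beta> H(1) L(1) by (simp add: ennreal_mult ennreal_plus)
    also have "\<dots> \<le> ennreal ((H + L) * (\<alpha> * F r powr (- d) + \<beta> * F r powr (1 - b)))"
    proof (rule ennreal_leI)
      have "0 \<le> L * (\<alpha> * F r powr (- d))" "0 \<le> H * (\<beta> * F r powr (1 - b))" using \<alpha>\<beta> H(1) L(1) by auto
      then show "\<alpha> * (H * F r powr (- d)) + \<beta> * (L * F r powr (1 - b)) \<le> (H + L) * (\<alpha> * F r powr (- d) + \<beta> * F r powr (1 - b))"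
        by (simp add: algebra_simps)
    qed
    finally show ?thesis .
  qed
  then show ?thesis using H(1) L(1) by (intro exI[of _ "H + L"]) auto
qed

text \<open>The normalisation contributes at most \<open>(1 - r) * F r / c\<close>. In the kernel
  mean at \<open>r * s\<close>, \<open>1 - r * s\<close> is at least \<open>1 - r\<close> and the
  tail is at least both \<open>F r\<close> and \<open>F s\<close>. Using \<open>F s\<close> below
  \<open>r\<close> gives the exponent \<open>2 + b\<close>, and using \<open>F r\<close> above gives
  \<open>b\<close>; both parts are of order \<open>F r powr (- (1 + b)) / (1 - r)\<close> before
  normalisation, which leaves \<open>F r powr (- b)\<close>.\<close>

lemma schur_row:
  assumes b: "0 < b" "b < 1"
  shows "\<exists>A>0. \<forall>z\<in>\<bbbD>. (\<integral>\<^sup>+\<zeta>. ennreal (berezin_kernel \<omega> z \<zeta> * F (cmod \<zeta>) powr (- b)) \<partial>N)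
    \<le> ennreal (A * F (cmod z) powr (- b))"
proof -
  obtain c where c: "c > 0" "\<And>r. 0 \<le> r \<and> r < 1 \<Longrightarrow> c / ((1 - r) * F r) \<le> kernel_real (r\<^sup>2)"
    using kernel_real_lower by blast
  obtain K where K: "K > 0" "\<And>x. 0 \<le> x \<and> x < 1 \<Longrightarrow> kernel_mean x \<le> K / ((1 - x) * (F x)\<^sup>2)"
    using kernel_mean_upper by blast
  obtain H where H: "H > 0" "\<And>f r \<alpha> \<beta>. 0 \<le> r \<and> r < 1 \<and> 0 \<le> \<alpha> \<and> 0 \<le> \<beta> \<and>
      (\<forall>s. 0 \<le> s \<and> s < r \<longrightarrow> f s \<le> ennreal (\<alpha> * F s powr (- (1 + (1 + b))))) \<and>
      (\<forall>s. r \<le> s \<and> s < 1 \<longrightarrow> f s \<le> ennreal (\<beta> * F s powr (- b))) \<Longrightarrow>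
    (\<integral>\<^sup>+s. f s \<partial>\<mu>) \<le> ennreal (H * (\<alpha> * F r powr (- (1 + b)) + \<beta> * F r powr (1 - b)))"
    using nn_integral_tail_split[of b "1 + b"] b by (auto simp del: minus_add_distrib)
  have "(\<integral>\<^sup>+\<zeta>. ennreal (berezin_kernel \<omega> z \<zeta> * F (cmod \<zeta>) powr (- b)) \<partial>N)
    \<le> ennreal (4 * K * H / c * F (cmod z) powr (- b))" if z: "z \<in> \<bbbD>" for z
  proof -
    define r where "r = cmod z"
    have r: "0 \<le> r" "r < 1" using z by (auto simp: r_def)
    have Fr: "0 < F r" by (rule tail_pos[OF r])
    define k where "k = kernel_real (r\<^sup>2)"
    have k: "0 < k" "c / ((1 - r) * F r) \<le> k" using kernel_real_sq_pos[OF z] c(2)[of r] r by (auto simp: k_def r_def)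
    have rs: "0 \<le> r * s" "r * s < 1" "r * s \<le> s" "r * s \<le> r" if "0 \<le> s" "s < 1" for s
      using r that mult_strict_mono'[of r 1 s 1] by (auto simp: mult_left_le mult_left_le_one_le)
    \<comment> \<open>\<open>G\<close> will be \<open>F s\<close> below \<open>r\<close> and
      \<open>F r\<close> above.\<close>
    have bound: "2 * s * kernel_mean (r * s) * F s powr (- b) \<le> 2 * K / ((1 - r) * G\<^sup>2) * F s powr (- b)"
      if s: "0 \<le> s" "s < 1" and G: "0 < G" "G \<le> F (r * s)" for s G
    proof (rule mult_right_mono)
      have "kernel_mean (r * s) \<le> K / ((1 - r * s) * (F (r * s))\<^sup>2)" using K rs[OF s] by auto
      also have "\<dots> \<le> K / ((1 - r) * G\<^sup>2)"
        using rs[OF s] r G K(1) by (intro divide_left_mono mult_mono power_mono mult_pos_pos) auto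
      finally have "2 * s * kernel_mean (r * s) \<le> 2 * s * (K / ((1 - r) * G\<^sup>2))"
        using s by (intro mult_left_mono) auto
      also have "\<dots> \<le> 2 * 1 * (K / ((1 - r) * G\<^sup>2))"
        using s K(1) r by (intro mult_right_mono mult_left_mono) auto
      finally show "2 * s * kernel_mean (r * s) \<le> 2 * K / ((1 - r) * G\<^sup>2)" by simp
    qed simp
    have "(\<integral>\<^sup>+\<zeta>. ennreal (berezin_kernel \<omega> z \<zeta> * F (cmod \<zeta>) powr (- b)) \<partial>N) =
      (\<integral>\<^sup>+\<zeta>. ennreal ((cmod (kernel_fun (cnj z * \<zeta>)))\<^sup>2) * ennreal (1 / k * F (cmod \<zeta>) powr (- b)) \<partial>N)"
      using k(1) unfolding berezin_kernel_eq[OF z] k_def[unfolded r_def, symmetric]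
      by (intro nn_integral_cong) (simp add: ennreal_mult'[symmetric])
    also have "\<dots> = (\<integral>\<^sup>+s. ennreal (2 * s) * (ennreal (kernel_mean (r * s)) * ennreal (1 / k * F s powr (- b))) \<partial>\<mu>)"
      unfolding r_def by (rule nn_integral_kernel_radial[OF _ z]) measurable
    also have "\<dots> \<le> ennreal (H * (1 / k * (2 * K / (1 - r)) * F r powr (- (1 + b)) + 1 / k * (2 * K / ((1 - r) * (F r)\<^sup>2)) * F r powr (1 - b)))"
    proof (rule H(2), intro conjI allI impI)
      fix s :: real assume s: "0 \<le> s \<and> s < r"
      have Fs: "0 < F s" "F s \<le> F (r * s)" using s r rs[of s] by (auto intro: tail_pos \<mu>.tail_antimono)
      have "ennreal (2 * s) * (ennreal (kernel_mean (r * s)) * ennreal (1 / k * F s powr (- b)))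
         = ennreal (1 / k * (2 * s * kernel_mean (r * s) * F s powr (- b)))"
        using s k by (simp add: ennreal_mult'[symmetric] ennreal_mult''[symmetric] mult_ac)
      also have "\<dots> \<le> ennreal (1 / k * (2 * K / ((1 - r) * (F s)\<^sup>2) * F s powr (- b)))"
        using s r k Fs by (intro ennreal_leI mult_left_mono bound) auto
      also have "2 * K / ((1 - r) * (F s)\<^sup>2) * F s powr (- b) = 2 * K / (1 - r) * F s powr (- (1 + (1 + b)))"
      proof -
        have "- (1 + (1 + b)) = - b - 2" by simp
        then have "F s powr (- (1 + (1 + b))) = F s powr (- b) / (F s)\<^sup>2" using Fs by (simp only: powr_diff) simp
        then show ?thesis by simp
      qed
      finally show "ennreal (2 * s) * (ennreal (kernel_mean (r * s)) * ennreal (1 / k * F s powr (- b)))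
         \<le> ennreal (1 / k * (2 * K / (1 - r)) * F s powr (- (1 + (1 + b))))"
        by (simp only: mult.assoc)
    next
      fix s :: real assume s: "r \<le> s \<and> s < 1"
      have Fs: "F r \<le> F (r * s)" using s r rs[of s] by (auto intro: \<mu>.tail_antimono)
      have "ennreal (2 * s) * (ennreal (kernel_mean (r * s)) * ennreal (1 / k * F s powr (- b)))
         = ennreal (1 / k * (2 * s * kernel_mean (r * s) * F s powr (- b)))"
        using s r k by (simp add: ennreal_mult'[symmetric] ennreal_mult''[symmetric] mult_ac)
      also have "\<dots> \<le> ennreal (1 / k * (2 * K / ((1 - r) * (F r)\<^sup>2) * F s powr (- b)))"
        using s r k Fs Fr by (intro ennreal_leI mult_left_mono bound) auto
      finally show "ennreal (2 * s) * (ennreal (kernel_mean (r * s)) * ennreal (1 / k * F s powr (- b)))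
         \<le> ennreal (1 / k * (2 * K / ((1 - r) * (F r)\<^sup>2)) * F s powr (- b))"
        by (simp only: mult.assoc)
    qed (use r k K(1) in auto)
    also have "\<dots> \<le> ennreal (4 * K * H / c * F r powr (- b))"
    proof (rule ennreal_leI)
      have 1: "F r powr (- (1 + b)) = F r powr (- b) / F r"
      proof -
        have "- (1 + b) = - b - 1" by simp
        then show ?thesis using Fr by (simp only: powr_diff) simp
      qed
      have 2: "F r powr (1 - b) = F r powr (- b) * F r"
      proof -
        have "1 - b = - b + 1" by simp
        then show ?thesis using Fr by (simp only: powr_add) simp
      qed
      have "H * (1 / k * (2 * K / (1 - r)) * F r powr (- (1 + b)) + 1 / k * (2 * K / ((1 - r) * (F r)\<^sup>2)) * F r powr (1 - b))
         = 4 * K * H * F r powr (- b) * (1 / (k * ((1 - r) * F r)))"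
      proof -
        have "H * (1 / k * (2 * K / v) * (P / G) + 1 / k * (2 * K / (v * G\<^sup>2)) * (P * G)) = 4 * K * H * P * (1 / (k * (v * G)))"
          if "v \<noteq> 0" "G \<noteq> 0" for v P G :: real
          using that k(1) by (simp add: field_simps power2_eq_square)
        then show ?thesis unfolding 1 2 using Fr r by simp
      qed
      also have "\<dots> \<le> 4 * K * H * F r powr (- b) * (1 / c)"
        using k Fr r c(1) K(1) H(1) by (intro mult_left_mono frac_le) (auto simp: field_simps)
      finally show "H * (1 / k * (2 * K / (1 - r)) * F r powr (- (1 + b)) + 1 / k * (2 * K / ((1 - r) * (F r)\<^sup>2)) * F r powr (1 - b))
         \<le> 4 * K * H / c * F r powr (- b)" by simp
    qed
    finally show ?thesis by (simp only: r_def)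
  qed
  then show ?thesis using c K H by (intro exI[of _ "4 * K * H / c"]) auto
qed

text \<open>Now the normalisation depends on the integration variable and gives a factor
  \<open>(1 - s) * F s\<close>. It cancels the singular \<open>1 - s\<close>, since
  \<open>1 - r * s\<close> is at least \<open>1 - s\<close>, and leaves
  \<open>F s powr (- (1 + e))\<close> below \<open>r\<close>. For \<open>e = 0\<close> this would be
  just outside the range of \<open>nn_integral_tail_high\<close>, which is why the test function is
  a genuine negative power. Above \<open>r\<close> the bound \<open>F s \<le> F r\<close> leaves
  \<open>1 / F r\<close> times \<open>F s powr (- e)\<close>.\<close>

lemma schur_column:
  assumes e: "0 < e" "e < 1"
  shows "\<exists>B>0. \<forall>\<zeta>\<in>\<bbbD>. (\<integral>\<^sup>+z. ennreal (berezin_kernel \<omega> z \<zeta> * F (cmod z) powr (- e)) \<partial>N)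
    \<le> ennreal (B * F (cmod \<zeta>) powr (- e))"
proof -
  obtain c where c: "c > 0" "\<And>r. 0 \<le> r \<and> r < 1 \<Longrightarrow> c / ((1 - r) * F r) \<le> kernel_real (r\<^sup>2)"
    using kernel_real_lower by blast
  obtain K where K: "K > 0" "\<And>x. 0 \<le> x \<and> x < 1 \<Longrightarrow> kernel_mean x \<le> K / ((1 - x) * (F x)\<^sup>2)"
    using kernel_mean_upper by blast
  obtain H where H: "H > 0" "\<And>f r \<alpha> \<beta>. 0 \<le> r \<and> r < 1 \<and> 0 \<le> \<alpha> \<and> 0 \<le> \<beta> \<and>
      (\<forall>s. 0 \<le> s \<and> s < r \<longrightarrow> f s \<le> ennreal (\<alpha> * F s powr (- (1 + e)))) \<and>
      (\<forall>s. r \<le> s \<and> s < 1 \<longrightarrow> f s \<le> ennreal (\<beta> * F s powr (- e))) \<Longrightarrow>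
    (\<integral>\<^sup>+s. f s \<partial>\<mu>) \<le> ennreal (H * (\<alpha> * F r powr (- e) + \<beta> * F r powr (1 - e)))"
    using nn_integral_tail_split[of e e] e by (auto simp del: minus_add_distrib)
  have "(\<integral>\<^sup>+z. ennreal (berezin_kernel \<omega> z \<zeta> * F (cmod z) powr (- e)) \<partial>N)
    \<le> ennreal (4 * K * H / c * F (cmod \<zeta>) powr (- e))" if \<zeta>: "\<zeta> \<in> \<bbbD>" for \<zeta>
  proof -
    define r where "r = cmod \<zeta>"
    have r: "0 \<le> r" "r < 1" using \<zeta> by (auto simp: r_def)
    have Fr: "0 < F r" by (rule tail_pos[OF r])
    have rs: "0 \<le> r * s" "r * s < 1" "r * s \<le> s" "r * s \<le> r" if "0 \<le> s" "s < 1" for s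
      using r that mult_strict_mono'[of r 1 s 1] by (auto simp: mult_left_le mult_left_le_one_le)
    have bound: "2 * s * kernel_mean (r * s) * ((1 - s) * F s) \<le> 2 * K * F s / G\<^sup>2"
      if s: "0 \<le> s" "s < 1" and G: "0 < G" "G \<le> F (r * s)" for s G
    proof -
      have "kernel_mean (r * s) \<le> K / ((1 - r * s) * (F (r * s))\<^sup>2)" using K rs[OF s] by auto
      also have "\<dots> \<le> K / ((1 - s) * G\<^sup>2)"
        using rs[OF s] s G K(1) by (intro divide_left_mono mult_mono power_mono mult_pos_pos) auto
      finally have "2 * s * kernel_mean (r * s) \<le> 2 * s * (K / ((1 - s) * G\<^sup>2))"
        using s by (intro mult_left_mono) auto
      also have "\<dots> \<le> 2 * 1 * (K / ((1 - s) * G\<^sup>2))"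
        using s K(1) by (intro mult_right_mono mult_left_mono) auto
      finally have "2 * s * kernel_mean (r * s) * ((1 - s) * F s) \<le> 2 * 1 * (K / ((1 - s) * G\<^sup>2)) * ((1 - s) * F s)"
        using s by (intro mult_right_mono) auto
      then show ?thesis using s by simp
    qed
    have pt: "berezin_kernel \<omega> z \<zeta> * F (cmod z) powr (- e) \<le>
        (cmod (kernel_fun (cnj \<zeta> * z)))\<^sup>2 * ((1 - cmod z) * F (cmod z) / c * F (cmod z) powr (- e))" if z: "z \<in> \<bbbD>" for z
    proof -
      have Fz: "0 < F (cmod z)" using z by (intro tail_pos) auto
      have "1 / kernel_real ((cmod z)\<^sup>2) \<le> 1 / (c / ((1 - cmod z) * F (cmod z)))"
        using c Fz z by (intro frac_le) auto
      then have k: "1 / kernel_real ((cmod z)\<^sup>2) \<le> (1 - cmod z) * F (cmod z) / c" by simp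
      have "cmod (kernel_fun (cnj z * \<zeta>)) = cmod (kernel_fun (cnj \<zeta> * z))"
        using kernel_fun_cnj[OF cnj_mult_in_disc[OF z \<zeta>]] by (simp add: mult.commute)
      then have "berezin_kernel \<omega> z \<zeta> = (cmod (kernel_fun (cnj \<zeta> * z)))\<^sup>2 * (1 / kernel_real ((cmod z)\<^sup>2))"
        unfolding berezin_kernel_eq[OF z] by simp
      also have "\<dots> \<le> (cmod (kernel_fun (cnj \<zeta> * z)))\<^sup>2 * ((1 - cmod z) * F (cmod z) / c)"
        by (intro mult_left_mono k) simp
      finally show ?thesis by (simp only: mult.assoc[symmetric]) (intro mult_right_mono, auto)
    qed
    have "(\<integral>\<^sup>+z. ennreal (berezin_kernel \<omega> z \<zeta> * F (cmod z) powr (- e)) \<partial>N) \<le>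
      (\<integral>\<^sup>+z. ennreal ((cmod (kernel_fun (cnj \<zeta> * z)))\<^sup>2) * ennreal ((1 - cmod z) * F (cmod z) / c * F (cmod z) powr (- e)) \<partial>N)"
      using pt by (intro nn_integral_mono) (auto simp: ennreal_mult'[symmetric] intro!: ennreal_leI)
    also have "\<dots> = (\<integral>\<^sup>+s. ennreal (2 * s) * (ennreal (kernel_mean (r * s)) * ennreal ((1 - s) * F s / c * F s powr (- e))) \<partial>\<mu>)"
      unfolding r_def by (rule nn_integral_kernel_radial[OF _ \<zeta>]) measurable
    also have "\<dots> \<le> ennreal (H * (2 * K / c * F r powr (- e) + 2 * K / c / F r * F r powr (1 - e)))"
    proof (rule H(2), intro conjI allI impI)
      fix s :: real assume s: "0 \<le> s \<and> s < r"
      have Fs: "0 < F s" "F s \<le> F (r * s)" using s r rs[of s] by (auto intro: tail_pos \<mu>.tail_antimono)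
      have "ennreal (2 * s) * (ennreal (kernel_mean (r * s)) * ennreal ((1 - s) * F s / c * F s powr (- e)))
         = ennreal (2 * s * kernel_mean (r * s) * ((1 - s) * F s) * (1 / c * F s powr (- e)))"
        using s r c(1) by (simp add: ennreal_mult'[symmetric] ennreal_mult''[symmetric] mult_ac)
      also have "\<dots> \<le> ennreal (2 * K * F s / (F s)\<^sup>2 * (1 / c * F s powr (- e)))"
        using s r c(1) Fs by (intro ennreal_leI mult_right_mono bound) auto
      also have "2 * K * F s / (F s)\<^sup>2 * (1 / c * F s powr (- e)) = 2 * K / c * F s powr (- (1 + e))"
      proof -
        have "- (1 + e) = - e - 1" by simp
        then have "F s powr (- (1 + e)) = F s powr (- e) / F s" using Fs by (simp only: powr_diff) simp
        then show ?thesis using Fs by (simp add: power2_eq_square)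
      qed
      finally show "ennreal (2 * s) * (ennreal (kernel_mean (r * s)) * ennreal ((1 - s) * F s / c * F s powr (- e)))
         \<le> ennreal (2 * K / c * F s powr (- (1 + e)))" .
    next
      fix s :: real assume s: "r \<le> s \<and> s < 1"
      have Fs: "F r \<le> F (r * s)" "F s \<le> F r" using s r rs[of s] by (auto intro: \<mu>.tail_antimono)
      have "ennreal (2 * s) * (ennreal (kernel_mean (r * s)) * ennreal ((1 - s) * F s / c * F s powr (- e)))
         = ennreal (2 * s * kernel_mean (r * s) * ((1 - s) * F s) * (1 / c * F s powr (- e)))"
        using s r c(1) by (simp add: ennreal_mult'[symmetric] ennreal_mult''[symmetric] mult_ac)
      also have "\<dots> \<le> ennreal (2 * K * F r / (F r)\<^sup>2 * (1 / c * F s powr (- e)))"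
      proof (intro ennreal_leI mult_right_mono)
        have "2 * s * kernel_mean (r * s) * ((1 - s) * F s) \<le> 2 * K * F s / (F r)\<^sup>2"
          using s r Fs Fr by (intro bound) auto
        also have "\<dots> \<le> 2 * K * F r / (F r)\<^sup>2"
          using Fs K(1) by (intro divide_right_mono mult_left_mono) auto
        finally show "2 * s * kernel_mean (r * s) * ((1 - s) * F s) \<le> 2 * K * F r / (F r)\<^sup>2" .
      qed (use c(1) in auto)
      also have "2 * K * F r / (F r)\<^sup>2 * (1 / c * F s powr (- e)) = 2 * K / c / F r * F s powr (- e)"
        using Fr by (simp add: power2_eq_square)
      finally show "ennreal (2 * s) * (ennreal (kernel_mean (r * s)) * ennreal ((1 - s) * F s / c * F s powr (- e)))
         \<le> ennreal (2 * K / c / F r * F s powr (- e))" .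
    qed (use r Fr c(1) K(1) in auto)
    also have "H * (2 * K / c * F r powr (- e) + 2 * K / c / F r * F r powr (1 - e)) = 4 * K * H / c * F r powr (- e)"
    proof -
      have "1 - e = - e + 1" by simp
      then have "F r powr (1 - e) = F r powr (- e) * F r" using Fr by (simp only: powr_add) simp
      then show ?thesis using Fr by (simp add: field_simps)
    qed
    finally show ?thesis by (simp only: r_def)
  qed
  then show ?thesis using c K H by (intro exI[of _ "4 * K * H / c"]) auto
qed

end

subsection \<open>Exceptional and dominating sets\<close>

context doubling_weight
begin

text \<open>Joint measurability is obtained from a formula that is Borel on all pairs of complex
  numbers, with the kernel extended by zero outside the disc, and that agrees with the Berezin
  kernel on the disc.\<close>

lemma berezin_kernel_measurable_pair:
  "(\<lambda>(z, \<zeta>). berezin_kernel \<omega> z \<zeta>) \<in> borel_measurable (N \<Otimes>\<^sub>M N)"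
proof -
  define \<kappa> where "\<kappa> = (\<lambda>x. indicator \<bbbD> x *\<^sub>R kernel_fun x)"
  have \<kappa> [measurable]: "\<kappa> \<in> borel_measurable borel"
    unfolding \<kappa>_def
    by (intro borel_measurable_continuous_on_indicator holomorphic_on_imp_continuous_on kernel_fun_holomorphic) auto
  define k where "k = (\<lambda>x. \<Sum>n. coef n * x ^ n)"
  have k [measurable]: "k \<in> borel_measurable borel" unfolding k_def by measurable
  have id: "(\<lambda>z. z) \<in> N \<rightarrow>\<^sub>M borel"
    using borel_measurable_dA[of "\<lambda>z. z"] by (subst measurable_cong_sets[OF sets_N refl]) simp
  have p: "(\<lambda>p. (fst p, snd p)) \<in> N \<Otimes>\<^sub>M N \<rightarrow>\<^sub>M (borel \<Otimes>\<^sub>M borel)"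
    by (intro measurable_Pair measurable_compose[OF measurable_fst id] measurable_compose[OF measurable_snd id])
  have [measurable]: "cnj \<in> borel_measurable borel"
    by (intro borel_measurable_continuous_onI continuous_intros)
  have m: "(\<lambda>p. (cmod (\<kappa> (cnj (fst p) * snd p)))\<^sup>2 / k ((cmod (fst p))\<^sup>2)) \<in> borel_measurable (borel \<Otimes>\<^sub>M borel)"
    by measurable
  have "(\<lambda>p. (cmod (\<kappa> (cnj (fst p) * snd p)))\<^sup>2 / k ((cmod (fst p))\<^sup>2)) \<in> borel_measurable (N \<Otimes>\<^sub>M N)"
    using measurable_compose[OF p m] by (simp only: fst_conv snd_conv)
  then show ?thesis
  proof (subst measurable_cong)
    fix p :: "complex \<times> complex" assume "p \<in> space (N \<Otimes>\<^sub>M N)"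
    then have "fst p \<in> \<bbbD>" "snd p \<in> \<bbbD>" by (auto simp: space_pair_measure)
    then show "(case p of (z, \<zeta>) \<Rightarrow> berezin_kernel \<omega> z \<zeta>) = (cmod (\<kappa> (cnj (fst p) * snd p)))\<^sup>2 / k ((cmod (fst p))\<^sup>2)"
      using cnj_mult_in_disc[of "fst p" "snd p"]
      by (simp add: split_beta berezin_kernel_eq \<kappa>_def k_def kernel_real_def)
  qed
qed

lemma berezin_transform_bounded:
  assumes t: "1 < t"
  shows "\<exists>C>0. \<forall>\<phi>. \<phi> \<in> borel_measurable N \<longrightarrow> (\<forall>\<zeta>\<in>\<bbbD>. 0 \<le> \<phi> \<zeta>) \<longrightarrow>
    (\<integral>\<^sup>+z. ennreal ((LINT \<zeta>|N. \<phi> \<zeta> * berezin_kernel \<omega> z \<zeta>) powr t) \<partial>N) \<le> ennreal (C powr t) * (\<integral>\<^sup>+\<zeta>. ennreal (\<phi> \<zeta> powr t) \<partial>N)"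
proof -
  define s where "s = t / (t - 1)"
  have s: "1 < s" unfolding s_def using t by (simp add: less_divide_eq)
  \<comment> \<open>With this choice \<open>a * s = 1 / (2 * t)\<close> and
    \<open>a * t = 1 / (2 * s)\<close>, so both exponents lie strictly between 0 and 1, as rows and
    columns demand. It depends on \<open>t\<close> alone.\<close>
  define a where "a = 1 / (2 * t * s)"
  have as: "0 < a * s" "a * s < 1" and at: "0 < a * t" "a * t < 1"
    using t s by (auto simp: a_def field_simps)
  obtain A where A: "A > 0" "\<And>z. z \<in> \<bbbD> \<Longrightarrow> (\<integral>\<^sup>+\<zeta>. ennreal (berezin_kernel \<omega> z \<zeta> * F (cmod \<zeta>) powr (- (a * s))) \<partial>N)
    \<le> ennreal (A * F (cmod z) powr (- (a * s)))"
    using schur_row[OF as] by blast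
  obtain B where B: "B > 0" "\<And>\<zeta>. \<zeta> \<in> \<bbbD> \<Longrightarrow> (\<integral>\<^sup>+z. ennreal (berezin_kernel \<omega> z \<zeta> * F (cmod z) powr (- (a * t))) \<partial>N)
    \<le> ennreal (B * F (cmod \<zeta>) powr (- (a * t)))"
    using schur_column[OF at] by blast
  \<comment> \<open>The \<open>t\<close>-th root of the Schur constant, so that \<open>C\<close> can
    later be merged with \<open>\<epsilon>\<close> under one power.\<close>
  define C where "C = (A powr (t - 1) * B) powr (1 / t)"
  have C: "0 < C" "C powr t = A powr (t - 1) * B" using A(1) B(1) t by (auto simp: C_def powr_powr)
  have "(\<integral>\<^sup>+z. ennreal ((LINT \<zeta>|N. \<phi> \<zeta> * berezin_kernel \<omega> z \<zeta>) powr t) \<partial>N) \<le> ennreal (C powr t) * (\<integral>\<^sup>+\<zeta>. ennreal (\<phi> \<zeta> powr t) \<partial>N)"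
    if \<phi>: "\<phi> \<in> borel_measurable N" "\<forall>\<zeta>\<in>\<bbbD>. 0 \<le> \<phi> \<zeta>" for \<phi>
    unfolding C(2)
  proof (rule N.schur_test[where h = "\<lambda>z. F (cmod z) powr (- a)" and s = s])
    have "(\<lambda>z. F (cmod z) powr (- a)) \<in> borel_measurable borel" by measurable
    then show "(\<lambda>z. F (cmod z) powr (- a)) \<in> borel_measurable N"
      by (subst measurable_cong_sets[OF sets_N refl]) (rule borel_measurable_dA)
    show "0 < F (cmod z) powr (- a)" if "z \<in> space N" for z
      using that tail_pos[of "cmod z"] by simp
    show "(\<integral>\<^sup>+\<zeta>. ennreal (berezin_kernel \<omega> z \<zeta> * (F (cmod \<zeta>) powr (- a)) powr s) \<partial>N)
        \<le> ennreal (A * (F (cmod z) powr (- a)) powr s)" if "z \<in> space N" for z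
      using A(2)[of z] that by (simp add: powr_powr)
    show "(\<integral>\<^sup>+z. ennreal (berezin_kernel \<omega> z \<zeta> * (F (cmod z) powr (- a)) powr t) \<partial>N)
        \<le> ennreal (B * (F (cmod \<zeta>) powr (- a)) powr t)" if "\<zeta> \<in> space N" for \<zeta>
      using B(2)[of \<zeta>] that by (simp add: powr_powr)
  qed (use \<phi> t A(1) B(1) berezin_kernel_nonneg berezin_kernel_measurable_pair in \<open>auto simp: s_def\<close>)
  then show ?thesis using C(1) by blast
qed

text \<open>The measure is finite and \<open>x powr q \<le> 1 + x powr p\<close>. Thus functions in
  the space with exponent \<open>p\<close> have a Berezin transform of their \<open>q\<close>-th
  power that is a convergent integral.\<close>

lemma integrable_N_powr_le:
  assumes f: "f holomorphic_on \<bbbD>" and q: "0 < q" "q \<le> p" and int: "integrable N (\<lambda>\<zeta>. cmod (f \<zeta>) powr p)"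
  shows "integrable N (\<lambda>\<zeta>. cmod (f \<zeta>) powr q)"
proof (rule Bochner_Integration.integrable_bound[of N "\<lambda>\<zeta>. 1 + cmod (f \<zeta>) powr p"])
  show "integrable N (\<lambda>\<zeta>. 1 + cmod (f \<zeta>) powr p)" using int by simp
  show "(\<lambda>\<zeta>. cmod (f \<zeta>) powr q) \<in> borel_measurable N"
    using powr_norm_measurable[OF f q(1)] by (subst measurable_cong_sets[OF sets_N refl])
  have "x powr q \<le> 1 + x powr p" if "0 \<le> x" for x :: real
  proof (cases "x \<le> 1")
    case True
    then have "x powr q \<le> 1 powr q" using q that by (intro powr_mono2) auto
    then have "x powr q \<le> 1" by simp
    then show ?thesis using powr_ge_zero[of x p] by linarith
  next
    case False
    then show ?thesis using powr_mono[OF q(2), of x] by linarith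
  qed
  then show "AE \<zeta> in N. norm (cmod (f \<zeta>) powr q) \<le> norm (1 + cmod (f \<zeta>) powr p)"
    by (intro AE_I2) simp
qed

lemma bergman_space_iff:
  "0 < p \<Longrightarrow> f \<in> bergman_space p \<omega> \<longleftrightarrow> f holomorphic_on \<bbbD> \<and> integrable N (\<lambda>\<zeta>. cmod (f \<zeta>) powr p)"
  using integral_dA_N(2)[OF powr_norm_measurable] by (auto simp: bergman_space_def)

lemma bergman_norm_powr:
  assumes "f holomorphic_on \<bbbD>" "0 < p"
  shows "bergman_norm p \<omega> f powr p = (LINT \<zeta>|N. cmod (f \<zeta>) powr p)"
proof -
  have "0 \<le> (LINT \<zeta>|N. cmod (f \<zeta>) powr p)" by (intro integral_nonneg_AE AE_I2) simp
  then show ?thesis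
    unfolding bergman_norm_def using assms by (simp add: integral_dA_N(1)[OF powr_norm_measurable] powr_powr)
qed

lemma set_integral_dA_N:
  assumes "f holomorphic_on \<bbbD>" "0 < p" "G \<in> sets dA"
  shows "(LINT z:G|dA. cmod (f z) powr p * \<omega> z) = (LINT z|N. indicator G z * cmod (f z) powr p)"
proof -
  have "(LINT z:G|dA. cmod (f z) powr p * \<omega> z) = (LINT z|dA. (indicator G z * cmod (f z) powr p) * \<omega> z)"
    by (simp add: set_lebesgue_integral_def mult.assoc)
  also have "\<dots> = (LINT z|N. indicator G z * cmod (f z) powr p)"
    using assms by (intro integral_dA_N borel_measurable_times powr_norm_measurable) auto
  finally show ?thesis .
qed

lemma berezin_transform_measurable:
  assumes "\<phi> \<in> borel_measurable N"
  shows "(\<lambda>z. LINT \<zeta>|N. \<phi> \<zeta> * berezin_kernel \<omega> z \<zeta>) \<in> borel_measurable N"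
proof (rule N.borel_measurable_lebesgue_integral)
  have "(\<lambda>p. \<phi> (snd p) * (case p of (z, \<zeta>) \<Rightarrow> berezin_kernel \<omega> z \<zeta>)) \<in> borel_measurable (N \<Otimes>\<^sub>M N)"
    by (intro borel_measurable_times berezin_kernel_measurable_pair measurable_compose[OF measurable_snd assms])
  then show "(\<lambda>(z, \<zeta>). \<phi> \<zeta> * berezin_kernel \<omega> z \<zeta>) \<in> borel_measurable (N \<Otimes>\<^sub>M N)"
    by (simp only: split_beta')
qed

lemma exceptional_set_eq:
  assumes f: "f \<in> bergman_space p \<omega>" and pq: "0 < q" "q < p"
  shows "exceptional_set \<omega> \<epsilon> q f =
    {z\<in>\<bbbD>. cmod (f z) powr q \<le> \<epsilon> * (LINT \<zeta>|N. cmod (f \<zeta>) powr q * berezin_kernel \<omega> z \<zeta>)}"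
proof -
  have hol: "f holomorphic_on \<bbbD>" and intq: "integrable N (\<lambda>\<zeta>. cmod (f \<zeta>) powr q)"
    using f integrable_N_powr_le[of f q p] pq by (auto simp: bergman_space_iff)
  show ?thesis
    unfolding exceptional_set_def using berezin_integral(2)[OF hol pq(1) intq] by auto
qed

lemma exceptional_set_measurable:
  assumes f: "f \<in> bergman_space p \<omega>" and pq: "0 < q" "q < p"
  shows "exceptional_set \<omega> \<epsilon> q f \<in> sets dA"
proof -
  have hol: "f holomorphic_on \<bbbD>" using f by (simp add: bergman_space_def)
  have m: "(\<lambda>\<zeta>. cmod (f \<zeta>) powr q) \<in> borel_measurable N"
    using powr_norm_measurable[OF hol pq(1)] by (subst measurable_cong_sets[OF sets_N refl])
  have "{z\<in>space N. cmod (f z) powr q \<le> \<epsilon> * (LINT \<zeta>|N. cmod (f \<zeta>) powr q * berezin_kernel \<omega> z \<zeta>)} \<in> sets N"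
    by (intro borel_measurable_le m borel_measurable_times borel_measurable_const berezin_transform_measurable)
  then show ?thesis unfolding exceptional_set_eq[OF assms] by simp
qed

text \<open>The ratio \<open>t\<close> is fixed before \<open>p\<close> and \<open>q\<close>, so the
  constant depends on the ratio and the weight only. Measurability is part of the claim because the
  set integral would have no meaning without it.\<close>

lemma exceptional_set_bound:
  assumes t: "1 < t"
  shows "\<exists>C>0. \<forall>p q. 0 < q \<and> q < p \<and> p / q = t \<longrightarrow> (\<forall>f\<in>bergman_space p \<omega>. \<forall>\<epsilon>>0.
    exceptional_set \<omega> \<epsilon> q f \<in> sets dA \<and>
    (LINT z:exceptional_set \<omega> \<epsilon> q f|dA. cmod (f z) powr p * \<omega> z) \<le> (C * \<epsilon>) powr (p / q) * bergman_norm p \<omega> f powr p)"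
proof -
  obtain C where C: "C > 0" "\<And>\<phi>. \<phi> \<in> borel_measurable N \<Longrightarrow> (\<forall>\<zeta>\<in>\<bbbD>. 0 \<le> \<phi> \<zeta>) \<Longrightarrow>
    (\<integral>\<^sup>+z. ennreal ((LINT \<zeta>|N. \<phi> \<zeta> * berezin_kernel \<omega> z \<zeta>) powr t) \<partial>N) \<le> ennreal (C powr t) * (\<integral>\<^sup>+\<zeta>. ennreal (\<phi> \<zeta> powr t) \<partial>N)"
    using berezin_transform_bounded[OF t] by blast
  have "(LINT z:exceptional_set \<omega> \<epsilon> q f|dA. cmod (f z) powr p * \<omega> z) \<le> (C * \<epsilon>) powr (p / q) * bergman_norm p \<omega> f powr p"
    if pq: "0 < q" "q < p" "p / q = t" and f: "f \<in> bergman_space p \<omega>" and \<epsilon>: "\<epsilon> > 0" for p q f \<epsilon>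
  proof -
    define E where "E = exceptional_set \<omega> \<epsilon> q f"
    have E [measurable]: "E \<in> sets dA" unfolding E_def by (rule exceptional_set_measurable[OF f pq(1,2)])
    have p: "0 < p" and qt: "q * t = p" using pq by (auto simp: field_simps)
    have hol: "f holomorphic_on \<bbbD>" and intp: "integrable N (\<lambda>\<zeta>. cmod (f \<zeta>) powr p)"
      using f p by (auto simp: bergman_space_iff)
    define \<phi> where "\<phi> = (\<lambda>\<zeta>. cmod (f \<zeta>) powr q)"
    have \<phi>m: "\<phi> \<in> borel_measurable N"
      unfolding \<phi>_def using powr_norm_measurable[OF hol pq(1)] by (subst measurable_cong_sets[OF sets_N refl])
    define T where "T = (\<lambda>z. LINT \<zeta>|N. \<phi> \<zeta> * berezin_kernel \<omega> z \<zeta>)"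
    have Tm: "T \<in> borel_measurable N" unfolding T_def by (rule berezin_transform_measurable[OF \<phi>m])
    have fp: "cmod (f z) powr p = \<phi> z powr t" for z
      by (simp add: \<phi>_def powr_powr qt)
    have T0: "0 \<le> T z" if "z \<in> \<bbbD>" for z
      unfolding T_def \<phi>_def using berezin_kernel_nonneg[OF that] by (intro integral_nonneg_AE AE_I2) simp
    have m: "(\<lambda>z. indicator E z * cmod (f z) powr p) \<in> borel_measurable N"
      by (subst measurable_cong_sets[OF sets_N refl])
        (intro borel_measurable_times powr_norm_measurable[OF hol p] borel_measurable_indicator E)
    have "ennreal (LINT z|N. indicator E z * cmod (f z) powr p) = (\<integral>\<^sup>+z. ennreal (indicator E z * cmod (f z) powr p) \<partial>N)"
    proof (rule nn_integral_eq_integral[symmetric])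
      show "integrable N (\<lambda>z. indicator E z * cmod (f z) powr p)"
        by (rule Bochner_Integration.integrable_bound[OF intp m]) (auto split: split_indicator)
    qed simp
    also have "\<dots> \<le> (\<integral>\<^sup>+z. ennreal (\<epsilon> powr t) * ennreal (T z powr t) \<partial>N)"
    proof (rule nn_integral_mono)
      fix z assume "z \<in> space N"
      then have z: "z \<in> \<bbbD>" by simp
      show "ennreal (indicator E z * cmod (f z) powr p) \<le> ennreal (\<epsilon> powr t) * ennreal (T z powr t)"
      proof (cases "z \<in> E")
        case True
        then have "\<phi> z \<le> \<epsilon> * T z"
          unfolding E_def exceptional_set_eq[OF f pq(1,2)] by (simp add: \<phi>_def T_def)
        then have "\<phi> z powr t \<le> (\<epsilon> * T z) powr t"
          using t by (intro powr_mono2) (auto simp: \<phi>_def)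
        also have "\<dots> = \<epsilon> powr t * T z powr t" by (rule powr_mult)
        finally show ?thesis using True unfolding fp by (simp add: ennreal_mult[symmetric] ennreal_leI)
      qed simp
    qed
    also have "\<dots> = ennreal (\<epsilon> powr t) * (\<integral>\<^sup>+z. ennreal (T z powr t) \<partial>N)"
    proof (intro nn_integral_cmult)
      have "(\<lambda>x::real. ennreal (x powr t)) \<in> borel_measurable borel" by measurable
      then show "(\<lambda>z. ennreal (T z powr t)) \<in> borel_measurable N" by (rule measurable_compose[OF Tm])
    qed
    also have "\<dots> \<le> ennreal (\<epsilon> powr t) * (ennreal (C powr t) * (\<integral>\<^sup>+\<zeta>. ennreal (\<phi> \<zeta> powr t) \<partial>N))"
      unfolding T_def by (intro mult_left_mono C(2) \<phi>m) (auto simp: \<phi>_def)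
    also have "(\<integral>\<^sup>+\<zeta>. ennreal (\<phi> \<zeta> powr t) \<partial>N) = ennreal (LINT \<zeta>|N. cmod (f \<zeta>) powr p)"
      unfolding fp[symmetric] by (rule nn_integral_eq_integral[OF intp]) simp
    also have "ennreal (\<epsilon> powr t) * (ennreal (C powr t) * ennreal (LINT \<zeta>|N. cmod (f \<zeta>) powr p))
      = ennreal ((C * \<epsilon>) powr t * (LINT \<zeta>|N. cmod (f \<zeta>) powr p))"
      by (simp add: ennreal_mult'[symmetric] powr_mult mult_ac)
    finally have "(LINT z|N. indicator E z * cmod (f z) powr p) \<le> (C * \<epsilon>) powr t * (LINT \<zeta>|N. cmod (f \<zeta>) powr p)"
      by (subst (asm) ennreal_le_iff) (auto intro!: mult_nonneg_nonneg integral_nonneg_AE)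
    then show ?thesis
      unfolding E_def[symmetric] pq(3) set_integral_dA_N[OF hol p E] bergman_norm_powr[OF hol p] .
  qed
  then show ?thesis using C(1) exceptional_set_measurable by blast
qed

lemma complement_bound:
  assumes f: "f \<in> bergman_space p \<omega>" and p: "0 < p" and E: "E \<in> sets dA"
    and bound: "(LINT z:E|dA. cmod (f z) powr p * \<omega> z) \<le> 1 / 2 * bergman_norm p \<omega> f powr p"
  shows "1 / 2 * bergman_norm p \<omega> f powr p \<le> (LINT z:\<bbbD> - E|dA. cmod (f z) powr p * \<omega> z)"
proof -
  have hol: "f holomorphic_on \<bbbD>" and intp: "integrable N (\<lambda>\<zeta>. cmod (f \<zeta>) powr p)"
    using f p by (auto simp: bergman_space_iff)
  have D: "\<bbbD> \<in> sets dA" using sets.top[of dA] by simp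
  have part: "integrable N (\<lambda>z. indicator A z * cmod (f z) powr p)" if "A \<in> sets dA" for A
    using integrable_mult_indicator[OF _ intp, of A] that by simp
  have "(LINT z|N. indicator E z * cmod (f z) powr p) + (LINT z|N. indicator (\<bbbD> - E) z * cmod (f z) powr p)
      = (LINT z|N. indicator E z * cmod (f z) powr p + indicator (\<bbbD> - E) z * cmod (f z) powr p)"
    using E D by (intro Bochner_Integration.integral_add[symmetric] part) auto
  also have "\<dots> = (LINT z|N. cmod (f z) powr p)"
    by (intro Bochner_Integration.integral_cong) (auto split: split_indicator)
  finally show ?thesis
    using bound D E by (simp add: set_integral_dA_N[OF hol p] bergman_norm_powr[OF hol p] sets.Diff)
qed

end

text \<open>Positivity of \<open>weight_hat\<close> at 0 yields integrability of the radial profile,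
  since otherwise the Bochner integral would be 0. An integrable profile has a Borel representative,
  and the doubling constant is rounded up to a power of two.\<close>

lemma D_hat_doubling_weight:
  assumes "\<omega> \<in> D_hat"
  obtains u m where "doubling_weight \<omega> u m"
proof -
  have D: "is_weight \<omega>" "radial \<omega>" "\<And>z. z \<in> \<bbbD> \<Longrightarrow> 0 < weight_hat \<omega> z"
    using assms by (auto simp: D_hat_def)
  obtain C where C: "C \<ge> 1" "\<And>r. 0 \<le> r \<Longrightarrow> r < 1 \<Longrightarrow> weight_hat \<omega> (of_real r) \<le> C * weight_hat \<omega> (of_real ((1 + r) / 2))"
    using assms unfolding D_hat_def by blast
  define w where "w = (\<lambda>s. indicator {0..<1} s * \<omega> (of_real s))"
  have w_int: "integrable lebesgue w"
  proof (rule ccontr)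
    assume "\<not> integrable lebesgue w"
    then have "(LINT s|lebesgue. w s) = 0" by (rule not_integrable_integral_eq)
    then show False using D(3)[of 0] by (simp add: weight_hat_def set_lebesgue_integral_def w_def)
  qed
  have w0: "0 \<le> w s" for s using D(1) by (simp add: w_def is_weight_def indicator_def)
  obtain u0 where u0: "u0 \<in> borel_measurable lborel" "AE s in lborel. w s = u0 s"
    using completion_ex_borel_measurable_real[OF borel_measurable_integrable[OF w_int]] by blast
  \<comment> \<open>The absolute value makes the representative nonnegative everywhere and changes
    it only on a null set.\<close>
  define u where "u = (\<lambda>s. \<bar>u0 s\<bar>)"
  have u_AE: "AE s in lborel. w s = u s"
    using u0(2)
  proof eventually_elim
    fix s assume "w s = u0 s"
    then show "w s = u s" using w0[of s] by (simp add: u_def)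
  qed
  have u_meas: "u \<in> borel_measurable borel" using u0(1) by (simp add: u_def)
  have rw: "radial_weight \<omega> u"
  proof
    show "(\<lambda>s. indicator {0..<1} s * \<omega> (of_real s)) \<in> borel_measurable lebesgue"
      using borel_measurable_integrable[OF w_int] by (simp add: w_def)
    show "AE s in lborel. s \<in> {0..<1} \<longrightarrow> \<omega> (of_real s) = u s"
      using u_AE by eventually_elim (auto simp: w_def)
    have "(\<integral>\<^sup>+s. indicator {0..<1} s * ennreal (u s) \<partial>lborel) \<le> (\<integral>\<^sup>+s. ennreal (u s) \<partial>lborel)"
      by (intro nn_integral_mono) (auto split: split_indicator)
    also have "\<dots> = (\<integral>\<^sup>+s. ennreal (u s) \<partial>lebesgue)" by (rule nn_integral_completion[symmetric])
    also have "\<dots> = (\<integral>\<^sup>+s. ennreal (norm (w s)) \<partial>lebesgue)"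
    proof (rule nn_integral_cong_AE, rule eventually_mono[OF AE_completion[OF u_AE]])
      fix s assume "w s = u s"
      then show "ennreal (u s) = ennreal (norm (w s))" using w0[of s] by simp
    qed
    also have "\<dots> < \<infinity>" using w_int by (simp add: integrable_iff_bounded)
    finally show "(\<integral>\<^sup>+s. indicator {0..<1} s * ennreal (u s) \<partial>lborel) < \<infinity>" .
  qed (use D u_meas in \<open>auto simp: u_def\<close>)
  interpret radial_weight \<omega> u by (rule rw)
  obtain m :: nat where m: "C < 2 ^ m" using real_arch_pow[of 2 C] by auto
  have hat: "weight_hat \<omega> (of_real r) = \<mu>.tail r" if "0 \<le> r" "r < 1" for r
    using weight_hat_eq[of "of_real r"] that by simp
  have "doubling_weight \<omega> u m"
  proof
    fix r :: real assume r: "0 \<le> r" "r < 1"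
    show "0 < \<mu>.tail r" using D(3)[of "of_real r"] r by (simp add: hat)
    have r2: "0 \<le> (1 + r) / 2" "(1 + r) / 2 < 1" using r by auto
    have "\<mu>.tail r \<le> C * \<mu>.tail ((1 + r) / 2)" using C(2)[OF r] by (simp only: hat[OF r] hat[OF r2])
    also have "\<dots> \<le> 2 ^ m * \<mu>.tail ((1 + r) / 2)" using m by (intro mult_right_mono) auto
    finally show "\<mu>.tail r \<le> 2 ^ m * \<mu>.tail ((1 + r) / 2)" .
  qed
  then show ?thesis by (rule that)
qed

theorem theorem7:
  fixes \<omega> :: "complex \<Rightarrow> real"
  assumes "\<omega> \<in> D_hat"
  shows "(\<forall>q>0. \<exists>C>0. \<forall>f\<in>bergman_space q \<omega>. \<forall>z\<in>\<bbbD>.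
            cmod (f z) powr q
              \<le> C * (LINT \<zeta>|dA. cmod (f \<zeta>) powr q * berezin_kernel \<omega> z \<zeta> * \<omega> \<zeta>))
       \<and> (\<forall>t>1. \<exists>C>0. \<forall>p q. 0 < q \<and> q < p \<and> p / q = t \<longrightarrow>
            (\<forall>f\<in>bergman_space p \<omega>. \<forall>\<epsilon>>0.
               exceptional_set \<omega> \<epsilon> q f \<in> sets dA \<and>
               (LINT z:exceptional_set \<omega> \<epsilon> q f|dA. cmod (f z) powr p * \<omega> z)
                 \<le> (C * \<epsilon>) powr (p / q) * bergman_norm p \<omega> f powr p))
       \<and> (\<forall>p q. 0 < q \<and> q < p \<longrightarrow>
            (\<exists>\<epsilon>>0. \<forall>f\<in>bergman_space p \<omega>.
               (LINT z:\<bbbD> - exceptional_set \<omega> \<epsilon> q f|dA. cmod (f z) powr p * \<omega> z)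
                 \<ge> 1 / 2 * bergman_norm p \<omega> f powr p))
       \<and> (\<forall>p q. 0 < q \<and> q < p \<longrightarrow>
            (\<exists>\<epsilon>\<^sub>0>0. \<forall>\<epsilon>. 0 < \<epsilon> \<and> \<epsilon> \<le> \<epsilon>\<^sub>0 \<longrightarrow>
               (\<forall>f\<in>bergman_space p \<omega>. dominating_set p \<omega> f (\<bbbD> - exceptional_set \<omega> \<epsilon> q f))))"
proof -
  obtain u m where "doubling_weight \<omega> u m" using D_hat_doubling_weight[OF assms] .
  then interpret doubling_weight \<omega> u m .
  \<comment> \<open>One threshold serves both remaining claims, uniformly in \<open>f\<close>: for
    \<open>\<epsilon> \<le> 1 / (2 * C)\<close> the factor \<open>(C * \<epsilon>) powr t\<close> is
    at most \<open>(1 / 2) powr t\<close>, and this is at most 1/2 because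
    \<open>t > 1\<close>.\<close>
  have main: "\<exists>\<epsilon>\<^sub>0>0. \<forall>\<epsilon>. 0 < \<epsilon> \<and> \<epsilon> \<le> \<epsilon>\<^sub>0 \<longrightarrow> (\<forall>f\<in>bergman_space p \<omega>. exceptional_set \<omega> \<epsilon> q f \<in> sets dA \<and>
      1 / 2 * bergman_norm p \<omega> f powr p \<le> (LINT z:\<bbbD> - exceptional_set \<omega> \<epsilon> q f|dA. cmod (f z) powr p * \<omega> z))"
    if pq: "0 < q" "q < p" for p q
  proof -
    define t where "t = p / q"
    have t: "1 < t" using pq by (simp add: t_def less_divide_eq)
    obtain C where C: "C > 0" "\<And>f \<epsilon>. f \<in> bergman_space p \<omega> \<Longrightarrow> \<epsilon> > 0 \<Longrightarrow> exceptional_set \<omega> \<epsilon> q f \<in> sets dA \<and>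
      (LINT z:exceptional_set \<omega> \<epsilon> q f|dA. cmod (f z) powr p * \<omega> z) \<le> (C * \<epsilon>) powr t * bergman_norm p \<omega> f powr p"
      using exceptional_set_bound[OF t] pq t_def by blast
    have "1 / 2 * bergman_norm p \<omega> f powr p \<le> (LINT z:\<bbbD> - exceptional_set \<omega> \<epsilon> q f|dA. cmod (f z) powr p * \<omega> z)"
      if f: "f \<in> bergman_space p \<omega>" and \<epsilon>: "0 < \<epsilon>" "\<epsilon> \<le> 1 / (2 * C)" for f \<epsilon>
    proof (rule complement_bound[OF f])
      show "0 < p" using pq by simp
      show "exceptional_set \<omega> \<epsilon> q f \<in> sets dA" using C(2)[OF f \<epsilon>(1)] by blast
      have "C * \<epsilon> \<le> 1 / 2" using \<epsilon> C(1) by (simp add: field_simps)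
      then have "(C * \<epsilon>) powr t \<le> (1 / 2) powr t" using \<epsilon> C(1) t by (intro powr_mono2) auto
      also have "\<dots> \<le> (1 / 2) powr 1" using t by (intro powr_mono') auto
      finally have "(C * \<epsilon>) powr t * bergman_norm p \<omega> f powr p \<le> 1 / 2 * bergman_norm p \<omega> f powr p"
        by (intro mult_right_mono) auto
      then show "(LINT z:exceptional_set \<omega> \<epsilon> q f|dA. cmod (f z) powr p * \<omega> z) \<le> 1 / 2 * bergman_norm p \<omega> f powr p"
        using C(2)[OF f \<epsilon>(1)] by linarith
    qed
    then show ?thesis using C by (intro exI[of _ "1 / (2 * C)"]) auto
  qed
  show ?thesis
  proof (intro conjI)
    show "\<forall>q>0. \<exists>C>0. \<forall>f\<in>bergman_space q \<omega>. \<forall>z\<in>\<bbbD>. cmod (f z) powr q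
        \<le> C * (LINT \<zeta>|dA. cmod (f \<zeta>) powr q * berezin_kernel \<omega> z \<zeta> * \<omega> \<zeta>)"
      using berezin_pointwise_bound by blast
    show "\<forall>t>1. \<exists>C>0. \<forall>p q. 0 < q \<and> q < p \<and> p / q = t \<longrightarrow>
            (\<forall>f\<in>bergman_space p \<omega>. \<forall>\<epsilon>>0.
               exceptional_set \<omega> \<epsilon> q f \<in> sets dA \<and>
               (LINT z:exceptional_set \<omega> \<epsilon> q f|dA. cmod (f z) powr p * \<omega> z)
                 \<le> (C * \<epsilon>) powr (p / q) * bergman_norm p \<omega> f powr p)"
      using exceptional_set_bound by blast
    show "\<forall>p q. 0 < q \<and> q < p \<longrightarrow> (\<exists>\<epsilon>>0. \<forall>f\<in>bergman_space p \<omega>.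
               (LINT z:\<bbbD> - exceptional_set \<omega> \<epsilon> q f|dA. cmod (f z) powr p * \<omega> z)
                 \<ge> 1 / 2 * bergman_norm p \<omega> f powr p)"
    proof (intro allI impI)
      fix p q :: real assume "0 < q \<and> q < p"
      then obtain \<epsilon>\<^sub>0 where "\<epsilon>\<^sub>0 > 0" "\<forall>\<epsilon>. 0 < \<epsilon> \<and> \<epsilon> \<le> \<epsilon>\<^sub>0 \<longrightarrow> (\<forall>f\<in>bergman_space p \<omega>. exceptional_set \<omega> \<epsilon> q f \<in> sets dA \<and>
        1 / 2 * bergman_norm p \<omega> f powr p \<le> (LINT z:\<bbbD> - exceptional_set \<omega> \<epsilon> q f|dA. cmod (f z) powr p * \<omega> z))"
        using main[of q p] by blast
      then show "\<exists>\<epsilon>>0. \<forall>f\<in>bergman_space p \<omega>.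
               (LINT z:\<bbbD> - exceptional_set \<omega> \<epsilon> q f|dA. cmod (f z) powr p * \<omega> z)
                 \<ge> 1 / 2 * bergman_norm p \<omega> f powr p"
        by (intro exI[of _ \<epsilon>\<^sub>0]) blast
    qed
    show "\<forall>p q. 0 < q \<and> q < p \<longrightarrow> (\<exists>\<epsilon>\<^sub>0>0. \<forall>\<epsilon>. 0 < \<epsilon> \<and> \<epsilon> \<le> \<epsilon>\<^sub>0 \<longrightarrow>
               (\<forall>f\<in>bergman_space p \<omega>. dominating_set p \<omega> f (\<bbbD> - exceptional_set \<omega> \<epsilon> q f)))"
    proof (intro allI impI)
      fix p q :: real assume "0 < q \<and> q < p"
      then obtain \<epsilon>\<^sub>0 where \<epsilon>\<^sub>0: "\<epsilon>\<^sub>0 > 0" "\<And>\<epsilon> f. 0 < \<epsilon> \<Longrightarrow> \<epsilon> \<le> \<epsilon>\<^sub>0 \<Longrightarrow> f \<in> bergman_space p \<omega> \<Longrightarrow>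
        exceptional_set \<omega> \<epsilon> q f \<in> sets dA \<and>
        1 / 2 * bergman_norm p \<omega> f powr p \<le> (LINT z:\<bbbD> - exceptional_set \<omega> \<epsilon> q f|dA. cmod (f z) powr p * \<omega> z)"
        using main[of q p] by blast
      have "dominating_set p \<omega> f (\<bbbD> - exceptional_set \<omega> \<epsilon> q f)"
        if "0 < \<epsilon>" "\<epsilon> \<le> \<epsilon>\<^sub>0" "f \<in> bergman_space p \<omega>" for \<epsilon> f
        unfolding dominating_set_def
      proof (intro conjI exI[of _ "1 / 2"])
        show "\<bbbD> - exceptional_set \<omega> \<epsilon> q f \<in> sets dA"
          using sets.compl_sets[of "exceptional_set \<omega> \<epsilon> q f" dA] \<epsilon>\<^sub>0(2)[OF that] by simp
      qed (use \<epsilon>\<^sub>0(2)[OF that] in auto)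
      then show "\<exists>\<epsilon>\<^sub>0>0. \<forall>\<epsilon>. 0 < \<epsilon> \<and> \<epsilon> \<le> \<epsilon>\<^sub>0 \<longrightarrow>
               (\<forall>f\<in>bergman_space p \<omega>. dominating_set p \<omega> f (\<bbbD> - exceptional_set \<omega> \<epsilon> q f))"
        using \<epsilon>\<^sub>0(1) by blast
    qed
  qed
qed

end
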